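(* Let $F\in\mathbb{K}[[x]][y]$ be a square-free Weierstrass polynomial of degree $d$ over a perfect field $\mathbb{K}$ of characteristic $0$ or greater than $d$. The algorithm $\mathtt{AbhyankarTest}(F)$ described in the context works as specified: it returns True if $F$ is irreducible in $\overline{\mathbb{K}}[[x]][y]$, and False otherwise.
   Context: $\overline{\mathbb{K}}$ is an algebraic closure of $\mathbb{K}$. A polynomial is Weierstrass if it is monic in $y$ and all its lower coefficients vanish at $x=0$. For $N\mid d$ the $N$-th approximate root of $F$ is the unique monic $\psi\in\mathbb{K}[[x]][y]$ of degree $d/N$ with $\deg_y(F-\psi^N)<d-d/N$. For a monic $\psi$ of positive degree, the $\psi$-adic expansion of $G$ is $G=\sum_i a_i\psi^i$ with $\deg_y a_i<\deg_y\psi$. Algorithm $\mathtt{AbhyankarTest}(F)$. Initialise $N=d$, $k=0$, and $v_0=v_x$, the $x$-valuation on $\mathbb{K}[[x]][y]$ (minimum of the $x$-valuations of the coefficients). While $N>1$ do: (1) Let $\psi_k$ be the $N$-th approximate root of $F$ and $F=\sum_i c_i\psi_k^i$ the $\psi_k$-adic expansion of $F$. (2) Let $\mathcal{N}_k(F)$ be the Newton polygon of the set $\mathrm{Conv}\big(\bigcup_{c_i\ne0}\big((i,v_k(c_i\psi_k^i))+(\mathbb{R}^+)^2\big)\big)$, i.e. the union of the compact edges of strictly negative slope of the boundary of this convex set (its unique vertex if there is no such edge). (3) If $(N,v_k(F))\notin\mathcal{N}_k(F)$, or $\mathcal{N}_k(F)$ is not straight (i.e. is not a single segment from a point of abscissa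 $0$ to a point of abscissa $N$), or it is straight of slope $-m/q$ ($q>0$, $q,m$ coprime integers) with $q=1$, return False. (4) Otherwise, with $-m/q$ the slope of $\mathcal{N}_k(F)$, put $q_{k+1}=q$, $m_{k+1}=m$, replace $N$ by $N/q$ and $k$ by $k+1$, and define the new $v_k$ (for the new value of $k$) by $$v_k(G)=\min_i\big(q_kv_{k-1}(a_i\psi_{k-1}^i)+i\,m_k\big),$$ where $G=\sum_ia_i\psi_{k-1}^i$ is the $\psi_{k-1}$-adic expansion of $G\in\mathbb{K}[[x]][y]$. When the loop ends (that is, $N=1$), return True. (All power series are considered with exact, untruncated coefficients.) *)

theory Defs
  imports
    "HOL-Analysis.Polytope"
    "HOL-Algebra.Algebraic_Closure_Type"
    "HOL-Computational_Algebra.Computational_Algebra"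
    "HOL-Library.Extended_Nat"
begin

text \<open>
  Elements of \<open>K[[x]][y]\<close> are rendered as \<^typ>\<open>'a fps poly\<close>: the polynomial variable is \<open>y\<close>,
  the power series variable is \<open>x\<close>. Valuations take values in \<^typ>\<open>enat\<close>, the value of \<open>0\<close>
  being \<open>\<infinity>\<close>.
\<close>

definition perfect_field :: "'a::field itself \<Rightarrow> bool" where
  "perfect_field _ \<longleftrightarrow> CHAR('a) = 0 \<or> surj (\<lambda>a::'a. a ^ CHAR('a))"

definition weierstrass :: "'a::field fps poly \<Rightarrow> bool" where
  "weierstrass F \<longleftrightarrow>
     Polynomial.lead_coeff F = 1 \<and>
     (\<forall>i < Polynomial.degree F. fps_nth (Polynomial.coeff F i) 0 = 0)"

definition base_change_ac :: "'a::field fps poly \<Rightarrow> 'a alg_closure fps poly" where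
  "base_change_ac = map_poly (\<lambda>f. Abs_fps (\<lambda>n. to_ac (fps_nth f n)))"

definition approx_root :: "nat \<Rightarrow> 'a::field fps poly \<Rightarrow> 'a fps poly" where
  "approx_root N F =
     (THE \<psi>. Polynomial.lead_coeff \<psi> = 1 \<and>
        Polynomial.degree \<psi> = Polynomial.degree F div N \<and>
        (F - \<psi> ^ N = 0 \<or>
         Polynomial.degree (F - \<psi> ^ N) < Polynomial.degree F - Polynomial.degree F div N))"

text \<open>
  Since \<open>deg 0 = 0\<close> here, the degree bound on the coefficients allows the coefficient \<open>0\<close>
  exactly because \<open>\<psi>\<close> has positive degree.
\<close>

definition adic_expansion ::
    "'a::field fps poly \<Rightarrow> 'a fps poly \<Rightarrow> nat \<Rightarrow> 'a fps poly" where
  "adic_expansion \<psi> G =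
     (THE a. finite {i. a i \<noteq> 0} \<and>
        (\<forall>i. Polynomial.degree (a i) < Polynomial.degree \<psi>) \<and>
        G = (\<Sum>i | a i \<noteq> 0. a i * \<psi> ^ i))"

definition x_valuation :: "'a::field fps poly \<Rightarrow> enat" where
  "x_valuation G =
     (INF i. if Polynomial.coeff G i = 0 then \<infinity> else enat (subdegree (Polynomial.coeff G i)))"

definition next_valuation ::
    "nat \<Rightarrow> nat \<Rightarrow> 'a::field fps poly \<Rightarrow> ('a fps poly \<Rightarrow> enat) \<Rightarrow> 'a fps poly \<Rightarrow> enat" where
  "next_valuation q m \<psi> v G =
     (INF i. enat q * v (adic_expansion \<psi> G i * \<psi> ^ i) + enat (i * m))"

definition newton_region ::
    "('a::field fps poly \<Rightarrow> enat) \<Rightarrow> 'a fps poly \<Rightarrow> 'a fps poly \<Rightarrow> (real \<times> real) set" where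
  "newton_region v \<psi> F =
     (let c = adic_expansion \<psi> F in
      convex hull (\<Union>i \<in> {i. c i \<noteq> 0}.
        {(real i + s, real (the_enat (v (c i * \<psi> ^ i))) + t) | s t. 0 \<le> s \<and> 0 \<le> t}))"

text \<open>
  The edges are the one-dimensional faces. When no edge is compact of negative slope, the set
  of extreme points consists of the unique vertex.
\<close>

definition compact_negative_edges :: "(real \<times> real) set \<Rightarrow> (real \<times> real) set set" where
  "compact_negative_edges C =
     {e. e face_of C \<and> aff_dim e = 1 \<and> compact e \<and>
         (\<exists>p\<in>e. \<exists>r\<in>e. fst p < fst r \<and> snd r < snd p)}"

definition newton_polygon ::
    "('a::field fps poly \<Rightarrow> enat) \<Rightarrow> 'a fps poly \<Rightarrow> 'a fps poly \<Rightarrow> (real \<times> real) set" where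
  "newton_polygon v \<psi> F =
     (let C = newton_region v \<psi> F; E = compact_negative_edges C in
      if E = {} then {p. p extreme_point_of C} else \<Union>E)"

definition straight :: "nat \<Rightarrow> (real \<times> real) set \<Rightarrow> bool" where
  "straight N P \<longleftrightarrow> (\<exists>a b. P = closed_segment (0, a) (real N, b))"

definition straight_slope :: "nat \<Rightarrow> (real \<times> real) set \<Rightarrow> real" where
  "straight_slope N P =
     (THE s. \<exists>a b. P = closed_segment (0, a) (real N, b) \<and> s = (b - a) / real N)"

text \<open>
  The slope of a straight Newton polygon is strictly negative, so in its reduced form \<open>-m/q\<close>
  with \<open>q > 0\<close> the integer \<open>m\<close> is positive too, and natural numbers suffice.
\<close>

definition slope_fraction :: "real \<Rightarrow> nat \<times> nat" where
  "slope_fraction s =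
     (THE (q, m). 0 < q \<and> coprime q m \<and> s = - (real m / real q))"

text \<open>
  \<open>abhyankar_loop F N v\<close> is the loop entered with the current values \<open>N\<close> and \<open>v = v\<^sub>k\<close>;
  the pair \<open>(q, m)\<close> is \<open>(q\<^bsub>k+1\<^esub>, m\<^bsub>k+1\<^esub>)\<close>.
\<close>

function abhyankar_loop ::
    "'a::field fps poly \<Rightarrow> nat \<Rightarrow> ('a fps poly \<Rightarrow> enat) \<Rightarrow> bool" where
  "abhyankar_loop F N v =
     (if N > 1 then
        (let \<psi> = approx_root N F; P = newton_polygon v \<psi> F in
         if (real N, real (the_enat (v F))) \<notin> P \<or> \<not> straight N P then False
         else (case slope_fraction (straight_slope N P) of (q, m) \<Rightarrow>
           if q = 1 then False
           else abhyankar_loop F (N div q) (next_valuation q m \<psi> v)))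
      else True)"
  by pat_completeness auto

lemma div_less_of_ne_one: "N div q < N" if "1 < N" "q \<noteq> 1" for N q :: nat
  using that by (cases "q = 0") auto

termination
  by (relation "measure (\<lambda>(F, N, v). N)") (auto intro: div_less_of_ne_one)

declare abhyankar_loop.simps [simp del]

definition abhyankar_test :: "'a::field fps poly \<Rightarrow> bool" where
  "abhyankar_test F = abhyankar_loop F (Polynomial.degree F) x_valuation"

end

theory Submission
  imports Defs
begin

text \<open>
  After extending scalars to an algebraically closed field \<open>L\<close>, Puiseux's theorem gives a branch
  \<open>x = t\<^sup>m, y = S(t)\<close> of \<open>F\<close> whose minimal polynomial has degree \<open>m\<close>, so \<open>F\<close> is irreducible iff
  \<open>m = d\<close>. Let \<open>\<nu>\<close> be the order in \<open>t\<close> along this branch.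

  Since \<open>\<nu>(F) = \<infinity>\<close>, a straight Newton polygon determines \<open>\<nu>(\<psi>\<^sub>k)\<close>, and the denominator \<open>q\<close> of
  its slope must divide the part of \<open>m\<close> not yet accounted for. Inductively \<open>v\<^sub>k\<close> is a valuation (an
  augmentation in the sense of MacLane) proportional to \<open>\<nu>\<close> on polynomials of degree less than that of
  \<open>\<psi>\<^sub>k\<close>. If the loop ends, then \<open>d\<close> divides \<open>m\<close>, so \<open>F\<close> is irreducible.

  Conversely, let \<open>m = d\<close>, and let \<open>c\<close> be the next characteristic exponent of \<open>S\<close>. The order in \<open>t\<close> of
  \<open>H(t\<^sup>d, S + u t\<^sup>c)\<close>, with \<open>u\<close> an indeterminate, is a valuation. The minimal polynomial of the
  truncation of \<open>S\<close> below \<open>t\<^sup>c\<close> has initial form linear in \<open>u\<close>, and Tschirnhausen's iteration from it to \<open>\<psi>\<^sub>k\<close>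
  preserves this property. Comparing initial forms in the \<open>\<psi>\<^sub>k\<close>-adic expansion of \<open>F\<close> shows
  that the polygon is straight with slope of denominator \<open>N / gcd(N, c) > 1\<close>.
\<close>

section \<open>Valuations\<close>

text \<open>The order \<nu> along a branch is infinite at \<open>F\<close>, hence
  \<open>valuation\<close> admits infinite values off zero, and \<nu> can only bound a multiple of
  the loop's \<open>v\<close> from above. Agreement of the two below the degree of the current
  approximate root is just enough to prove the next \<open>v\<close> multiplicative. The obstacle is
  that approximate roots are characterised by degrees alone, which says nothing about their values.
  They are therefore reached by Tschirnhausen iteration from a polynomial of known value: from
  \<open>y\<close> or a power of the preceding root to control \<open>v\<close>, from the norm of a
  truncated series to control initial forms. \<open>division_stable\<close> is the property that
  fixes the value along the iteration. Along \<open>S\<close> alone leading terms may cancel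
  unnoticed. The indeterminate \<open>u\<close> turns this question into one about polynomials in
  \<open>u\<close>, where powers of a nonconstant initial form are independent. Invertibility of the
  integers up to \<open>d\<close> enters in the division by \<open>N\<close>, in Puiseux's theorem
  and in counting roots of unity. The runs over the base field and over its closure coincide,
  because roots, expansions and polygons commute with base change.\<close>

locale valuation =
  fixes v :: "'r::idom \<Rightarrow> enat"
  assumes zero [simp]: "v 0 = \<infinity>"
    and one [simp]: "v 1 = 0"
    and mult: "v (a * b) = v a + v b"
    and add_ge: "min (v a) (v b) \<le> v (a + b)"
begin

lemma minus_one: "v (- 1) = 0"
proof -
  have "v (-1) + v (-1) = 0"
    using mult[of "-1" "-1"] by simp
  then show ?thesis by simp
qed

lemma minus [simp]: "v (- a) = v a"
  using mult[of "-1" a] minus_one by simp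

lemma diff_ge: "min (v a) (v b) \<le> v (a - b)"
  using add_ge[of a "-b"] by simp

lemma power: "v (a ^ n) = enat n * v a"
  by (induction n) (auto simp: mult zero_enat_def[symmetric] eSuc_enat[symmetric] mult_eSuc)

lemma sum_ge: "(\<And>i. i \<in> A \<Longrightarrow> k \<le> v (f i)) \<Longrightarrow> k \<le> v (sum f A)"
proof (induction A rule: infinite_finite_induct)
  case (insert x F)
  then have "k \<le> min (v (f x)) (v (sum f F))" by auto
  also have "\<dots> \<le> v (f x + sum f F)" by (rule add_ge)
  finally show ?case using insert by simp
qed auto

lemma sum_greater:
  "(\<And>i. i \<in> A \<Longrightarrow> k < v (f i)) \<Longrightarrow> k < \<infinity> \<Longrightarrow> k < v (sum f A)"
proof (induction A rule: infinite_finite_induct)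
  case (insert x F)
  then have "k < min (v (f x)) (v (sum f F))" by auto
  also have "\<dots> \<le> v (f x + sum f F)" by (rule add_ge)
  finally show ?case using insert by simp
qed auto

text \<open>Truncated subtraction moves \<open>l\<close> to the other side, which reduces the claim
  to \<open>sum_ge\<close>; for \<open>k < l\<close> both inequalities hold trivially. The strict
  version below works the same way with \<open>Suc k\<close>.\<close>

lemma sum_add_ge: "(\<And>x. x \<in> A \<Longrightarrow> enat k \<le> v (f x) + enat l) \<Longrightarrow> enat k \<le> v (sum f A) + enat l"
proof -
  have iff: "enat k \<le> x + enat l \<longleftrightarrow> enat (k - l) \<le> x" for x
    by (cases x) auto
  show "(\<And>x. x \<in> A \<Longrightarrow> enat k \<le> v (f x) + enat l) \<Longrightarrow> enat k \<le> v (sum f A) + enat l"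
    unfolding iff by (rule sum_ge)
qed

lemma sum_add_greater: "(\<And>x. x \<in> A \<Longrightarrow> enat k < v (f x) + enat l) \<Longrightarrow> enat k < v (sum f A) + enat l"
proof -
  have iff: "enat k < x + enat l \<longleftrightarrow> enat (Suc k - l) \<le> x" for x
    by (cases x) auto
  show "(\<And>x. x \<in> A \<Longrightarrow> enat k < v (f x) + enat l) \<Longrightarrow> enat k < v (sum f A) + enat l"
    unfolding iff by (rule sum_ge)
qed

lemma add_eq: "v (a + b) = v a" if "v a < v b"
proof (rule antisym)
  show "v a \<le> v (a + b)"
    using add_ge[of a b] that by auto
  have "min (v (a + b)) (v b) \<le> v a"
    using diff_ge[of "a + b" b] by simp
  then show "v (a + b) \<le> v a"
    using that by (auto simp: min_def split: if_splits)
qed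

lemma unit: "v a = 0" if "a * b = 1"
  using mult[of a b] that by simp

end

lemma valuation_scale: "valuation v \<Longrightarrow> 0 < q \<Longrightarrow> valuation (\<lambda>a. enat q * v a)"
proof (unfold_locales)
  fix a b assume v: "valuation v" and q: "0 < q"
  then show "enat q * v 0 = \<infinity>"
    by (simp add: valuation.zero imult_is_infinity zero_enat_def)
  show "enat q * v 1 = 0" by (simp add: v valuation.one)
  show "enat q * v (a * b) = enat q * v a + enat q * v b"
    by (simp add: v valuation.mult distrib_left)
  have "min (enat q * v a) (enat q * v b) = enat q * min (v a) (v b)"
    by (auto simp: min_def mult_left_mono intro!: antisym)
  also have "\<dots> \<le> enat q * v (a + b)"
    by (intro mult_left_mono valuation.add_ge v) simp
  finally show "min (enat q * v a) (enat q * v b) \<le> enat q * v (a + b)" .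
qed

lemma enat_mult_less_cancel: "enat q * x < enat q * y \<longleftrightarrow> x < y" if "0 < q"
  using that by (cases x; cases y) (auto simp: imult_is_infinity zero_enat_def)

lemma enat_mult_eq_cancel: "enat q * x = enat q * y \<longleftrightarrow> x = y" if "0 < q"
  using that by (cases x; cases y) (auto simp: imult_is_infinity zero_enat_def)

lemma INF_enat_attained: "\<exists>i. (INF i. f i) = (f i :: enat)"
proof -
  have "Inf (range f) \<in> range f"
    unfolding Inf_enat_def using LeastI_ex[of "\<lambda>x. x \<in> range f"] by auto
  then show ?thesis by auto
qed

definition gauss :: "('r::zero \<Rightarrow> enat) \<Rightarrow> nat \<Rightarrow> 'r poly \<Rightarrow> enat" where
  "gauss v \<mu> A = (INF i. v (coeff A i) + enat (i * \<mu>))"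

text \<open>\<open>i\<close> is the first index at which the minimum \<open>w\<close> is attained.
  Choosing the first one leaves a single term of least weight in the coefficient
  \<open>i + j\<close> of a product, as in Gauss's lemma.\<close>

definition initial_at :: "('r::zero \<Rightarrow> enat) \<Rightarrow> nat \<Rightarrow> 'r poly \<Rightarrow> nat \<Rightarrow> nat \<Rightarrow> bool" where
  "initial_at v \<mu> A w i \<longleftrightarrow>
     (\<forall>j. enat w \<le> v (coeff A j) + enat (j * \<mu>)) \<and>
     (\<forall>j<i. enat w < v (coeff A j) + enat (j * \<mu>)) \<and>
     v (coeff A i) + enat (i * \<mu>) = enat w"

lemma gauss_le: "gauss v \<mu> A \<le> v (coeff A i) + enat (i * \<mu>)"
  unfolding gauss_def by (rule INF_lower) simp

lemma gauss_geI: "(\<And>i. k \<le> v (coeff A i) + enat (i * \<mu>)) \<Longrightarrow> k \<le> gauss v \<mu> A"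
  unfolding gauss_def by (rule INF_greatest) simp

lemma gauss_attained: "\<exists>i. gauss v \<mu> A = v (coeff A i) + enat (i * \<mu>)"
  unfolding gauss_def by (rule INF_enat_attained)

lemma gauss_eq_initial: "initial_at v \<mu> A w i \<Longrightarrow> gauss v \<mu> A = enat w"
  by (rule antisym) (auto simp: initial_at_def intro!: gauss_geI, metis gauss_le)

lemma initial_exists:
  assumes "gauss v \<mu> A \<noteq> \<infinity>"
  obtains w i where "initial_at v \<mu> A w i" "gauss v \<mu> A = enat w"
proof -
  obtain w where w: "gauss v \<mu> A = enat w" using assms by auto
  define i where "i = (LEAST i. gauss v \<mu> A = v (coeff A i) + enat (i * \<mu>))"
  have 1: "gauss v \<mu> A = v (coeff A i) + enat (i * \<mu>)"
    unfolding i_def using gauss_attained by (rule LeastI_ex)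
  have 2: "gauss v \<mu> A \<noteq> v (coeff A j) + enat (j * \<mu>)" if "j < i" for j
    using not_less_Least that unfolding i_def by blast
  have "initial_at v \<mu> A w i"
    unfolding initial_at_def w[symmetric]
    using 1 2 gauss_le[of v \<mu> A] by (simp add: order.strict_iff_order)
  then show ?thesis using that w by blast
qed

text \<open>Gauss's lemma, stopped before the value of the coefficient \<open>i + j\<close> is
  computed. Main term and remainder stay apart because for adic expansions the product of
  coefficients must still be divided by \<psi>.\<close>

lemma initial_at_mult:
  assumes v: "valuation v" and A: "initial_at v \<mu> A w i" and B: "initial_at v \<mu> B u j"
  shows "enat (w + u) \<le> v (coeff (A * B) n) + enat (n * \<mu>)"
    and "n < i + j \<Longrightarrow> enat (w + u) < v (coeff (A * B) n) + enat (n * \<mu>)"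
    and "\<exists>R. coeff (A * B) (i + j) = coeff A i * coeff B j + R \<and>
          enat (w + u) < v R + enat ((i + j) * \<mu>)"
proof -
  interpret valuation v by (rule v)
  have le: "enat (w + u) \<le> v (coeff A k * coeff B l) + enat ((k + l) * \<mu>)" for k l
  proof -
    have "enat w + enat u \<le> (v (coeff A k) + enat (k * \<mu>)) + (v (coeff B l) + enat (l * \<mu>))"
      using A B unfolding initial_at_def by (intro add_mono) auto
    then show ?thesis by (simp add: mult algebra_simps plus_enat_simps(1)[symmetric] del: plus_enat_simps)
  qed
  have less: "enat (w + u) < v (coeff A k * coeff B l) + enat ((k + l) * \<mu>)"
    if "k < i \<or> l < j" for k l
  proof -
    have w: "enat w \<le> v (coeff A k) + enat (k * \<mu>)" "enat u \<le> v (coeff B l) + enat (l * \<mu>)"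
      "k < i \<Longrightarrow> enat w < v (coeff A k) + enat (k * \<mu>)"
      "l < j \<Longrightarrow> enat u < v (coeff B l) + enat (l * \<mu>)"
      using A B unfolding initial_at_def by auto
    have "enat w + enat u < (v (coeff A k) + enat (k * \<mu>)) + (v (coeff B l) + enat (l * \<mu>))"
      using that w by (cases "v (coeff A k)"; cases "v (coeff B l)") auto
    then show ?thesis by (simp add: mult algebra_simps plus_enat_simps(1)[symmetric] del: plus_enat_simps)
  qed
  show "enat (w + u) \<le> v (coeff (A * B) n) + enat (n * \<mu>)"
    unfolding coeff_mult using le by (intro sum_add_ge) (metis atMost_iff le_add_diff_inverse)
  show "enat (w + u) < v (coeff (A * B) n) + enat (n * \<mu>)" if "n < i + j"
    unfolding coeff_mult
  proof (intro sum_add_greater)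
    fix x assume "x \<in> {..n}"
    then have x: "x + (n - x) = n" by simp
    with that have "x < i \<or> n - x < j" by linarith
    from less[OF this] show "enat (w + u) < v (coeff A x * coeff B (n - x)) + enat (n * \<mu>)"
      by (simp add: x)
  qed
  define R where "R = (\<Sum>x\<in>{..i+j}-{i}. coeff A x * coeff B (i + j - x))"
  have "coeff (A * B) (i + j) = coeff A i * coeff B j + R"
    unfolding coeff_mult R_def by (subst sum.remove[of _ i]) auto
  moreover have "enat (w + u) < v R + enat ((i + j) * \<mu>)"
    unfolding R_def
  proof (intro sum_add_greater)
    fix x assume "x \<in> {..i + j} - {i}"
    then have x: "x + (i + j - x) = i + j" and "x < i \<or> i + j - x < j" by auto
    from less[OF this(2)] show "enat (w + u) < v (coeff A x * coeff B (i + j - x)) + enat ((i + j) * \<mu>)"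
      by (simp add: x)
  qed
  ultimately show "\<exists>R. coeff (A * B) (i + j) = coeff A i * coeff B j + R \<and>
          enat (w + u) < v R + enat ((i + j) * \<mu>)" by blast
qed

section \<open>Expansions in powers of a monic polynomial\<close>

definition reduced :: "'r::idom poly \<Rightarrow> 'r poly poly \<Rightarrow> bool" where
  "reduced \<psi> A \<longleftrightarrow> (\<forall>i. degree (coeff A i) < degree \<psi>)"

text \<open>A polynomial over the polynomial ring represents the expansion, so that summation is
  evaluation at \<psi> and the product of two expansions is a polynomial product, up to
  carries.\<close>

definition adic :: "'r::idom poly \<Rightarrow> 'r poly \<Rightarrow> 'r poly poly" where
  "adic \<psi> H = (THE A. reduced \<psi> A \<and> poly A \<psi> = H)"

lemma reduced_pCons: "reduced \<psi> (pCons a A) \<longleftrightarrow> degree a < degree \<psi> \<and> reduced \<psi> A"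
  unfolding reduced_def by (auto simp: coeff_pCons split: nat.splits)

lemma reduced_0 [simp]: "0 < degree \<psi> \<Longrightarrow> reduced \<psi> 0"
  unfolding reduced_def by simp

lemma reduced_add: "reduced \<psi> A \<Longrightarrow> reduced \<psi> B \<Longrightarrow> reduced \<psi> (A + B)"
  unfolding reduced_def by (simp add: degree_add_less)

lemma reduced_diff: "reduced \<psi> A \<Longrightarrow> reduced \<psi> B \<Longrightarrow> reduced \<psi> (A - B)"
  unfolding reduced_def by (simp add: degree_diff_less)

text \<open>The coefficients only form a domain, but pseudo-division by a monic polynomial
  multiplies by a power of 1 and so is an honest division.\<close>

lemma monic_division:
  fixes \<psi> :: "'r::idom poly"
  assumes "lead_coeff \<psi> = 1" "0 < degree \<psi>"
  obtains q r where "H = q * \<psi> + r" "degree r < degree \<psi>"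
proof -
  obtain q r where qr: "pseudo_divmod H \<psi> = (q, r)" by force
  have nz: "\<psi> \<noteq> 0" using assms by auto
  from pseudo_divmod[OF nz qr] assms have "H = q * \<psi> + r" "degree r < degree \<psi>"
    by (auto simp: mult.commute)
  then show ?thesis by (rule that)
qed

lemma degree_mult_monic:
  fixes \<psi> :: "'r::idom poly"
  assumes "lead_coeff \<psi> = 1" "q \<noteq> 0"
  shows "degree (q * \<psi>) = degree q + degree \<psi>"
  using assms by (intro degree_mult_eq) auto

lemma monic_division_unique:
  fixes \<psi> :: "'r::idom poly"
  assumes "lead_coeff \<psi> = 1" "q * \<psi> + r = q' * \<psi> + r'"
    "degree r < degree \<psi>" "degree r' < degree \<psi>"
  shows "q = q'" "r = r'"
proof -
  have eq: "(q - q') * \<psi> = r' - r" using assms(2) by (simp add: algebra_simps)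
  have "degree (r' - r) < degree \<psi>" using assms by (simp add: degree_diff_less)
  then show "q = q'"
    using degree_mult_monic[OF assms(1), of "q - q'"] eq by fastforce
  then show "r = r'" using assms(2) by simp
qed

lemma degree_poly_pCons:
  fixes \<psi> :: "'r::idom poly"
  assumes "lead_coeff \<psi> = 1" "degree a < degree \<psi>" "poly A \<psi> \<noteq> 0"
  shows "degree (poly (pCons a A) \<psi>) = degree \<psi> + degree (poly A \<psi>)"
proof -
  have "degree (\<psi> * poly A \<psi>) = degree \<psi> + degree (poly A \<psi>)"
    using assms by (subst degree_mult_eq) auto
  then show ?thesis using assms by (simp add: degree_add_eq_right)
qed

lemma poly_reduced_eq_0:
  fixes \<psi> :: "'r::idom poly"
  assumes "lead_coeff \<psi> = 1" "reduced \<psi> A" "poly A \<psi> = 0"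
  shows "A = 0"
  using assms(2,3)
proof (induction A)
  case (pCons a A)
  have "a + poly A \<psi> * \<psi> = 0" using pCons by (simp add: mult.commute)
  then have "poly A \<psi> * \<psi> + a = 0 * \<psi> + 0" by (simp add: add.commute)
  from monic_division_unique[OF assms(1) this] pCons.prems
  have "poly A \<psi> = 0" "a = 0" by (auto simp: reduced_pCons)
  with pCons show ?case by (auto simp: reduced_pCons)
qed simp

lemma reduced_unique:
  fixes \<psi> :: "'r::idom poly"
  assumes "lead_coeff \<psi> = 1" "reduced \<psi> A" "reduced \<psi> B" "poly A \<psi> = poly B \<psi>"
  shows "A = B"
  using poly_reduced_eq_0[OF assms(1) reduced_diff[OF assms(2,3)]] assms(4) by simp

lemma reduced_exists:
  fixes \<psi> :: "'r::idom poly"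
  assumes "lead_coeff \<psi> = 1" "0 < degree \<psi>"
  shows "\<exists>A. reduced \<psi> A \<and> poly A \<psi> = H"
proof (induction "degree H" arbitrary: H rule: less_induct)
  case less
  obtain q r where qr: "H = q * \<psi> + r" "degree r < degree \<psi>"
    using monic_division[OF assms] by metis
  show ?case
  proof (cases "q = 0")
    case True
    with qr assms show ?thesis by (intro exI[of _ "[:r:]"]) (simp add: reduced_pCons)
  next
    case False
    have "degree H = degree (q * \<psi>)"
      using qr degree_mult_monic[OF assms(1) False] by (simp add: degree_add_eq_left)
    then have "degree q < degree H"
      using degree_mult_monic[OF assms(1) False] assms by simp
    from less[OF this] obtain A where "reduced \<psi> A" "poly A \<psi> = q" by blast
    with qr show ?thesis
      by (intro exI[of _ "pCons r A"]) (simp add: reduced_pCons mult.commute add.commute)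
  qed
qed

locale monic_poly =
  fixes \<psi> :: "'r::idom poly"
  assumes monic: "lead_coeff \<psi> = 1" and deg_pos: "0 < degree \<psi>"
begin

lemma nonzero: "\<psi> \<noteq> 0" using deg_pos by auto

lemma adic_ex1: "\<exists>!A. reduced \<psi> A \<and> poly A \<psi> = H"
  using reduced_exists[OF monic deg_pos] reduced_unique[OF monic] by metis

lemma adic_reduced: "reduced \<psi> (adic \<psi> H)" and poly_adic: "poly (adic \<psi> H) \<psi> = H"
  using theI'[OF adic_ex1[of H]] unfolding adic_def by auto

lemma degree_coeff_adic: "degree (coeff (adic \<psi> H) i) < degree \<psi>"
  using adic_reduced unfolding reduced_def by blast

lemma adicI: "reduced \<psi> A \<Longrightarrow> poly A \<psi> = H \<Longrightarrow> adic \<psi> H = A"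
  using adic_ex1[of H] adic_reduced poly_adic by metis

lemma adic_0 [simp]: "adic \<psi> 0 = 0" by (rule adicI) (auto simp: deg_pos)

lemma adic_eq_0_iff [simp]: "adic \<psi> H = 0 \<longleftrightarrow> H = 0"
  using poly_adic[of H] by auto

lemma adic_add: "adic \<psi> (G + H) = adic \<psi> G + adic \<psi> H"
  by (rule adicI) (auto simp: reduced_add adic_reduced poly_adic)

lemma adic_small: "degree a < degree \<psi> \<Longrightarrow> adic \<psi> a = [:a:]"
  by (rule adicI) (auto simp: reduced_pCons deg_pos)

lemma adic_times_plus: "degree r < degree \<psi> \<Longrightarrow> adic \<psi> (q * \<psi> + r) = pCons r (adic \<psi> q)"
  by (rule adicI) (auto simp: reduced_pCons adic_reduced poly_adic algebra_simps)

lemma adic_power: "adic \<psi> (\<psi> ^ n) = monom 1 n"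
  by (rule adicI) (auto simp: poly_monom reduced_def deg_pos coeff_monom)

text \<open>In Horner form every step multiplies by the monic \<psi> and adds a term of smaller
  degree, so the leading term survives.\<close>

lemma degree_poly_reduced:
  "reduced \<psi> A \<Longrightarrow> A \<noteq> 0 \<Longrightarrow>
    degree (poly A \<psi>) = degree A * degree \<psi> + degree (lead_coeff A) \<and>
    lead_coeff (poly A \<psi>) = lead_coeff (lead_coeff A)"
proof (induction A)
  case (pCons a A)
  show ?case
  proof (cases "A = 0")
    case False
    then have "poly A \<psi> \<noteq> 0"
      using poly_reduced_eq_0[OF monic] pCons by (auto simp: reduced_pCons)
    with degree_poly_pCons[OF monic _ this, of a] pCons False
    have 1: "degree (poly (pCons a A) \<psi>) = degree \<psi> + degree (poly A \<psi>)"
      by (auto simp: reduced_pCons)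
    have IH: "degree (poly A \<psi>) = degree A * degree \<psi> + degree (lead_coeff A)"
      "lead_coeff (poly A \<psi>) = lead_coeff (lead_coeff A)"
      using pCons False by (auto simp: reduced_pCons)
    have "lead_coeff (a + \<psi> * poly A \<psi>) = lead_coeff (\<psi> * poly A \<psi>)"
    proof (rule lead_coeff_add_le)
      have "degree (\<psi> * poly A \<psi>) = degree \<psi> + degree (poly A \<psi>)"
        using \<open>poly A \<psi> \<noteq> 0\<close> nonzero by (rule degree_mult_eq[rotated])
      then show "degree a < degree (\<psi> * poly A \<psi>)"
        using pCons by (auto simp: reduced_pCons)
    qed
    then have "lead_coeff (poly (pCons a A) \<psi>) = lead_coeff (poly A \<psi>)"
      by (simp add: lead_coeff_mult monic)
    with 1 IH False show ?thesis by simp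
  qed (use pCons in auto)
qed simp

lemma degree_adic:
  assumes "H \<noteq> 0"
  shows "degree H = degree (adic \<psi> H) * degree \<psi> + degree (lead_coeff (adic \<psi> H))"
    and "lead_coeff H = lead_coeff (lead_coeff (adic \<psi> H))"
  using degree_poly_reduced[OF adic_reduced, of H] assms by (auto simp: poly_adic)

lemma degree_adic_eq:
  assumes "H \<noteq> 0"
  shows "degree (adic \<psi> H) = degree H div degree \<psi>"
proof -
  have "degree H = degree (adic \<psi> H) * degree \<psi> + degree (lead_coeff (adic \<psi> H))"
    using degree_adic(1)[OF assms] .
  then show ?thesis
    using degree_coeff_adic[of H "degree (adic \<psi> H)"] deg_pos by simp
qed

lemma adic_monic:
  assumes "lead_coeff H = 1" "degree H = n * degree \<psi>"
  shows "degree (adic \<psi> H) = n" "coeff (adic \<psi> H) n = 1"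
proof -
  have H: "H \<noteq> 0" using assms by auto
  show 1: "degree (adic \<psi> H) = n"
    using degree_adic_eq[OF H] assms deg_pos by simp
  then have "degree (coeff (adic \<psi> H) n) = 0"
    using degree_adic(1)[OF H] assms by simp
  then obtain c where "coeff (adic \<psi> H) n = [:c:]" by (metis degree_eq_zeroE)
  with degree_adic(2)[OF H] 1 assms show "coeff (adic \<psi> H) n = 1"
    by (simp add: one_pCons)
qed

lemma coeff_adic_eq_0: "degree H < n * degree \<psi> \<Longrightarrow> coeff (adic \<psi> H) n = 0"
proof (cases "H = 0")
  case False
  assume "degree H < n * degree \<psi>"
  then have "degree (adic \<psi> H) < n"
    unfolding degree_adic_eq[OF False] by (simp add: deg_pos less_mult_imp_div_less)
  then show ?thesis by (rule coeff_eq_0)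
qed simp

end

lemma adic_expansion_conv_adic:
  fixes \<psi> :: "'a::field fps poly"
  assumes "lead_coeff \<psi> = 1" "0 < degree \<psi>"
  shows "adic_expansion \<psi> H = coeff (adic \<psi> H)"
  unfolding adic_expansion_def
proof (rule the_equality)
  interpret monic_poly \<psi> by unfold_locales (use assms in auto)
  have poly_sum: "poly A \<psi> = (\<Sum>i | coeff A i \<noteq> 0. coeff A i * \<psi> ^ i)" for A
    unfolding poly_altdef
    by (rule sum.mono_neutral_right) (auto simp: le_degree)
  show "finite {i. coeff (adic \<psi> H) i \<noteq> 0} \<and>
        (\<forall>i. degree (coeff (adic \<psi> H) i) < degree \<psi>) \<and>
        H = (\<Sum>i | coeff (adic \<psi> H) i \<noteq> 0. coeff (adic \<psi> H) i * \<psi> ^ i)"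
    using degree_coeff_adic poly_sum[of "adic \<psi> H"] poly_adic
    by (auto intro: finite_subset[of _ "{..degree (adic \<psi> H)}"] simp: le_degree)
  fix a assume a: "finite {i. a i \<noteq> 0} \<and>
        (\<forall>i. degree (a i) < degree \<psi>) \<and> H = (\<Sum>i | a i \<noteq> 0. a i * \<psi> ^ i)"
  then have "\<forall>\<^sub>\<infinity> n. a n = 0" unfolding MOST_iff_cofinite eventually_cofinite by blast
  then have co: "coeff (Abs_poly a) = a" by (simp add: Abs_poly_inverse)
  have "adic \<psi> H = Abs_poly a"
    by (rule adicI) (use a in \<open>auto simp: reduced_def co poly_sum\<close>)
  then show "a = coeff (adic \<psi> H)" by (simp add: co)
qed

section \<open>Augmented valuations\<close>

lemma min_add_enat: "min (x + enat k) (y + enat k) = min x y + enat k"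
  by (cases x; cases y) auto

text \<open>MacLane's minimality of \<psi> for \<open>v\<close>: adding a remainder never raises the
  value of a multiple of \<psi>. By \<open>division_stable_remainder\<close> division then lowers
  neither part below the value of the dividend.\<close>

definition division_stable :: "('r::idom poly \<Rightarrow> enat) \<Rightarrow> 'r poly \<Rightarrow> bool" where
  "division_stable v \<psi> \<longleftrightarrow> (\<forall>q r. degree r < degree \<psi> \<longrightarrow> v (q * \<psi> + r) \<le> v (q * \<psi>))"

lemma division_stable_remainder:
  assumes "valuation v" "division_stable v \<psi>" "degree r < degree \<psi>"
  shows "v (q * \<psi> + r) \<le> v r"
proof -
  have "v (q * \<psi> + r) \<le> v (q * \<psi>)" using assms unfolding division_stable_def by blast
  then show ?thesis
    using valuation.diff_ge[OF assms(1), of "q * \<psi> + r" "q * \<psi>"] by simp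
qed

text \<open>
  Such a \<open>\<psi>\<close> is a key polynomial for \<open>v\<close> in the sense of MacLane. Key polynomials are usually
  recognized by their residual polynomial; here a second valuation \<open>\<nu>\<close>, agreeing with \<open>c v\<close> in small
  degree and strictly larger at \<open>\<psi>\<close>, plays that part.
\<close>
locale augmentation = v: valuation v + \<nu>: valuation \<nu> + monic_poly \<psi>
  for v \<nu> :: "'r::idom poly \<Rightarrow> enat" and \<psi> :: "'r poly" +
  fixes c q m :: nat
  assumes stable: "division_stable v \<psi>"
    and v_infinity: "v H = \<infinity> \<Longrightarrow> H = 0"
    and \<nu>_ge: "enat c * v H \<le> \<nu> H"
    and \<nu>_eq: "degree a < degree \<psi> \<Longrightarrow> \<nu> a = enat c * v a"
    and \<nu>_greater: "enat c * v \<psi> < \<nu> \<psi>"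
    and c_pos: "0 < c" and q_pos: "0 < q"
begin

text \<open>This is the new value of \<psi>. The summand \<open>q * v \<psi>\<close> appears because
  \<open>next_valuation\<close> applies the old valuation to \<open>a * \<psi> ^ i\<close> and not
  to \<open>a\<close>.\<close>

definition weight :: nat where "weight = q * the_enat (v \<psi>) + m"

definition aug :: "'r poly \<Rightarrow> enat" where
  "aug H = gauss (\<lambda>a. enat q * v a) weight (adic \<psi> H)"

lemma v_\<psi>: "v \<psi> = enat (the_enat (v \<psi>))"
  using v_infinity[of \<psi>] nonzero by (cases "v \<psi>") auto

lemma scaled: "valuation (\<lambda>a. enat q * v a)"
  using q_pos by (intro valuation_scale v.valuation_axioms)

text \<open>
  If \<open>r\<close> had larger value than \<open>s * \<psi> + r\<close>, both summands would have larger \<open>\<nu>\<close>-value than their sum.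
\<close>
lemma key_remainder:
  assumes "\<nu> (s * \<psi> + r) = enat c * v (s * \<psi> + r)" "degree r < degree \<psi>"
  shows "v r = v (s * \<psi> + r)"
proof (rule ccontr)
  let ?C = "s * \<psi> + r"
  assume ne: "v r \<noteq> v ?C"
  have le: "v ?C \<le> v (s * \<psi>)" "v ?C \<le> v r"
    using stable division_stable_remainder[OF v.valuation_axioms stable] assms(2)
    unfolding division_stable_def by auto
  with ne have less: "v ?C < v r" by simp
  then have 1: "enat c * v ?C < \<nu> r"
    using \<nu>_eq[OF assms(2)] c_pos by (simp add: enat_mult_less_cancel)
  have "s \<noteq> 0" using ne by auto
  then have "v s \<noteq> \<infinity>" using v_infinity by auto
  then have "enat c * v s + enat c * v \<psi> < \<nu> s + \<nu> \<psi>"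
    using \<nu>_ge[of s] \<nu>_greater v_\<psi> by (cases "v s"; cases "\<nu> s"; cases "\<nu> \<psi>"; cases "v \<psi>") auto
  moreover have "enat c * v ?C \<le> enat c * v s + enat c * v \<psi>"
    using le(1) by (simp add: v.mult flip: distrib_left) (simp add: mult_left_mono)
  ultimately have "enat c * v ?C < \<nu> (s * \<psi>)"
    by (simp add: \<nu>.mult)
  with 1 have "enat c * v ?C < min (\<nu> (s * \<psi>)) (\<nu> r)" by simp
  also have "\<dots> \<le> \<nu> ?C" by (rule \<nu>.add_ge)
  finally show False using assms(1) by simp
qed

lemma aug_0: "aug 0 = \<infinity>"
  unfolding aug_def gauss_def using q_pos by (simp add: imult_is_infinity zero_enat_def)

lemma aug_infinity: "aug H = \<infinity> \<Longrightarrow> H = 0"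
proof (rule ccontr)
  assume inf: "aug H = \<infinity>" and "H \<noteq> 0"
  then have "lead_coeff (adic \<psi> H) \<noteq> 0" by simp
  then have "v (lead_coeff (adic \<psi> H)) \<noteq> \<infinity>" using v_infinity by blast
  moreover have "enat q * v (lead_coeff (adic \<psi> H)) + enat (degree (adic \<psi> H) * weight) = \<infinity>"
    using inf gauss_le[of "\<lambda>a. enat q * v a" weight "adic \<psi> H" "degree (adic \<psi> H)"]
    unfolding aug_def by simp
  ultimately show False by auto
qed

lemma aug_add_ge: "min (aug G) (aug H) \<le> aug (G + H)"
proof -
  let ?v = "\<lambda>a. enat q * v a"
  have "min (aug G) (aug H) \<le> ?v (coeff (adic \<psi> (G + H)) i) + enat (i * weight)" for i
  proof -
    have "min (aug G) (aug H) \<le> min (?v (coeff (adic \<psi> G) i) + enat (i * weight))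
        (?v (coeff (adic \<psi> H) i) + enat (i * weight))"
      unfolding aug_def by (intro min.mono gauss_le)
    also have "\<dots> = min (?v (coeff (adic \<psi> G) i)) (?v (coeff (adic \<psi> H) i)) + enat (i * weight)"
      by (rule min_add_enat)
    also have "\<dots> \<le> ?v (coeff (adic \<psi> (G + H)) i) + enat (i * weight)"
      unfolding adic_add coeff_add
      by (intro add_right_mono valuation.add_ge[OF scaled])
    finally show ?thesis .
  qed
  then show ?thesis unfolding aug_def[of "G + H"] by (rule gauss_geI)
qed

text \<open>The expansion of the product arises from the product \<open>C\<close> of the expansions
  by one round of carrying. Carries into indices up to \<open>i + j\<close> are too large to matter,
  and at \<open>i + j\<close> the remainder keeps the value of the coefficient by
  \<open>key_remainder\<close>.\<close>

lemma aug_mult_nonzero: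
  assumes "G \<noteq> 0" "H \<noteq> 0"
  shows "aug (G * H) = aug G + aug H"
proof -
  let ?v = "\<lambda>a. enat q * v a"
  define A where "A = adic \<psi> G"
  define B where "B = adic \<psi> H"
  define C where "C = A * B"
  have "gauss ?v weight A \<noteq> \<infinity>" "gauss ?v weight B \<noteq> \<infinity>"
    using aug_infinity assms unfolding A_def B_def aug_def by auto
  then obtain w i u j where wi: "initial_at ?v weight A w i" "aug G = enat w"
    and uj: "initial_at ?v weight B u j" "aug H = enat u"
    by (metis initial_exists A_def B_def aug_def)
  note prod = initial_at_mult[OF scaled wi(1) uj(1), folded C_def]
  \<comment> \<open>Quotient and remainder on division by \<psi>.\<close>
  define dm where "dm a = (SOME p. a = fst p * \<psi> + snd p \<and> degree (snd p) < degree \<psi>)" for a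
  have dm: "a = fst (dm a) * \<psi> + snd (dm a)" "degree (snd (dm a)) < degree \<psi>" for a
  proof -
    have "\<exists>p. a = fst p * \<psi> + snd p \<and> degree (snd p) < degree \<psi>"
      using monic_division[OF monic deg_pos, of a] by (metis fst_conv snd_conv)
    from someI_ex[OF this] show "a = fst (dm a) * \<psi> + snd (dm a)" "degree (snd (dm a)) < degree \<psi>"
      unfolding dm_def by auto
  qed
  have dm0 [simp]: "fst (dm 0) = 0" "snd (dm 0) = 0"
    using monic_division_unique[OF monic, of "fst (dm 0)" "snd (dm 0)" 0 0] dm[of 0] deg_pos by auto
  \<comment> \<open>The remainder stays at its index and the quotient is carried to the next
    one.\<close>
  define D where "D = map_poly (\<lambda>a. snd (dm a)) C + pCons 0 (map_poly (\<lambda>a. fst (dm a)) C)"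
  have D_coeff: "coeff D n = snd (dm (coeff C n)) + (if n = 0 then 0 else fst (dm (coeff C (n - 1))))" for n
    unfolding D_def by (simp add: coeff_map_poly coeff_pCons split: nat.split)
  have "poly (map_poly (\<lambda>a. snd (dm a)) C) \<psi> + \<psi> * poly (map_poly (\<lambda>a. fst (dm a)) C) \<psi> = poly C \<psi>"
  proof (induction C)
    case (pCons a C)
    have "poly (map_poly (\<lambda>a. snd (dm a)) (pCons a C)) \<psi> + \<psi> * poly (map_poly (\<lambda>a. fst (dm a)) (pCons a C)) \<psi>
      = (fst (dm a) * \<psi> + snd (dm a)) + \<psi> * (poly (map_poly (\<lambda>a. snd (dm a)) C) \<psi> + \<psi> * poly (map_poly (\<lambda>a. fst (dm a)) C) \<psi>)"
      using pCons(1) by (subst map_poly_pCons map_poly_pCons; simp)+ (simp add: algebra_simps)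
    also have "\<dots> = a + \<psi> * poly C \<psi>" using dm(1)[of a] pCons by simp
    finally show ?case by simp
  qed simp
  then have "poly D \<psi> = G * H"
    by (simp add: D_def C_def A_def B_def poly_adic)
  moreover have "reduced \<psi> D"
    unfolding reduced_def
  proof
    fix n
    \<comment> \<open>A product of two reduced coefficients has degree at most twice
      \<open>degree \<psi> - 1\<close>, so the quotient is again reduced and no second carry
      arises.\<close>
    have "degree (fst (dm (coeff C l))) < degree \<psi>" for l
    proof (cases "fst (dm (coeff C l)) = 0")
      case False
      have "degree (coeff C l) \<le> 2 * (degree \<psi> - 1)"
        unfolding C_def coeff_mult
      proof (intro degree_sum_le ballI)
        fix x
        have "degree (coeff A x * coeff B (l - x)) \<le> degree (coeff A x) + degree (coeff B (l - x))"
          by (rule degree_mult_le)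
        also have "\<dots> \<le> 2 * (degree \<psi> - 1)"
          using degree_coeff_adic[of G x] degree_coeff_adic[of H "l - x"] unfolding A_def B_def by simp
        finally show "degree (coeff A x * coeff B (l - x)) \<le> 2 * (degree \<psi> - 1)" .
      qed simp
      moreover have "degree (coeff C l) = degree (fst (dm (coeff C l))) + degree \<psi>"
        using dm[of "coeff C l"] degree_mult_monic[OF monic False]
        by (metis degree_add_eq_left trans_less_add2)
      ultimately show ?thesis using deg_pos by simp
    qed (simp add: deg_pos)
    then show "degree (coeff D n) < degree \<psi>"
      unfolding D_coeff using dm(2) by (auto intro!: degree_add_less)
  qed
  ultimately have adic: "adic \<psi> (G * H) = D" using adicI by blast
  have rem: "v a \<le> v (snd (dm a))" "v a \<le> v (fst (dm a) * \<psi>)" for a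
    using dm[of a] stable division_stable_remainder[OF v.valuation_axioms stable]
    unfolding division_stable_def by metis+
  have carry: "?v (coeff C n) + enat (n * weight) \<le> ?v (fst (dm (coeff C n))) + enat (Suc n * weight)" for n
  proof -
    have "?v (coeff C n) + enat (n * weight) \<le> enat q * (v (fst (dm (coeff C n))) + v \<psi>) + enat (n * weight)"
      using rem(2)[of "coeff C n"] by (simp add: v.mult mult_left_mono)
    also have "\<dots> \<le> ?v (fst (dm (coeff C n))) + enat (Suc n * weight)"
      by (subst v_\<psi>, cases "v (fst (dm (coeff C n)))") (auto simp: weight_def algebra_simps)
    finally show ?thesis .
  qed
  have small: "?v (coeff C n) + enat (n * weight) \<le> ?v (snd (dm (coeff C n))) + enat (n * weight)" for n
    using rem(1)[of "coeff C n"] by (simp add: mult_left_mono)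
  have split: "min (?v (snd (dm (coeff C n))) + enat (n * weight)) 
      (?v (if n = 0 then 0 else fst (dm (coeff C (n - 1)))) + enat (n * weight))
      \<le> ?v (coeff D n) + enat (n * weight)" for n
    unfolding D_coeff min_add_enat
    by (intro add_right_mono valuation.add_ge[OF scaled])
  have zero: "?v 0 = \<infinity>" using valuation.zero[OF scaled] .
  \<comment> \<open>The carry into index \<open>n\<close> comes from \<open>n - 1\<close>. For
    \<open>n\<close> up to \<open>i + j\<close> inclusive this lies before the initial index of
    \<open>C\<close>, where the bound is strict.\<close>
  have other: "enat (w + u) \<le> ?v (if n = 0 then 0 else fst (dm (coeff C (n - 1)))) + enat (n * weight)"
    "n \<le> i + j \<Longrightarrow> enat (w + u) < ?v (if n = 0 then 0 else fst (dm (coeff C (n - 1)))) + enat (n * weight)" for n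
    using prod(1)[of "n - 1"] prod(2)[of "n - 1"] carry[of "n - 1"] zero by (cases "n = 0"; force)+
  have "initial_at ?v weight D (w + u) (i + j)"
    unfolding initial_at_def
  proof (intro conjI allI impI)
    fix n
    show "enat (w + u) \<le> ?v (coeff D n) + enat (n * weight)"
      using prod(1)[of n] small[of n] split[of n] other(1)[of n]
      by (meson min.boundedI order_trans)
    show "enat (w + u) < ?v (coeff D n) + enat (n * weight)" if "n < i + j"
      using prod(2)[OF that] small[of n] split[of n] other(2)[of n] that
      by (meson less_imp_le min_less_iff_conj order_less_le_trans)
  next
    let ?n = "i + j"
    obtain R where R: "coeff C ?n = coeff A i * coeff B j + R" "enat (w + u) < ?v R + enat (?n * weight)"
      using prod(3) by blast
    have AB: "?v (coeff A i * coeff B j) + enat (?n * weight) = enat (w + u)"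
    proof -
      have "enat w + enat u = (?v (coeff A i) + enat (i * weight)) + (?v (coeff B j) + enat (j * weight))"
        using wi(1) uj(1) unfolding initial_at_def by simp
      then show ?thesis
        by (simp add: v.mult algebra_simps plus_enat_simps(1)[symmetric] del: plus_enat_simps)
    qed
    have less: "v (coeff A i * coeff B j) < v R"
    proof -
      have "?v (coeff A i * coeff B j) + enat (?n * weight) < ?v R + enat (?n * weight)"
        using AB R(2) by simp
      then have "?v (coeff A i * coeff B j) < ?v R"
        using q_pos by (cases "v (coeff A i * coeff B j)"; cases "v R") auto
      then show ?thesis by (simp only: enat_mult_less_cancel[OF q_pos])
    qed
    then have vC: "v (coeff C ?n) = v (coeff A i * coeff B j)"
      unfolding R(1) by (rule v.add_eq)
    \<comment> \<open>The product may exceed the degree bound of \<open>\<nu>_eq\<close>, but each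
      factor obeys it and both valuations are multiplicative. The larger remainder \<open>R\<close>
      then does not disturb the equality for the coefficient of \<open>C\<close>.\<close>
    have "\<nu> (coeff A i * coeff B j) = enat c * v (coeff A i * coeff B j)"
      using \<nu>_eq degree_coeff_adic unfolding A_def B_def by (simp add: \<nu>.mult v.mult distrib_left)
    moreover have "\<nu> (coeff A i * coeff B j) < \<nu> R"
      using less \<nu>_ge[of R] calculation c_pos enat_mult_less_cancel order_less_le_trans by metis
    ultimately have "\<nu> (coeff C ?n) = enat c * v (coeff C ?n)"
      unfolding vC unfolding R(1) using \<nu>.add_eq by simp
    then have "v (snd (dm (coeff C ?n))) = v (coeff C ?n)"
      using key_remainder dm by metis
    then have val: "?v (snd (dm (coeff C ?n))) + enat (?n * weight) = enat (w + u)"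
      using AB vC by simp
    let ?s = "if ?n = 0 then 0 else fst (dm (coeff C (?n - 1)))"
    have "?v (snd (dm (coeff C ?n))) + enat (?n * weight) < ?v ?s + enat (?n * weight)"
      using other(2)[of ?n] val by simp
    then have "?v (snd (dm (coeff C ?n))) < ?v ?s"
      by (cases "?v (snd (dm (coeff C ?n)))"; cases "?v ?s") auto
    then have "?v (coeff D ?n) = ?v (snd (dm (coeff C ?n)))"
      unfolding D_coeff by (rule valuation.add_eq[OF scaled])
    then show "?v (coeff D ?n) + enat (?n * weight) = enat (w + u)" using val by simp
  qed
  then have "aug (G * H) = enat (w + u)"
    unfolding aug_def adic by (rule gauss_eq_initial)
  then show ?thesis using wi uj by simp
qed

lemma aug_small: "degree a < degree \<psi> \<Longrightarrow> aug a = enat q * v a"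
proof -
  assume a: "degree a < degree \<psi>"
  have "enat q * v (coeff [:a:] i) + enat (i * weight) = (if i = 0 then enat q * v a else \<infinity>)" for i
    using valuation.zero[OF scaled] by (auto simp: coeff_pCons zero_enat_def[symmetric] split: nat.split)
  then have "aug a = (INF i::nat. (if i = 0 then enat q * v a else \<infinity>))"
    unfolding aug_def gauss_def adic_small[OF a] by simp
  also have "\<dots> = enat q * v a"
    by (rule antisym) (auto intro: INF_greatest INF_lower2[of 0])
  finally show ?thesis .
qed

lemma aug_1: "aug 1 = 0"
  using aug_small[of 1] deg_pos by simp

lemma valuation_aug: "valuation aug"
proof
  show "aug (a * b) = aug a + aug b" for a b
    using aug_mult_nonzero[of a b] by (cases "a = 0 \<or> b = 0") (auto simp: aug_0)
qed (use aug_0 aug_1 aug_add_ge in auto)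

lemma aug_\<psi>: "aug \<psi> = enat weight"
proof -
  have "enat q * v (coeff (monom 1 1) i) + enat (i * weight) = (if i = 1 then enat weight else \<infinity>)" for i
    using valuation.zero[OF scaled] by (auto simp: zero_enat_def[symmetric])
  then have "aug \<psi> = (INF i::nat. (if i = 1 then enat weight else \<infinity>))"
    unfolding aug_def gauss_def using adic_power[of 1] by simp
  also have "\<dots> = enat weight"
    by (rule antisym) (auto intro: INF_greatest INF_lower2[of 1])
  finally show ?thesis .
qed

end

lemma next_valuation_conv_aug:
  fixes v :: "'a::field fps poly \<Rightarrow> enat"
  assumes "augmentation v \<nu> \<psi> c q"
  shows "next_valuation q m \<psi> v = augmentation.aug v \<psi> q m"
proof
  fix H
  interpret augmentation v \<nu> \<psi> c q m by (rule assms)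
  have "enat q * v (a * \<psi> ^ i) + enat (i * m) = enat q * v a + enat (i * weight)" for a i
    unfolding v.mult v.power
    by (subst v_\<psi>, cases "v a") (auto simp: weight_def algebra_simps imult_is_infinity)
  then show "next_valuation q m \<psi> v H = aug H"
    unfolding next_valuation_def aug_def gauss_def adic_expansion_conv_adic[OF monic deg_pos] by simp
qed

section \<open>Approximate roots\<close>

text \<open>For \<open>n\<close> invertible the first-order term has degree exactly
  \<open>degree b + (n - 1) * degree P\<close>, and the rest cannot cancel it. Uniqueness of
  approximate roots and progress of the iteration both rest on this.\<close>

lemma binomial_first_order:
  fixes P b :: "'r::idom poly"
  assumes "lead_coeff P = 1" "degree b < degree P" "0 < n"
  shows "\<exists>E. (P + b) ^ n = P ^ n + of_nat n * b * P ^ (n - 1) + E \<and>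
           (E = 0 \<or> degree E < degree b + (n - 1) * degree P)"
  using assms(3)
proof (induction n rule: nat_induct_non_zero)
  case 1
  show ?case by (intro exI[of _ 0]) simp
next
  case (Suc n)
  then obtain E where E: "(P + b) ^ n = P ^ n + of_nat n * b * P ^ (n - 1) + E"
    "E = 0 \<or> degree E < degree b + (n - 1) * degree P" by blast
  let ?E = "of_nat n * b ^ 2 * P ^ (n - 1) + E * P + E * b"
  have "(P + b) ^ Suc n = P ^ Suc n + of_nat (Suc n) * b * P ^ n + ?E"
    using Suc.hyps unfolding power_Suc E(1)
    by (cases n) (simp_all add: algebra_simps power2_eq_square)
  moreover have "degree ?E < degree b + (Suc n - 1) * degree P"
  proof -
    have np: "(n - 1) * degree P + degree P = n * degree P"
      using Suc.hyps by (cases n) auto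
    have "degree (of_nat n * b ^ 2 * P ^ (n - 1)) \<le> degree (of_nat n * b ^ 2) + degree (P ^ (n - 1))"
      by (rule degree_mult_le)
    also have "\<dots> \<le> (degree (of_nat n :: 'r poly) + degree (b ^ 2)) + (n - 1) * degree P"
      using degree_mult_le[of "of_nat n" "b ^ 2"] degree_power_le[of P "n - 1"] by (simp add: mult.commute)
    also have "\<dots> \<le> 2 * degree b + (n - 1) * degree P"
      using degree_power_le[of b 2] by (simp add: mult.commute)
    finally have 1: "degree (of_nat n * b ^ 2 * P ^ (n - 1)) < degree b + n * degree P"
      using assms(2) np by linarith
    have 2: "degree (E * P) < degree b + n * degree P" "degree (E * b) < degree b + n * degree P"
      using E(2) degree_mult_le[of E P] degree_mult_le[of E b] assms(2) np Suc.hyps by auto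
    show ?thesis using 1 2 by (auto intro!: degree_add_less)
  qed
  ultimately show ?case by (metis diff_Suc_1)
qed

lemma degree_monic_power:
  fixes P :: "'r::idom poly"
  assumes "lead_coeff P = 1"
  shows "degree (P ^ n) = n * degree P" "lead_coeff (P ^ n) = 1"
  using assms by (auto simp: degree_power_eq lead_coeff_power)
    (metis degree_power_eq leading_coeff_0_iff zero_neq_one mult.commute)

lemma degree_diff_monic:
  fixes F G :: "'r::idom poly"
  assumes "lead_coeff F = 1" "lead_coeff G = 1" "degree F = degree G" "0 < degree F"
  shows "degree (F - G) < degree F"
proof -
  have "degree (F - G) \<le> degree F" using assms by (intro degree_diff_le) auto
  moreover have "coeff (F - G) (degree F) = 0" using assms by simp
  ultimately show ?thesis
    using assms(4) by (metis degree_0 leading_coeff_0_iff le_neq_implies_less)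
qed

definition is_approx_root :: "nat \<Rightarrow> 'a::field fps poly \<Rightarrow> 'a fps poly \<Rightarrow> bool" where
  "is_approx_root N F \<psi> \<longleftrightarrow> lead_coeff \<psi> = 1 \<and> degree \<psi> = degree F div N \<and>
        (F - \<psi> ^ N = 0 \<or> degree (F - \<psi> ^ N) < degree F - degree F div N)"

lemma of_nat_fps_poly_eq_0_iff: "(of_nat n :: 'a::field fps poly) = 0 \<longleftrightarrow> (of_nat n :: 'a) = 0"
  unfolding of_nat_poly by (simp add: fps_of_nat[symmetric] del: fps_of_nat)

lemma degree_of_nat_mult:
  assumes "(of_nat n :: 'a::field) \<noteq> 0"
  shows "degree (of_nat n * p) = degree (p :: 'a fps poly)"
  using assms of_nat_fps_poly_eq_0_iff[of n, where 'a = 'a] by (cases "p = 0") (auto simp: degree_mult_eq)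

text \<open>If the roots differ by \<open>b \<noteq> 0\<close>, their \<open>N\<close>-th powers
  differ by \<open>of_nat N * b * \<psi> ^ (N - 1)\<close> plus lower terms, whose degree is too
  large for both to approximate \<open>F\<close>.\<close>

lemma is_approx_root_unique:
  fixes F :: "'a::field fps poly"
  assumes "is_approx_root N F \<psi>" "is_approx_root N F \<phi>"
    and N: "(of_nat N :: 'a) \<noteq> 0" and dvd: "N dvd degree F" "0 < degree F"
  shows "\<psi> = \<phi>"
proof (rule ccontr)
  assume ne: "\<psi> \<noteq> \<phi>"
  define b where "b = \<phi> - \<psi>"
  have N0: "0 < N" using N by (auto intro: Nat.gr0I)
  obtain e where e: "degree F = N * e" using dvd by blast
  then have e0: "0 < e" and de: "degree F div N = e" using dvd N0 by auto
  have psi: "lead_coeff \<psi> = 1" "degree \<psi> = e" "lead_coeff \<phi> = 1" "degree \<phi> = e"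
    using assms e N0 unfolding is_approx_root_def by auto
  then have db: "degree b < degree \<psi>" unfolding b_def
    using degree_diff_monic[of \<phi> \<psi>] e0 by auto
  obtain E where E: "(\<psi> + b) ^ N = \<psi> ^ N + of_nat N * b * \<psi> ^ (N - 1) + E"
    "E = 0 \<or> degree E < degree b + (N - 1) * degree \<psi>"
    using binomial_first_order[OF psi(1) db N0] by blast
  have b0: "b \<noteq> 0" using ne b_def by simp
  define D where "D = of_nat N * b * \<psi> ^ (N - 1)"
  have D: "degree D = degree b + (N - 1) * e" "D \<noteq> 0"
    using b0 N psi degree_of_nat_mult[OF N, of b] unfolding D_def
    by (subst degree_mult_eq, auto simp: degree_monic_power of_nat_fps_poly_eq_0_iff)+
  have "\<not> (D + E = 0 \<or> degree (D + E) < (N - 1) * e)"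
  proof (cases "E = 0")
    case False
    then have "degree E < degree D" using E(2) psi(2) D by simp
    then have "degree (D + E) = degree D" by (rule degree_add_eq_left)
    moreover have "D + E \<noteq> 0"
      using \<open>degree E < degree D\<close> by (metis add_eq_0_iff degree_minus less_irrefl)
    ultimately show ?thesis using D by simp
  qed (use D in simp)
  moreover have "F - \<psi> ^ N = 0 \<or> degree (F - \<psi> ^ N) < (N - 1) * e"
    "F - \<phi> ^ N = 0 \<or> degree (F - \<phi> ^ N) < (N - 1) * e"
    using assms(1,2) N0 unfolding is_approx_root_def e by (auto simp: diff_mult_distrib)
  then have "(F - \<psi> ^ N) - (F - \<phi> ^ N) = 0 \<or> degree ((F - \<psi> ^ N) - (F - \<phi> ^ N)) < (N - 1) * e"
    by (metis degree_diff_less diff_0 diff_0_right degree_minus)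
  moreover have "(F - \<psi> ^ N) - (F - \<phi> ^ N) = D + E"
    using E(1) unfolding b_def D_def by (simp add: algebra_simps)
  ultimately show False by simp
qed

lemma approx_rootI:
  assumes "is_approx_root N F \<psi>" "(of_nat N :: 'a::field) \<noteq> 0" "N dvd degree (F :: 'a fps poly)" "0 < degree F"
  shows "approx_root N F = \<psi>"
  unfolding approx_root_def is_approx_root_def[symmetric]
  using assms is_approx_root_unique by blast

text \<open>
  Tschirnhausen iteration: passing from \<open>P\<close> to \<open>P + b / N\<close>, where \<open>b\<close> is the coefficient of
  \<open>P ^ (N - 1)\<close> in the expansion of \<open>F\<close>, lowers the degree of \<open>F - P ^ N\<close>.
\<close>
lemma is_approx_root_induct:
  fixes F :: "'a::field fps poly"
  assumes F: "lead_coeff F = 1" "degree F = N * e" and N: "(of_nat N :: 'a) \<noteq> 0" "2 \<le> N" and e: "0 < e"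
    and start: "Q P"
    and monic: "\<And>P. Q P \<Longrightarrow> lead_coeff P = 1 \<and> degree P = e"
    and step: "\<And>P b r. Q P \<Longrightarrow> F - P ^ N = b * P ^ (N - 1) + r \<Longrightarrow> degree r < (N - 1) * e \<Longrightarrow>
       degree b < e \<Longrightarrow> Q (P + smult (fps_const (1 / of_nat N)) b)"
  shows "\<exists>\<psi>. Q \<psi> \<and> is_approx_root N F \<psi>"
  using start
proof (induction "degree (F - P ^ N)" arbitrary: P rule: less_induct)
  case less
  have P: "lead_coeff P = 1" "degree P = e" using monic less.prems by auto
  interpret monic_poly P by unfold_locales (use P e in auto)
  interpret PN: monic_poly "P ^ (N - 1)"
    by unfold_locales (use degree_monic_power[OF P(1), of "N - 1"] P e N in auto)
  have dq: "degree F div N = e" "degree F - e = (N - 1) * e"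
    using F(2) N(2) by (simp_all add: diff_mult_distrib)
  show ?case
  proof (cases "degree (F - P ^ N) < (N - 1) * e")
    case True
    then have "is_approx_root N F P"
      unfolding is_approx_root_def dq using P dq by simp
    then show ?thesis using less.prems by blast
  next
    case False
    obtain b r where br: "F - P ^ N = b * P ^ (N - 1) + r" "degree r < degree (P ^ (N - 1))"
      using monic_division[OF PN.monic PN.deg_pos] by metis
    then have dr: "degree r < (N - 1) * e" using P(2) by (simp add: degree_monic_power(1)[OF P(1)])
    have b0: "b \<noteq> 0" using False br dr by auto
    have dF: "degree (F - P ^ N) = degree b + (N - 1) * e"
    proof -
      have "degree (b * P ^ (N - 1)) = degree b + (N - 1) * e"
        using degree_mult_monic[OF PN.monic b0] P by (simp add: degree_monic_power)
      then show ?thesis using br dr by (simp add: degree_add_eq_left)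
    qed
    have "degree (F - P ^ N) < N * e"
      using degree_diff_monic[OF F(1) degree_monic_power(2)[OF P(1), of N]] P(2) F(2) e N
      by (simp add: degree_monic_power(1)[OF P(1)])
    moreover have "N * e = (N - 1) * e + e" using N by (cases N) auto
    ultimately have db: "degree b < e" using dF by simp
    define b' where "b' = smult (fps_const (1 / of_nat N)) b"
    have c0: "fps_const (1 / of_nat N :: 'a) \<noteq> 0" using N by simp
    have "of_nat N * fps_const (1 / of_nat N :: 'a) = 1"
      unfolding fps_of_nat[symmetric] fps_const_mult using N by simp
    then have b': "of_nat N * b' = b" "degree b' = degree b"
      unfolding b'_def of_nat_poly using c0 by (simp_all add: mult.commute)
    obtain E where E: "(P + b') ^ N = P ^ N + of_nat N * b' * P ^ (N - 1) + E"
      "E = 0 \<or> degree E < degree b + (N - 1) * e"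
    proof -
      have "degree b' < degree P" "0 < N" using b' db P N by auto
      from binomial_first_order[OF P(1) this] show ?thesis
        using that unfolding b'(2) P(2) by blast
    qed
    have "F - (P + b') ^ N = (F - P ^ N) - b * P ^ (N - 1) - E"
      unfolding E(1) b'(1) by (simp only: diff_diff_eq add.assoc)
    then have "F - (P + b') ^ N = r - E" unfolding br(1) by simp
    then have "degree (F - (P + b') ^ N) < degree (F - P ^ N)"
      unfolding dF using E(2) dr by (cases "E = 0") (simp_all add: degree_diff_less)
    moreover have "Q (P + b')" unfolding b'_def by (rule step[OF less.prems br(1) dr db])
    ultimately show ?thesis using less.hyps by blast
  qed
qed

text \<open>One factor \<open>P\<close> is peeled off at a time: stability absorbs the remainder of
  \<open>r\<close>, the induction hypothesis its quotient.\<close>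

lemma division_stable_power:
  fixes P :: "'r::idom poly"
  assumes v: "valuation v" and P: "lead_coeff P = 1" "0 < degree P" and st: "division_stable v P"
  shows "degree r < n * degree P \<or> r = 0 \<Longrightarrow> v (b * P ^ n + r) \<le> v (b * P ^ n)"
proof (induction n arbitrary: r)
  case (Suc n)
  interpret valuation v by (rule v)
  obtain q s where qs: "r = q * P + s" "degree s < degree P"
    using monic_division[OF P] by metis
  have "degree q < n * degree P \<or> q = 0"
  proof (cases "q = 0")
    case False
    then have "degree r = degree q + degree P"
      using qs degree_mult_monic[OF P(1)] by (metis degree_add_eq_left trans_less_add2)
    then show ?thesis using Suc.prems P by auto
  qed simp
  from Suc.IH[OF this] have IH: "v (b * P ^ n + q) \<le> v (b * P ^ n)" .
  have "b * P ^ Suc n + r = (b * P ^ n + q) * P + s" by (simp add: qs algebra_simps)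
  also have "v \<dots> \<le> v ((b * P ^ n + q) * P)"
    using st qs(2) unfolding division_stable_def by blast
  also have "\<dots> \<le> v (b * P ^ n) + v P" using IH by (simp add: mult add_right_mono)
  finally show ?case by (simp add: mult algebra_simps)
qed simp

text \<open>Division by \<open>P + a\<close> is iterated division by \<open>P\<close>:
  \<open>q * P + r = q * (P + a) + (r - q * a)\<close>, where \<open>r - q * a\<close> has smaller
  degree than the dividend and at least its value.\<close>

lemma division_stable_shift:
  fixes P :: "'r::idom poly"
  assumes v: "valuation v" and P: "lead_coeff P = 1" "0 < degree P" and st: "division_stable v P"
    and a: "degree a < degree P" "v P \<le> v a"
  shows "v (P + a) = v P" and "division_stable v (P + a)"
proof -
  interpret valuation v by (rule v)
  show eq: "v (P + a) = v P"
  proof (rule antisym)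
    show "v (P + a) \<le> v P" using st a(1) unfolding division_stable_def by (metis mult_1)
    show "v P \<le> v (P + a)" using add_ge[of P a] a by simp
  qed
  have P': "degree (P + a) = degree P" "lead_coeff (P + a) = 1"
    using a P lead_coeff_add_le[of a P] by (auto simp: degree_add_eq_left add.commute)
  have "\<exists>q r. H = q * (P + a) + r \<and> degree r < degree P \<and> v H \<le> v (q * (P + a))" for H
  proof (induction "degree H" arbitrary: H rule: less_induct)
    case less
    obtain q r where qr: "H = q * P + r" "degree r < degree P"
      using monic_division[OF P] by metis
    show ?case
    proof (cases "q = 0")
      case True
      then show ?thesis using qr by (intro exI[of _ 0] exI[of _ r]) simp
    next
      case False
      have dH: "degree H = degree q + degree P"
        using qr degree_mult_monic[OF P(1) False] by (metis degree_add_eq_left trans_less_add2)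
      have "degree (r - q * a) < degree H"
        using degree_mult_le[of q a] a qr dH by (intro degree_diff_less) auto
      from less[OF this] obtain q' r' where q': "r - q * a = q' * (P + a) + r'" "degree r' < degree P"
        "v (r - q * a) \<le> v (q' * (P + a))" by blast
      have 1: "v H \<le> v (q * P)" "v H \<le> v r"
        using st division_stable_remainder[OF v st] qr unfolding division_stable_def by auto
      moreover have "v (q * P) \<le> v (q * a)" using a by (simp add: mult add_left_mono)
      ultimately have "v H \<le> v (r - q * a)"
        using diff_ge[of r "q * a"] by (meson min.boundedI order_trans)
      then have "v H \<le> v (q' * (P + a))" using q'(3) by simp
      moreover have "v H \<le> v (q * (P + a))" using 1 by (simp add: mult eq)
      ultimately have "v H \<le> v ((q + q') * (P + a))"
        unfolding distrib_right using add_ge by (meson min.boundedI order_trans)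
      moreover have "H = (q + q') * (P + a) + r'"
        using qr(1) q'(1) by (simp add: algebra_simps)
      ultimately show ?thesis using q' by blast
    qed
  qed
  then show "division_stable v (P + a)"
    unfolding division_stable_def P'(1)
    using monic_division_unique[OF P'(2)] P'(1) by metis
qed

lemma valuation_const_unit:
  assumes "valuation (v :: 'a::field fps poly \<Rightarrow> enat)" "c \<noteq> 0"
  shows "v (smult (fps_const c) H) = v H"
proof -
  have "[:fps_const c:] * [:fps_const (inverse c):] = 1"
    using assms(2) by (simp add: one_pCons)
  then have "v [:fps_const c:] = 0" by (rule valuation.unit[OF assms(1)])
  then show ?thesis using valuation.mult[OF assms(1), of "[:fps_const c:]" H] by simp
qed

text \<open>The iteration from \<open>P\<close> only adds terms of value at least
  \<open>v P\<close>, so value and stability of \<open>P\<close> pass to the limit. It serves twice,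
  for the valuation of the loop and for the order of the generic perturbation. The vanishing
  coefficient is the degree condition on \<open>F - \<psi> ^ N\<close>.\<close>

lemma approx_root_valuation:
  fixes F P :: "'a::field fps poly" and v :: "'a fps poly \<Rightarrow> enat"
  assumes F: "lead_coeff F = 1" "degree F = N * degree P" and N: "(of_nat N :: 'a) \<noteq> 0" "2 \<le> N"
    and P: "lead_coeff P = 1" "0 < degree P"
    and v: "valuation v" "division_stable v P" "v P \<noteq> \<infinity>" "enat N * v P \<le> v F"
  defines "\<psi> \<equiv> approx_root N F"
  shows "is_approx_root N F \<psi>" "lead_coeff \<psi> = 1" "degree \<psi> = degree P" "v \<psi> = v P" "v P \<le> v (\<psi> - P)"
    "division_stable v \<psi>" "coeff (adic \<psi> F) (N - 1) = 0"
proof -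
  interpret valuation v by fact
  define Q where "Q p \<longleftrightarrow> lead_coeff p = 1 \<and> degree p = degree P \<and> v P \<le> v (p - P)" for p
  have Q: "v p = v P" "division_stable v p" if "Q p" for p
  proof -
    have "degree (p - P) < degree P"
      using that P degree_diff_monic[of p P] unfolding Q_def by auto
    from division_stable_shift[OF v(1) P v(2) this] that show "v p = v P" "division_stable v p"
      unfolding Q_def by auto
  qed
  have "\<exists>\<psi>. Q \<psi> \<and> is_approx_root N F \<psi>"
  proof (rule is_approx_root_induct[OF F N P(2)])
    show "Q P" unfolding Q_def using P by simp
    show "lead_coeff p = 1 \<and> degree p = degree P" if "Q p" for p using that unfolding Q_def by blast
    fix p b r assume Qp: "Q p" and eq: "F - p ^ N = b * p ^ (N - 1) + r"
      and r: "degree r < (N - 1) * degree P" and b: "degree b < degree P"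
    have p: "lead_coeff p = 1" "degree p = degree P" using Qp unfolding Q_def by auto
    \<comment> \<open>Both \<open>F\<close> and \<open>p ^ N\<close> have value at least
      \<open>N\<close> times that of \<open>P\<close>; cancelling the finite value of
      \<open>p ^ (N - 1)\<close> leaves the bound on \<open>b\<close>.\<close>
    have "enat N * v P \<le> min (v F) (v (p ^ N))" using v Q(1)[OF Qp] by (simp add: power)
    also have "\<dots> \<le> v (F - p ^ N)" by (rule diff_ge)
    also have "\<dots> \<le> v (b * p ^ (N - 1))"
      unfolding eq using p P r Q(2)[OF Qp] by (intro division_stable_power v(1)) auto
    also have "\<dots> = v b + enat (N - 1) * v P" by (simp add: mult power Q(1)[OF Qp])
    finally have "v P \<le> v b"
      using N(2) v(3) by (cases "v P"; cases "v b"; cases N) auto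
    then have vb: "v P \<le> v (smult (fps_const (1 / of_nat N)) b)"
      using N valuation_const_unit[OF v(1), of "1 / of_nat N" b] by simp
    let ?b = "smult (fps_const (1 / of_nat N)) b"
    have "degree ?b < degree p" using b p by (metis degree_smult_le order_le_less_trans)
    then have "lead_coeff (p + ?b) = 1 \<and> degree (p + ?b) = degree P"
      using p lead_coeff_add_le[of ?b p] by (simp add: degree_add_eq_left add.commute)
    moreover have "v P \<le> v (p - P + ?b)"
      using add_ge[of "p - P" ?b] vb Qp unfolding Q_def by (meson min.boundedI order_trans)
    moreover have "p + ?b - P = p - P + ?b" by simp
    ultimately show "Q (p + ?b)" unfolding Q_def by metis
  qed
  then obtain \<phi> where \<phi>: "Q \<phi>" "is_approx_root N F \<phi>" by blast
  have "\<psi> = \<phi>" unfolding \<psi>_def using \<phi>(2) N(1)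
    by (rule approx_rootI) (use F N P in auto)
  with \<phi> have \<psi>: "Q \<psi>" "is_approx_root N F \<psi>" by auto
  then show ap: "is_approx_root N F \<psi>" and m: "lead_coeff \<psi> = 1" "degree \<psi> = degree P" and
    "v P \<le> v (\<psi> - P)" unfolding Q_def by auto
  show "v \<psi> = v P" "division_stable v \<psi>" using Q \<psi> by auto
  interpret monic_poly \<psi> by unfold_locales (use m P in auto)
  have "degree (F - \<psi> ^ N) < (N - 1) * degree \<psi>"
    using ap N P unfolding is_approx_root_def F(2) m by (auto simp: diff_mult_distrib)
  then have "coeff (adic \<psi> (F - \<psi> ^ N)) (N - 1) = 0" by (rule coeff_adic_eq_0)
  moreover have "adic \<psi> F = adic \<psi> (F - \<psi> ^ N) + monom 1 N"
    using adic_add[of "F - \<psi> ^ N" "\<psi> ^ N"] adic_power by simp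
  ultimately show "coeff (adic \<psi> F) (N - 1) = 0" using N by simp
qed

section \<open>Ring homomorphisms on polynomials\<close>

locale comm_ring_morphism =
  fixes h :: "'r::comm_ring_1 \<Rightarrow> 's::comm_ring_1"
  assumes one [simp]: "h 1 = 1"
    and add: "h (a + b) = h a + h b"
    and mult: "h (a * b) = h a * h b"
begin

lemma zero [simp]: "h 0 = 0"
  using add[of 0 0] by simp

lemma minus: "h (- a) = - h a"
  using add[of a "- a"] by (simp add: eq_neg_iff_add_eq_0 add.commute)

lemma diff: "h (a - b) = h a - h b"
  using add[of a "- b"] minus by simp

lemma sum: "h (sum f A) = (\<Sum>x\<in>A. h (f x))"
  by (induction A rule: infinite_finite_induct) (auto simp: add)

lemma prod: "h (prod f A) = (\<Prod>x\<in>A. h (f x))"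
  by (induction A rule: infinite_finite_induct) (auto simp: mult)

lemma power: "h (a ^ n) = h a ^ n"
  by (induction n) (auto simp: mult)

lemma coeff_map [simp]: "coeff (map_poly h p) i = h (coeff p i)"
  by (simp add: coeff_map_poly)

lemma map_poly_morphism: "comm_ring_morphism (map_poly h)"
proof
  show "map_poly h 1 = 1" by simp
  show "map_poly h (p + q) = map_poly h p + map_poly h q" for p q
    by (rule poly_eqI) (simp add: add)
  show "map_poly h (p * q) = map_poly h p * map_poly h q" for p q
    by (rule poly_eqI) (simp add: coeff_mult sum mult)
qed

lemma map_poly_pCons' [simp]: "map_poly h (pCons a p) = pCons (h a) (map_poly h p)"
  by (rule poly_eqI) (simp add: coeff_pCons split: nat.splits)

lemma poly_map_poly: "poly (map_poly h p) (h x) = h (poly p x)"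
  by (induction p) (auto simp: add mult)

lemma map_poly_pcompose: "map_poly h (pcompose p q) = pcompose (map_poly h p) (map_poly h q)"
proof -
  interpret m: comm_ring_morphism "map_poly h" by (rule map_poly_morphism)
  show ?thesis by (induction p) (auto simp: pcompose_pCons m.add m.mult)
qed

end

lemma comm_ring_morphism_comp:
  "comm_ring_morphism f \<Longrightarrow> comm_ring_morphism g \<Longrightarrow> comm_ring_morphism (\<lambda>x. f (g x))"
  by (simp add: comm_ring_morphism_def)

lemma poly_eval_morphism: "comm_ring_morphism (\<lambda>p :: 'r::comm_ring_1 poly. poly p x)"
  by unfold_locales auto

lemma pcompose_morphism: "comm_ring_morphism (\<lambda>p :: 'r::comm_ring_1 poly. pcompose p q)"
  by unfold_locales (auto simp: pcompose_add pcompose_mult pcompose_1)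

definition pw :: "nat \<Rightarrow> 'a::idom fps \<Rightarrow> 'a fps" where
  "pw m f = f oo (fps_X ^ m)"

lemma pw_nth: "0 < m \<Longrightarrow> fps_nth (pw m f) n = (if m dvd n then fps_nth f (n div m) else 0)"
  unfolding pw_def by (rule fps_nth_compose_X_power)

lemma pw_morphism: "0 < m \<Longrightarrow> comm_ring_morphism (pw m)"
  by unfold_locales (auto simp: pw_def fps_compose_add_distrib intro!: fps_compose_mult_distrib)

lemma pw_pw: "0 < m \<Longrightarrow> 0 < k \<Longrightarrow> pw m (pw k f) = pw (m * k) f"
  by (rule fps_ext) (auto simp: pw_nth div_mult2_eq elim!: dvdE)

lemma pw_1 [simp]: "pw 1 f = f" "pw (Suc 0) f = f"
  unfolding pw_def by auto

lemma subdegree_pw: "0 < m \<Longrightarrow> subdegree (pw m f) = m * subdegree f"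
  unfolding pw_def by (simp add: fps_X_power_subdegree)

lemma pw_eq_0_iff [simp]: "0 < m \<Longrightarrow> pw m f = 0 \<longleftrightarrow> f = 0"
  unfolding pw_def by (subst fps_compose_eq_0_iff) auto

lemma pw_X: "0 < m \<Longrightarrow> pw m fps_X = fps_X ^ m"
  unfolding pw_def by (simp add: fps_X_fps_compose_startby0)

section \<open>Hensel's lemma\<close>

text \<open>Views a polynomial in \<open>y\<close> over power series as a power series in
  \<open>x\<close> over polynomials in \<open>y\<close>, the form in which factorizations are lifted
  order by order.\<close>

definition slice :: "nat \<Rightarrow> 'a::comm_ring_1 fps poly \<Rightarrow> 'a poly" where
  "slice n H = map_poly (\<lambda>f. fps_nth f n) H"

lemma coeff_slice [simp]: "coeff (slice n H) j = fps_nth (coeff H j) n"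
  unfolding slice_def by (simp add: coeff_map_poly)

lemma slice_eqI: "(\<And>n. slice n A = slice n B) \<Longrightarrow> A = B"
  by (intro poly_eqI fps_ext) (metis coeff_slice)

lemma slice_mult: "slice n (A * B) = (\<Sum>i\<le>n. slice i A * slice (n - i) B)"
proof (rule poly_eqI)
  fix j
  have "coeff (slice n (A * B)) j = (\<Sum>k\<le>j. \<Sum>i\<le>n. fps_nth (coeff A k) i * fps_nth (coeff B (j - k)) (n - i))"
    by (simp add: coeff_mult fps_sum_nth fps_mult_nth atLeast0AtMost)
  also have "\<dots> = (\<Sum>i\<le>n. \<Sum>k\<le>j. fps_nth (coeff A k) i * fps_nth (coeff B (j - k)) (n - i))"
    by (rule sum.swap)
  also have "\<dots> = coeff (\<Sum>i\<le>n. slice i A * slice (n - i) B) j"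
    by (simp add: coeff_sum coeff_mult)
  finally show "coeff (slice n (A * B)) j = coeff (\<Sum>i\<le>n. slice i A * slice (n - i) B) j" .
qed

text \<open>Only \<open>s\<close> is reduced, modulo \<open>g\<close>; the bound on the degree of
  \<open>E\<close> then forces that of \<open>t\<close>.\<close>

lemma bezout_small_degree:
  fixes g h E :: "'a::field poly"
  assumes "a * g + b * h = 1" "0 < degree g" "0 < degree h" "degree E < degree g + degree h"
  shows "\<exists>s t. s * h + g * t = E \<and> degree s < degree g \<and> degree t < degree h"
proof -
  define s where "s = (E * b) mod g"
  define t where "t = E * a + (E * b) div g * h"
  have ds: "degree s < degree g"
    unfolding s_def using assms(2) by (metis degree_0 degree_mod_less mod_by_0 not_less_zero)
  have "E = E * (a * g + b * h)" using assms(1) by simp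
  also have "\<dots> = E * a * g + ((E * b) div g * g + s) * h"
    unfolding s_def by (simp add: algebra_simps)
  finally have eq: "s * h + g * t = E" by (simp add: t_def algebra_simps)
  have "degree t < degree h"
  proof (cases "t = 0")
    case False
    have "degree (g * t) = degree g + degree t"
      using False assms(2) by (intro degree_mult_eq) auto
    moreover have "degree (g * t) < degree g + degree h"
    proof -
      have "degree (s * h) < degree g + degree h"
        using degree_mult_le[of s h] ds by linarith
      moreover have "g * t = E - s * h" using eq by (simp add: algebra_simps)
      ultimately show ?thesis using assms(4) by (simp add: degree_diff_less)
    qed
    ultimately show ?thesis by simp
  qed (use assms in simp)
  with eq ds show ?thesis by blast
qed

lemma hensel:
  fixes G :: "'a::field fps poly"
  assumes G: "lead_coeff G = 1" and gh: "lead_coeff g = 1" "lead_coeff h = 1" "0 < degree g" "0 < degree h"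
    and bez: "a * g + b * h = 1" and red: "slice 0 G = g * h"
  shows "\<exists>G1 G2. G = G1 * G2 \<and> lead_coeff G1 = 1 \<and> lead_coeff G2 = 1 \<and>
           degree G1 = degree g \<and> degree G2 = degree h"
proof -
  \<comment> \<open>\<open>f n\<close> is the pair of \<open>n\<close>-th slices of the two factors.
    Comparing slices of the product gives a linear equation for it whose right-hand side involves
    earlier pairs only.\<close>
  define P where "P f n r \<longleftrightarrow> (if n = 0 then r = (g, h) else
      degree (fst r) < degree g \<and> degree (snd r) < degree h \<and>
      fst r * h + g * snd r = slice n G - (\<Sum>i\<in>{1..<n}. fst (f i) * snd (f (n - i))))"
    for f :: "nat \<Rightarrow> 'a poly \<times> 'a poly" and n :: nat and r
  have dG: "degree G = degree g + degree h"
  proof -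
    have "coeff (slice 0 G) (degree G) = 1" using G by simp
    then have "degree G \<le> degree (slice 0 G)" by (intro le_degree) auto
    moreover have "degree (slice 0 G) \<le> degree G" by (intro degree_le) (simp add: coeff_eq_0)
    ultimately have "degree G = degree (g * h)" using red by simp
    also have "\<dots> = degree g + degree h" using gh by (intro degree_mult_eq) auto
    finally show ?thesis .
  qed
  have "\<exists>f. \<forall>n. P f n (f n)"
  proof (rule dependent_wf_choice[of "{(i::nat, j). i < j}"])
    show "wf {(i::nat, j). i < j}" by (rule wf)
    show "P f x r = P g x r" if "\<And>z. (z, x) \<in> {(i, j). i < j} \<Longrightarrow> f z = g z" for f g x r
    proof -
      have "(\<Sum>i\<in>{1..<x}. fst (f i) * snd (f (x - i))) = (\<Sum>i\<in>{1..<x}. fst (g i) * snd (g (x - i)))"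
        using that by (intro sum.cong) auto
      then show ?thesis unfolding P_def by simp
    qed
    fix n f assume IH: "\<And>i. (i, n) \<in> {(i, j). i < j} \<Longrightarrow> P f i (f i)"
    show "\<exists>r. P f n r"
    proof (cases "n = 0")
      case False
      define E where "E = slice n G - (\<Sum>i\<in>{1..<n}. fst (f i) * snd (f (n - i)))"
      have "degree (slice n G) < degree g + degree h"
      proof (cases "slice n G = 0")
        case nz: False
        have "degree (slice n G) \<le> degree G" by (intro degree_le) (simp add: coeff_eq_0)
        moreover have "coeff (slice n G) (degree G) = 0" using False G by simp
        ultimately show ?thesis using nz dG
          by (metis leading_coeff_0_iff le_neq_implies_less)
      qed (use gh in simp)
      moreover have "degree (\<Sum>i\<in>{1..<n}. fst (f i) * snd (f (n - i))) < degree g + degree h"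
      proof (rule degree_sum_less)
        fix i assume i: "i \<in> {1..<n}"
        have "degree (fst (f i)) < degree g" "degree (snd (f (n - i))) < degree h"
          using IH[of i] IH[of "n - i"] i unfolding P_def by auto
        then show "degree (fst (f i) * snd (f (n - i))) < degree g + degree h"
          using degree_mult_le[of "fst (f i)" "snd (f (n - i))"] by linarith
      qed (use gh in simp)
      ultimately have "degree E < degree g + degree h"
        unfolding E_def by (rule degree_diff_less)
      from bezout_small_degree[OF bez gh(3,4) this] obtain s t
        where "s * h + g * t = E" "degree s < degree g" "degree t < degree h" by blast
      with False show ?thesis unfolding P_def E_def by (intro exI[of _ "(s, t)"]) simp
    qed (simp add: P_def)
  qed
  then obtain f where f: "\<And>n. P f n (f n)" by blast
  have f0: "f 0 = (g, h)" using f[of 0] unfolding P_def by simp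
  define mk where "mk c k = (\<Sum>j\<le>k. monom (Abs_fps (\<lambda>n. coeff (c n) j)) j)"
    for c :: "nat \<Rightarrow> 'a poly" and k
  have coeff_mk: "coeff (mk c k) j = (if j \<le> k then Abs_fps (\<lambda>n. coeff (c n) j) else 0)" for c k j
    unfolding mk_def by (simp add: coeff_sum)
  have slice_mk: "slice n (mk c k) = c n" if "degree (c n) \<le> k" for c k n
    using that by (intro poly_eqI) (auto simp: coeff_mk coeff_eq_0)
  have mk_monic: "lead_coeff (mk c k) = 1 \<and> degree (mk c k) = k"
    if "lead_coeff (c 0) = 1" "degree (c 0) = k" "\<And>n. 0 < n \<Longrightarrow> degree (c n) < k" for c k
  proof -
    have "coeff (mk c k) k = 1"
      using that by (intro fps_ext) (auto simp: coeff_mk coeff_eq_0)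
    moreover have "degree (mk c k) \<le> k" by (intro degree_le) (simp add: coeff_mk)
    ultimately have "degree (mk c k) = k" by (intro antisym le_degree) auto
    with \<open>coeff (mk c k) k = 1\<close> show ?thesis by simp
  qed
  define G1 where "G1 = mk (\<lambda>n. fst (f n)) (degree g)"
  define G2 where "G2 = mk (\<lambda>n. snd (f n)) (degree h)"
  have deg: "degree (fst (f n)) < degree g" "degree (snd (f n)) < degree h" if "0 < n" for n
    using f[of n] that unfolding P_def by auto
  have sl: "slice n G1 = fst (f n)" "slice n G2 = snd (f n)" for n
    unfolding G1_def G2_def using deg[of n] f0 by (cases "n = 0"; simp add: slice_mk)+
  have "G = G1 * G2"
  proof (rule slice_eqI)
    fix n
    show "slice n G = slice n (G1 * G2)"
    proof (cases "n = 0")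
      case True
      then show ?thesis using red by (simp add: slice_mult sl f0)
    next
      case False
      have "{..n} = insert 0 (insert n {1..<n})" using False by auto
      then have "slice n (G1 * G2) = g * snd (f n) + (fst (f n) * h + (\<Sum>i\<in>{1..<n}. fst (f i) * snd (f (n - i))))"
        using False by (simp add: slice_mult sl f0)
      also have "\<dots> = slice n G" using f[of n] False unfolding P_def by (simp add: algebra_simps)
      finally show ?thesis by simp
    qed
  qed
  moreover have "lead_coeff G1 = 1 \<and> degree G1 = degree g"
    unfolding G1_def by (rule mk_monic) (use f0 gh deg in auto)
  moreover have "lead_coeff G2 = 1 \<and> degree G2 = degree h"
    unfolding G2_def by (rule mk_monic) (use f0 gh deg in auto)
  ultimately show ?thesis by blast
qed

text \<open>Modulo the linear factor, \<open>h\<close> is the nonzero constant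
  \<open>poly h \<beta>\<close>. Hence \<open>x = 1 - h / poly h \<beta>\<close> is a multiple of
  the linear factor, while \<open>1 - x ^ k\<close> is a multiple of \<open>h\<close> by the
  geometric sum.\<close>

lemma bezout_linear_power:
  fixes h :: "'a::field poly"
  assumes "\<not> [:- \<beta>, 1:] dvd h"
  shows "\<exists>a b. a * [:- \<beta>, 1:] ^ k + b * h = 1"
proof -
  define l where "l = [:- \<beta>, 1:]"
  have c: "poly h \<beta> \<noteq> 0" using assms by (simp add: poly_eq_0_iff_dvd)
  have "l dvd h - [:poly h \<beta>:]"
    unfolding l_def poly_eq_0_iff_dvd[symmetric] by simp
  then obtain u where "h - [:poly h \<beta>:] = l * u" by blast
  then have h: "h = l * u + [:poly h \<beta>:]" by (simp add: algebra_simps)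
  define x where "x = smult (- inverse (poly h \<beta>)) (l * u)"
  have "1 - x = smult (inverse (poly h \<beta>)) h"
    unfolding x_def by (subst (2) h) (use c in \<open>simp add: smult_add_right one_pCons\<close>)
  then have "1 - x ^ k = smult (inverse (poly h \<beta>)) h * (\<Sum>i<k. x ^ i)"
    by (simp add: one_diff_power_eq)
  moreover have "x ^ k = smult ((- inverse (poly h \<beta>)) ^ k) (u ^ k) * l ^ k"
    unfolding x_def smult_power power_mult_distrib
    by (simp only: mult_smult_left mult.commute[of "u ^ k"])
  ultimately have "smult ((- inverse (poly h \<beta>)) ^ k) (u ^ k) * l ^ k +
      smult (inverse (poly h \<beta>)) (\<Sum>i<k. x ^ i) * h = 1"
    by (simp add: algebra_simps)
  then show ?thesis unfolding l_def by blast
qed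

section \<open>Puiseux roots\<close>

lemma coeff_pcompose_tschirnhausen:
  fixes F :: "'r::idom poly"
  assumes "lead_coeff F = 1" "degree F = n" "0 < n" "of_nat n * s = coeff F (n - 1)"
  shows "lead_coeff (pcompose F [:- s, 1:]) = 1" "degree (pcompose F [:- s, 1:]) = n"
    "coeff (pcompose F [:- s, 1:]) (n - 1) = 0"
proof -
  show d: "degree (pcompose F [:- s, 1:]) = n" using assms by (simp add: degree_pcompose)
  show "lead_coeff (pcompose F [:- s, 1:]) = 1"
    using assms by (subst lead_coeff_comp) auto
  define R where "R = F - monom 1 n - monom (coeff F (n - 1)) (n - 1)"
  have "degree R < n - 1 \<or> R = 0"
  proof (cases "R = 0")
    case False
    have "coeff R i = 0" if "n - 1 \<le> i" for i
    proof (cases "i = n \<or> i = n - 1")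
      case True
      then show ?thesis using assms by (auto simp: R_def)
    next
      case False
      with that have "n < i" by linarith
      then show ?thesis using assms by (simp add: R_def coeff_eq_0)
    qed
    then show ?thesis using False by (metis leading_coeff_0_iff not_le)
  qed simp
  then have R: "coeff (pcompose R [:- s, 1:]) (n - 1) = 0"
    by (auto simp: coeff_eq_0 degree_pcompose)
  interpret pc: comm_ring_morphism "\<lambda>p :: 'r poly. pcompose p [:- s, 1:]" by (rule pcompose_morphism)
  have mono: "pcompose (monom c k) [:- s, 1:] = smult c ([:- s, 1:] ^ k)" for c :: 'r and k
  proof -
    have "monom c k = smult c ([:0, 1:] ^ k)" by (simp add: monom_altdef)
    then show ?thesis by (simp add: pcompose_smult pc.power pcompose_pCons)
  qed
  define a where "a = coeff F (n - 1)"
  have "F = monom 1 n + monom a (n - 1) + R" by (simp add: R_def a_def)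
  then have "pcompose F [:- s, 1:] = [:- s, 1:] ^ n + smult a ([:- s, 1:] ^ (n - 1)) + pcompose R [:- s, 1:]"
    by (simp add: pcompose_add mono)
  then have "coeff (pcompose F [:- s, 1:]) (n - 1) =
      coeff ([:- s, 1:] ^ n) (n - 1) + a * coeff ([:- s, 1:] ^ (n - 1)) (n - 1)"
    using R by simp
  also have "\<dots> = 0"
    using assms(3,4) coeff_linear_poly_power[of "n - 1" n "- s" 1] coeff_linear_poly_power[of "n - 1" "n - 1" "- s" 1]
    unfolding a_def[symmetric] by (cases n) auto
  finally show "coeff (pcompose F [:- s, 1:]) (n - 1) = 0" .
qed

text \<open>
  The Tschirnhausen shift kills the subleading coefficient, so after rescaling along the Newton
  slope the reduction is not a power of a linear polynomial and Hensel's lemma splits it.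
\<close>
lemma puiseux_root:
  fixes F :: "'a::alg_closed_field fps poly"
  assumes "lead_coeff F = 1" "0 < degree F"
    and "\<And>k. 0 < k \<Longrightarrow> k \<le> degree F \<Longrightarrow> (of_nat k :: 'a) \<noteq> 0"
  shows "\<exists>m S. 0 < m \<and> (of_nat m :: 'a) \<noteq> 0 \<and> poly (map_poly (pw m) F) S = 0"
  using assms
proof (induction "degree F" arbitrary: F rule: less_induct)
  case less
  define n where "n = degree F"
  have n: "0 < n" "(of_nat n :: 'a) \<noteq> 0" using less.prems by (auto simp: n_def)
  define s where "s = fps_const (1 / of_nat n) * coeff F (n - 1)"
  have "of_nat n * fps_const (1 / of_nat n :: 'a) = 1"
    unfolding fps_of_nat[symmetric] fps_const_mult using n by simp
  then have s: "of_nat n * s = coeff F (n - 1)"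
    unfolding s_def by (metis mult.assoc mult_1)
  define F' where "F' = pcompose F [:- s, 1:]"
  have F': "coeff F' n = 1" "degree F' = n" "coeff F' (n - 1) = 0"
    using coeff_pcompose_tschirnhausen[OF less.prems(1) n_def[symmetric] n(1) s] unfolding F'_def by auto
  have unshift: "\<exists>m S. 0 < m \<and> (of_nat m :: 'a) \<noteq> 0 \<and> poly (map_poly (pw m) F) S = 0"
    if m: "0 < m" "(of_nat m :: 'a) \<noteq> 0" "poly (map_poly (pw m) F') S = 0" for m S
  proof -
    interpret pm: comm_ring_morphism "pw m :: 'a fps \<Rightarrow> _" by (rule pw_morphism[OF m(1)])
    have "poly (map_poly (pw m) F) (S - pw m s) = 0"
      using m(3) unfolding F'_def pm.map_poly_pcompose by (simp add: poly_pcompose pm.minus)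
    then show ?thesis using m by blast
  qed
  show ?case
  proof (cases "\<forall>i<n. coeff F' i = 0")
    case True
    then have "F' = monom 1 n"
      using F' by (intro poly_eqI) (metis coeff_eq_0 coeff_monom linorder_neqE_nat)
    then have "poly (map_poly (pw 1) F') 0 = 0" using n by (simp add: poly_monom map_poly_monom)
    then show ?thesis by (rule unshift[rotated 2]) auto
  next
    case False
    define I where "I = {i. i < n \<and> coeff F' i \<noteq> 0}"
    define v where "v i = subdegree (coeff F' i)" for i
    have "finite I" "I \<noteq> {}" using False by (auto simp: I_def)
    from ex_is_arg_min_if_finite[OF this, of "\<lambda>i. real (v i) / real (n - i)"]
    obtain k where k: "is_arg_min (\<lambda>i. real (v i) / real (n - i)) (\<lambda>i. i \<in> I) k" by blast
    then have kI: "k < n" "coeff F' k \<noteq> 0" by (auto simp: is_arg_min_def I_def)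
    \<comment> \<open>The least Newton slope is \<open>p / q\<close>, not necessarily in lowest
      terms; \<open>q \<le> n\<close> makes \<open>q\<close> invertible in the field.\<close>
    define q where "q = n - k"
    define p where "p = v k"
    have q: "0 < q" "q \<le> n" "(of_nat q :: 'a) \<noteq> 0"
      using kI less.prems(3)[of q] unfolding q_def n_def by auto
    have min: "p * (n - i) \<le> q * v i" if "i < n" "coeff F' i \<noteq> 0" for i
    proof -
      have "real (v k) / real (n - k) \<le> real (v i) / real (n - i)"
        using k that by (auto simp: is_arg_min_linorder I_def)
      then have "real (v k) * real (n - i) \<le> real (v i) * real (n - k)"
        using that kI by (simp add: divide_simps mult_ac split: if_splits)
      then show ?thesis unfolding p_def q_def by (simp add: mult.commute flip: of_nat_mult)
    qed
    \<comment> \<open>This is F'(x^q, x^p y) divided by x^(p n). Minimality of the slope makes all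
      the shifts exact.\<close>
    define G where "G = (\<Sum>i\<le>n. monom (fps_shift (p * (n - i)) (pw q (coeff F' i))) i)"
    have cG: "coeff G i = (if i \<le> n then fps_shift (p * (n - i)) (pw q (coeff F' i)) else 0)" for i
      unfolding G_def by (simp add: coeff_sum)
    interpret pq: comm_ring_morphism "pw q :: 'a fps \<Rightarrow> _" by (rule pw_morphism[OF q(1)])
    have cGn: "coeff G n = 1" using F' by (simp add: cG)
    moreover have "degree G \<le> n" by (intro degree_le) (simp add: cG)
    ultimately have dG: "degree G = n" by (intro antisym le_degree) auto
    have FG: "pw q (coeff F' i) = fps_X ^ (p * (n - i)) * coeff G i" if "i \<le> n" for i
    proof (cases "i = n \<or> coeff F' i = 0")
      case False
      then have "p * (n - i) \<le> subdegree (pw q (coeff F' i))"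
        using min[of i] that q by (simp add: subdegree_pw v_def)
      then have "fps_shift (p * (n - i)) (pw q (coeff F' i)) * fps_X ^ (p * (n - i)) = pw q (coeff F' i)"
        by (rule fps_shift_times_fps_X_power)
      then show ?thesis using that unfolding cG by (simp only: if_True mult.commute)
    qed (use that F' cGn in \<open>auto simp: cG\<close>)
    have root: "\<exists>m S. 0 < m \<and> (of_nat m :: 'a) \<noteq> 0 \<and> poly (map_poly (pw m) F) S = 0"
      if m: "0 < m" "(of_nat m :: 'a) \<noteq> 0" "poly (map_poly (pw m) G) T = 0" for m T
    proof -
      interpret pm: comm_ring_morphism "pw m :: 'a fps \<Rightarrow> _" by (rule pw_morphism[OF m(1)])
      interpret pmq: comm_ring_morphism "pw (m * q) :: 'a fps \<Rightarrow> _" by (rule pw_morphism) (use m q in simp)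
      have sum_form: "poly (map_poly f H) y = (\<Sum>i\<le>n. f (coeff H i) * y ^ i)"
        if "comm_ring_morphism f" "degree H = n" for f :: "'a fps \<Rightarrow> 'a fps" and H y
      proof -
        have f0: "f 0 = 0" using that by (rule_tac comm_ring_morphism.zero)
        have "degree (map_poly f H) \<le> n" using that f0 by (intro degree_le) (auto simp: coeff_map_poly coeff_eq_0)
        then have "poly (map_poly f H) y = (\<Sum>i\<le>n. coeff (map_poly f H) i * y ^ i)"
          unfolding poly_altdef by (intro sum.mono_neutral_left) (auto simp: not_le coeff_eq_0)
        then show ?thesis using f0 by (simp add: coeff_map_poly)
      qed
      \<comment> \<open>Undoing the rescaling: a root \<open>T\<close> of \<open>G\<close> after x =
        t^m becomes a root of \<open>F'\<close> after x = t^(m q).\<close>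
      define S where "S = fps_X ^ (m * p) * T"
      have "poly (map_poly (pw (m * q)) F') S = (\<Sum>i\<le>n. pw (m * q) (coeff F' i) * S ^ i)"
        by (rule sum_form) (use F' pmq.comm_ring_morphism_axioms in auto)
      also have "\<dots> = (\<Sum>i\<le>n. fps_X ^ (m * p * n) * (pw m (coeff G i) * T ^ i))"
      proof (rule sum.cong)
        fix i assume i: "i \<in> {..n}"
        have "pw (m * q) (coeff F' i) = pw m (pw q (coeff F' i))" using m q by (simp add: pw_pw)
        also have "\<dots> = (fps_X ^ m) ^ (p * (n - i)) * pw m (coeff G i)"
          using i m by (simp add: FG pm.mult pm.power pw_X)
        finally have "pw (m * q) (coeff F' i) * S ^ i =
            (fps_X ^ (m * (p * (n - i))) * fps_X ^ (m * p * i)) * (pw m (coeff G i) * T ^ i)"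
          by (simp add: S_def power_mult_distrib mult_ac flip: power_mult)
        also have "fps_X ^ (m * (p * (n - i))) * fps_X ^ (m * p * i) = (fps_X ^ (m * p * n) :: 'a fps)"
          using i by (simp flip: power_add add: algebra_simps)
        finally show "pw (m * q) (coeff F' i) * S ^ i = fps_X ^ (m * p * n) * (pw m (coeff G i) * T ^ i)" .
      qed simp
      also have "\<dots> = fps_X ^ (m * p * n) * poly (map_poly (pw m) G) T"
        by (simp add: sum_form[OF pm.comm_ring_morphism_axioms dG] sum_distrib_left)
      also have "\<dots> = 0" using m by simp
      finally show ?thesis using m q by (intro unshift[of "m * q" S]) auto
    qed
    define g0 where "g0 = slice 0 G"
    have g0n: "coeff g0 n = 1" by (simp add: g0_def cGn)
    moreover have "degree g0 \<le> n" by (intro degree_le) (simp add: g0_def cG)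
    ultimately have dg0: "degree g0 = n" by (intro antisym le_degree) auto
    have g0k: "coeff g0 k \<noteq> 0"
    proof -
      have "coeff g0 k = fps_nth (pw q (coeff F' k)) (p * q)"
        using kI by (simp add: g0_def cG q_def)
      also have "\<dots> = fps_nth (coeff F' k) (v k)" using q by (simp add: pw_nth p_def)
      also have "\<dots> \<noteq> 0" using kI by (simp add: v_def)
      finally show ?thesis .
    qed
    have g0n1: "coeff g0 (n - 1) = 0" using F' by (simp add: g0_def cG)
    obtain \<beta> where \<beta>: "poly g0 \<beta> = 0"
      using alg_closed_imp_poly_has_root[of g0] dg0 n by auto
    have "g0 \<noteq> 0" using g0n by auto
    then obtain h where h: "g0 = [:- \<beta>, 1:] ^ order \<beta> g0 * h" "\<not> [:- \<beta>, 1:] dvd h"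
      using order_decomp by blast
    define r where "r = order \<beta> g0"
    define g where "g = [:- \<beta>, 1:] ^ r"
    have r0: "0 < r" using \<beta> \<open>g0 \<noteq> 0\<close> by (simp add: r_def order_gt_0_iff)
    have "degree g = r" unfolding g_def by (simp add: degree_linear_power)
    moreover have "lead_coeff g = 1" unfolding g_def by (rule degree_monic_power) simp
    ultimately have g: "degree g = r" "lead_coeff g = 1" by auto
    have g0: "g0 = g * h" using h(1) by (simp add: g_def r_def)
    have "h \<noteq> 0" using \<open>g0 \<noteq> 0\<close> g0 by auto
    then have deg: "n = r + degree h"
      using dg0 g0 g r0 by (metis degree_mult_eq degree_0 less_irrefl)
    have lch: "lead_coeff h = 1"
      using g0n dg0 g0 g by (metis lead_coeff_mult mult_1)
    have "0 < degree h"
    proof (rule ccontr)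
      assume "\<not> 0 < degree h"
      then have "h = 1" using lch by (metis degree_eq_zeroE gr0I lead_coeff_pCons(2) one_pCons pCons_0_0 lead_coeff_pCons(1))
      \<comment> \<open>The coefficient of y^(n-1) here is -n \<beta>. It vanishes, so \<beta> is 0
        and the reduction would be y^n, against the nonzero coefficient at \<open>k\<close>.\<close>
      then have g0r: "g0 = [:- \<beta>, 1:] ^ n" using g0 deg by (simp add: g_def)
      then have "of_nat n * \<beta> = 0"
        using g0n1 n coeff_linear_poly_power[of "n - 1" n "- \<beta>" 1] by (cases n) auto
      then have "\<beta> = 0" using n by simp
      then have "coeff g0 k = 0"
        unfolding g0r using kI coeff_linear_poly_power[of k n 0 1] by (simp add: power_0_left)
      with g0k show False by simp
    qed
    obtain a b where "a * g + b * h = 1"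
      using bezout_linear_power[OF h(2), of r] unfolding g_def by blast
    then have "\<exists>G1 G2. G = G1 * G2 \<and> lead_coeff G1 = 1 \<and> lead_coeff G2 = 1 \<and>
           degree G1 = degree g \<and> degree G2 = degree h"
      using hensel[of G g h a b] g r0 lch \<open>0 < degree h\<close> g0 cGn dG unfolding g0_def by simp
    then obtain G1 G2 where G12: "G = G1 * G2" "lead_coeff G1 = 1" "degree G1 = r"
      using g(1) by metis
    have "degree G1 < degree F" "0 < degree G1" using G12 deg \<open>0 < degree h\<close> r0 n_def by auto
    moreover have "(of_nat k :: 'a) \<noteq> 0" if "0 < k" "k \<le> degree G1" for k
      using that less.prems(3)[of k] calculation by simp
    ultimately obtain m T where m: "0 < m" "(of_nat m :: 'a) \<noteq> 0" "poly (map_poly (pw m) G1) T = 0"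
      using less.hyps[of G1] G12 by blast
    interpret pm: comm_ring_morphism "map_poly (pw m) :: 'a fps poly \<Rightarrow> _"
      by (intro comm_ring_morphism.map_poly_morphism pw_morphism m)
    have "poly (map_poly (pw m) G) T = 0" using m G12 by (simp add: pm.mult)
    then show ?thesis by (rule root[OF m(1,2)])
  qed
qed

section \<open>Conjugate parametrizations\<close>

lemma pw_0 [simp]: "pw m 0 = 0"
  by (simp add: pw_def)

definition unity_roots :: "nat \<Rightarrow> 'a::field set" where
  "unity_roots m = {w. w ^ m = 1}"

text \<open>X^m - \<eta> is separable: a double root would be a root of its derivative m X^(m-1),
  hence 0, which is not a root as \<eta> is nonzero.\<close>

lemma card_power_fiber:
  fixes \<eta> :: "'a::alg_closed_field"
  assumes m: "0 < m" "(of_nat m :: 'a) \<noteq> 0" and \<eta>: "\<eta> \<noteq> 0"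
  shows "finite {w. w ^ m = \<eta>}" "card {w. w ^ m = \<eta>} = m"
proof -
  define p where "p = monom 1 m - [:\<eta>:]"
  have cm: "coeff p m = 1" using m by (simp add: p_def coeff_pCons split: nat.split)
  have dp: "degree p = m"
    by (intro antisym le_degree degree_le) (auto simp: cm, auto simp: p_def coeff_pCons split: nat.split)
  have p0: "p \<noteq> 0" using cm by auto
  have root: "poly p x = 0 \<longleftrightarrow> x ^ m = \<eta>" for x by (simp add: p_def poly_monom)
  obtain A where A: "size A = m" "p = (\<Prod>x\<in>#A. [:- x, 1:])"
    using alg_closed_imp_factorization[OF p0] dp cm by auto
  have cnt: "count A x = 1" if x: "x \<in># A" for x
  proof (rule ccontr)
    assume ne: "count A x \<noteq> 1"
    obtain A' where A': "A = add_mset x A'" using multi_member_split[OF x] by blast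
    then have "count A' x \<noteq> 0" using ne by simp
    then have "x \<in># A'" by (simp only: count_eq_zero_iff not_not)
    then obtain B where "A' = add_mset x B" using multi_member_split[of x A'] by blast
    then have B: "A = add_mset x (add_mset x B)" using A' by simp
    define r where "r = (\<Prod>y\<in>#B. [:- y, 1:])"
    define l where "l = [:- x, 1:]"
    have lx: "poly l x = 0" by (simp add: l_def)
    have pr: "p = l * (l * r)" unfolding A(2) B r_def l_def by simp
    have "poly (pderiv p) x = 0" unfolding pr by (simp add: pderiv_mult lx)
    moreover have "pderiv p = monom (of_nat m) (m - 1)"
      unfolding p_def by (simp add: pderiv_diff pderiv_monom)
    ultimately have "x = 0" using m(2) by (simp add: poly_monom)
    moreover have "poly p x = 0" unfolding pr by (simp add: lx)
    ultimately show False using \<eta> m(1) by (simp add: root power_0_left)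
  qed
  have set: "{w. w ^ m = \<eta>} = set_mset A"
  proof -
    have "poly p x = (\<Prod>y\<in>#A. x - y)" for x
      unfolding A(2) by (induction A) (auto simp: algebra_simps)
    then have "poly p x = 0 \<longleftrightarrow> x \<in># A" for x
      by (auto simp: prod_mset_zero_iff)
    then show ?thesis using root by auto
  qed
  then show "finite {w. w ^ m = \<eta>}" by simp
  have "size A = (\<Sum>x\<in>set_mset A. count A x)" by (rule size_multiset_overloaded_eq)
  also have "\<dots> = card (set_mset A)" using cnt by simp
  finally show "card {w. w ^ m = \<eta>} = m" using A set by simp
qed

lemma unity_roots_card:
  assumes "0 < m" "(of_nat m :: 'a::alg_closed_field) \<noteq> 0"
  shows "finite (unity_roots m :: 'a set)" "card (unity_roots m :: 'a set) = m"
  using card_power_fiber[OF assms, of 1] by (auto simp: unity_roots_def)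

lemma one_in_unity_roots [simp]: "1 \<in> unity_roots m"
  by (simp add: unity_roots_def)

lemma unity_roots_mult: "w \<in> unity_roots m \<Longrightarrow> z \<in> unity_roots m \<Longrightarrow> w * z \<in> unity_roots m"
  by (simp add: unity_roots_def power_mult_distrib)

lemma unity_roots_inverse: "w \<in> unity_roots m \<Longrightarrow> inverse w \<in> unity_roots m"
  by (simp add: unity_roots_def power_inverse)

lemma unity_roots_nonzero: "0 < m \<Longrightarrow> w \<in> unity_roots m \<Longrightarrow> w \<noteq> 0"
  by (auto simp: unity_roots_def power_0_left)

lemma unity_roots_reindex:
  assumes "0 < m" "w \<in> unity_roots m"
  shows "bij_betw (\<lambda>z. w * z) (unity_roots m) (unity_roots m)"
  using unity_roots_nonzero[OF assms]
  by (intro bij_betwI[of _ _ _ "\<lambda>z. inverse w * z"])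
    (auto simp: unity_roots_mult unity_roots_inverse assms mult.assoc[symmetric])

text \<open>This does the work of a primitive root of unity: otherwise all \<open>m\<close> roots
  would be zeros of X^(n mod m) - 1, which has smaller degree.\<close>

lemma unity_roots_all_power_one:
  assumes m: "0 < m" "(of_nat m :: 'a::alg_closed_field) \<noteq> 0"
    and all: "\<And>w :: 'a. w \<in> unity_roots m \<Longrightarrow> w ^ n = 1"
  shows "m dvd n"
proof (rule ccontr)
  assume "\<not> m dvd n"
  then have r: "0 < n mod m" by (simp add: dvd_eq_mod_eq_0)
  define p where "p = (monom 1 (n mod m) - 1 :: 'a poly)"
  have "coeff p (n mod m) = 1" using r by (simp add: p_def coeff_1)
  then have p0: "p \<noteq> 0" by auto
  have "degree p \<le> n mod m"
    unfolding p_def by (intro degree_diff_le) (auto simp: degree_monom_le)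
  moreover have "unity_roots m \<subseteq> {x. poly p x = 0}"
  proof
    fix w :: 'a assume w: "w \<in> unity_roots m"
    have "w ^ n = w ^ (n mod m) * (w ^ m) ^ (n div m)"
      using power_add[of w "n mod m" "m * (n div m)"] by (simp only: mod_mult_div_eq power_mult)
    then have "1 = w ^ (n mod m)" using all[OF w] w by (simp add: unity_roots_def)
    then show "w \<in> {x. poly p x = 0}" by (simp add: p_def poly_monom)
  qed
  then have "m \<le> card {x. poly p x = 0}"
    using card_mono[OF poly_roots_finite[OF p0]] unity_roots_card[OF m] by metis
  ultimately have "m \<le> n mod m" using card_poly_roots_bound[OF p0] by linarith
  then show False using mod_less_divisor[OF m(1), of n] by linarith
qed

lemma unity_roots_sum_power:
  assumes m: "0 < m" "(of_nat m :: 'a::alg_closed_field) \<noteq> 0" and n: "\<not> m dvd n"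
  shows "(\<Sum>w\<in>unity_roots m. w ^ n) = (0 :: 'a)"
proof -
  obtain z :: 'a where z: "z \<in> unity_roots m" "z ^ n \<noteq> 1"
    using unity_roots_all_power_one[OF m] n by blast
  have "(\<Sum>w\<in>unity_roots m. w ^ n) = (\<Sum>w\<in>unity_roots m. (z * w) ^ n)"
    using sum.reindex_bij_betw[OF unity_roots_reindex[OF m(1) z(1)], of "\<lambda>w. w ^ n"] by simp
  also have "\<dots> = z ^ n * (\<Sum>w\<in>unity_roots m. w ^ n)"
    by (simp add: power_mult_distrib sum_distrib_left)
  finally have "(1 - z ^ n) * (\<Sum>w\<in>unity_roots m. w ^ n) = 0" by (simp add: algebra_simps)
  then show ?thesis using z by simp
qed

text \<open>The substitution t \<mapsto> w t. For \<open>w\<close> an \<open>m\<close>-th root of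
  unity it fixes x = t^m and so acts as a Galois conjugation.\<close>

definition twist :: "'a::field \<Rightarrow> 'a fps \<Rightarrow> 'a fps" where
  "twist w S = Abs_fps (\<lambda>n. w ^ n * fps_nth S n)"

lemma twist_nth [simp]: "fps_nth (twist w S) n = w ^ n * fps_nth S n"
  by (simp add: twist_def)

lemma twist_morphism: "comm_ring_morphism (twist w)"
proof
  show "twist w (a * b) = twist w a * twist w b" for a b
  proof (rule fps_ext)
    fix n
    have "(\<Sum>i=0..n. w ^ n * (fps_nth a i * fps_nth b (n - i))) =
        (\<Sum>i=0..n. w ^ i * fps_nth a i * (w ^ (n - i) * fps_nth b (n - i)))"
    proof (rule sum.cong)
      fix i assume "i \<in> {0..n}"
      then have "w ^ n = w ^ i * w ^ (n - i)" using power_add[of w i "n - i"] by simp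
      then show "w ^ n * (fps_nth a i * fps_nth b (n - i)) = w ^ i * fps_nth a i * (w ^ (n - i) * fps_nth b (n - i))"
        by (simp add: mult_ac)
    qed simp
    then show "fps_nth (twist w (a * b)) n = fps_nth (twist w a * twist w b) n"
      by (simp add: fps_mult_nth sum_distrib_left)
  qed
qed (auto intro!: fps_ext simp: algebra_simps)

lemma twist_twist: "twist w (twist z S) = twist (w * z) S"
  by (rule fps_ext) (simp add: power_mult_distrib mult_ac)

lemma twist_1 [simp]: "twist 1 S = S"
  by (rule fps_ext) simp

lemma twist_pw: "0 < m \<Longrightarrow> twist w (pw m f) = pw m (twist (w ^ m) f)"
  by (rule fps_ext) (auto simp: pw_nth elim!: dvdE simp: power_mult)

lemma twist_pw_unity: "0 < m \<Longrightarrow> w \<in> unity_roots m \<Longrightarrow> twist w (pw m f) = pw m f"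
  by (simp add: twist_pw unity_roots_def)

text \<open>\<open>m\<close> and the exponents of \<open>S\<close> have no common factor, that is,
  the parametrization (t^m, S(t)) is not one in a higher power of t.\<close>

definition primitive :: "nat \<Rightarrow> 'a::field fps \<Rightarrow> bool" where
  "primitive m S \<longleftrightarrow> (\<forall>g. g dvd m \<longrightarrow> 1 < g \<longrightarrow> (\<exists>i. fps_nth S i \<noteq> 0 \<and> \<not> g dvd i))"

text \<open>The order of \<open>w\<close> divides \<open>m\<close> and every exponent of
  \<open>S\<close>, so primitivity forces it to be 1.\<close>

lemma twist_primitive:
  assumes m: "0 < m" and S: "primitive m S" and w: "w \<in> unity_roots m" "twist w S = S"
  shows "w = 1"
proof (rule ccontr)
  assume w1: "w \<noteq> 1"
  define g where "g = (LEAST g. 0 < g \<and> w ^ g = 1)"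
  have "\<exists>g>0. w ^ g = 1" using m w by (auto simp: unity_roots_def)
  then have "0 < g \<and> w ^ g = 1" unfolding g_def by (rule LeastI_ex)
  then have g: "0 < g" "w ^ g = 1" by auto
  have dvd: "g dvd i" if "w ^ i = 1" for i
  proof (rule ccontr)
    assume "\<not> g dvd i"
    then have r: "0 < i mod g" by (simp add: dvd_eq_mod_eq_0)
    have "w ^ i = w ^ (i mod g) * (w ^ g) ^ (i div g)"
      using power_add[of w "i mod g" "g * (i div g)"] by (simp only: mod_mult_div_eq power_mult)
    then have "w ^ (i mod g) = 1" using that g by simp
    then have "g \<le> i mod g" unfolding g_def using r
      by (intro Least_le) (auto simp: g_def)
    then show False using mod_less_divisor[OF g(1), of i] by linarith
  qed
  have "g dvd m" using dvd w by (simp add: unity_roots_def)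
  moreover have "1 < g" using g w1 by (cases "g = 1") auto
  ultimately obtain i where i: "fps_nth S i \<noteq> 0" "\<not> g dvd i"
    using S unfolding primitive_def by blast
  have "w ^ i * fps_nth S i = fps_nth S i" using w(2) by (metis twist_nth)
  then show False using i dvd by auto
qed

lemma twist_inj:
  assumes m: "0 < m" and S: "primitive m S"
  shows "inj_on (\<lambda>w. twist w S) (unity_roots m)"
proof (rule inj_onI)
  fix w z assume wz: "w \<in> unity_roots m" "z \<in> unity_roots m" "twist w S = twist z S"
  then have "twist (inverse z) (twist w S) = twist (inverse z) (twist z S)" by simp
  then have "twist (inverse z * w) S = S"
    using unity_roots_nonzero[OF m wz(2)] by (simp add: twist_twist)
  then have "inverse z * w = 1"
    using twist_primitive[OF m S] wz by (simp add: unity_roots_mult unity_roots_inverse)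
  then show "w = z"
    using unity_roots_nonzero[OF m wz(2)] by (simp add: field_simps)
qed

definition ev :: "nat \<Rightarrow> 'a::field fps \<Rightarrow> 'a fps poly \<Rightarrow> 'a fps" where
  "ev m S H = poly (map_poly (pw m) H) S"

lemma ev_morphism: "0 < m \<Longrightarrow> comm_ring_morphism (ev m S)"
  unfolding ev_def
  by (intro comm_ring_morphism_comp[OF poly_eval_morphism] comm_ring_morphism.map_poly_morphism pw_morphism)

lemma ev_twist:
  assumes "0 < m" "w \<in> unity_roots m"
  shows "ev m (twist w S) H = twist w (ev m S H)"
proof -
  interpret tw: comm_ring_morphism "twist w" by (rule twist_morphism)
  have "map_poly (twist w) (map_poly (pw m) H) = map_poly (pw m) H"
    using assms by (intro poly_eqI) (simp add: coeff_map_poly twist_pw_unity tw.zero)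
  then show ?thesis unfolding ev_def using tw.poly_map_poly[of "map_poly (pw m) H" S] by simp
qed

lemma map_pw_degree: "0 < m \<Longrightarrow> degree (map_poly (pw m) H) = degree H"
  by (rule degree_map_poly) simp

lemma map_pw_eq_0_iff: "0 < m \<Longrightarrow> map_poly (pw m) H = 0 \<longleftrightarrow> H = 0"
  by (rule map_poly_eq_0_iff) auto

text \<open>By primitivity the conjugates of \<open>S\<close> are \<open>m\<close> distinct series,
  and all of them are roots together with \<open>S\<close>.\<close>

lemma degree_ge_of_root:
  fixes S :: "'a::alg_closed_field fps"
  assumes m: "0 < m" "(of_nat m :: 'a) \<noteq> 0" and S: "primitive m S" and H: "ev m S H = 0" "H \<noteq> 0"
  shows "m \<le> degree H"
proof -
  let ?p = "map_poly (pw m) H"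
  have p0: "?p \<noteq> 0" using H m by (simp add: map_pw_eq_0_iff)
  have "(\<lambda>w. twist w S) ` unity_roots m \<subseteq> {x. poly ?p x = 0}"
    using ev_twist[OF m(1), of _ S H] H comm_ring_morphism.zero[OF twist_morphism] by (auto simp: ev_def)
  then have "card ((\<lambda>w. twist w S) ` unity_roots m) \<le> card {x. poly ?p x = 0}"
    by (rule card_mono[OF poly_roots_finite[OF p0]])
  also have "\<dots> \<le> degree ?p" by (rule card_poly_roots_bound[OF p0])
  also have "\<dots> = degree H" using m by (simp add: map_pw_degree)
  finally show ?thesis using card_image[OF twist_inj[OF m(1) S]] unity_roots_card[OF m] by simp
qed

text \<open>Galois descent: a twist permutes the factors, so the coefficients of the product are
  fixed by all twists, involve only exponents divisible by \<open>m\<close>, and are series in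
  t^m.\<close>

lemma norm_poly_exists:
  fixes S :: "'a::alg_closed_field fps"
  assumes m: "0 < m" "(of_nat m :: 'a) \<noteq> 0"
  shows "\<exists>Q. lead_coeff Q = 1 \<and> degree Q = m \<and>
           map_poly (pw m) Q = (\<Prod>w\<in>unity_roots m. [:- twist w S, 1:])"
proof -
  define p where "p = (\<Prod>w\<in>unity_roots m. [:- twist w S, 1:])"
  have "map_poly (twist z) p = p" if z: "z \<in> unity_roots m" for z
  proof -
    interpret tw: comm_ring_morphism "twist z" by (rule twist_morphism)
    interpret mtw: comm_ring_morphism "map_poly (twist z)" by (rule tw.map_poly_morphism)
    have "map_poly (twist z) p = (\<Prod>w\<in>unity_roots m. [:- twist (z * w) S, 1:])"
      unfolding p_def by (simp add: mtw.prod tw.minus twist_twist)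
    also have "\<dots> = p"
      unfolding p_def
      by (rule prod.reindex_bij_betw[OF unity_roots_reindex[OF m(1) z], of "\<lambda>w. [:- twist w S, 1:]"])
    finally show ?thesis .
  qed
  then have inv: "twist z (coeff p i) = coeff p i" if "z \<in> unity_roots m" for z i
    using that comm_ring_morphism.coeff_map[OF twist_morphism] by metis
  have dvd: "m dvd n" if "fps_nth (coeff p i) n \<noteq> 0" for i n
  proof (rule unity_roots_all_power_one[OF m])
    fix w :: 'a assume "w \<in> unity_roots m"
    from inv[OF this, of i] have "w ^ n * fps_nth (coeff p i) n = fps_nth (coeff p i) n"
      by (metis twist_nth)
    with that show "w ^ n = 1" by simp
  qed
  define desc where "desc f = Abs_fps (\<lambda>n. fps_nth f (m * n))" for f :: "'a fps"
  have desc: "pw m (desc (coeff p i)) = coeff p i" for i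
    using m dvd[of i] by (intro fps_ext) (auto simp: pw_nth desc_def)
  define Q where "Q = map_poly desc p"
  have mQ: "map_poly (pw m) Q = p"
    using m desc by (intro poly_eqI) (simp add: Q_def coeff_map_poly desc_def fps_zero_def[symmetric])
  have fin: "finite (unity_roots m :: 'a set)" using unity_roots_card[OF m] by blast
  have dp: "degree p = m \<and> lead_coeff p = 1"
  proof -
    have "degree p = (\<Sum>w\<in>(unity_roots m :: 'a set). degree [:- twist w S, 1:])"
      unfolding p_def by (rule degree_prod_eq_sum_degree) auto
    moreover have "lead_coeff p = 1" unfolding p_def lead_coeff_prod by simp
    ultimately show ?thesis using unity_roots_card[OF m] by simp
  qed
  have dQ: "degree Q = m" using mQ dp map_pw_degree[OF m(1), of Q] by simp
  have "pw m (coeff Q m) = coeff p m"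
    using mQ by (metis comm_ring_morphism.coeff_map[OF pw_morphism[OF m(1)]])
  also have "\<dots> = 1" using dp by metis
  also have "\<dots> = pw m 1" by (simp add: comm_ring_morphism.one[OF pw_morphism[OF m(1)]])
  finally have "pw m (coeff Q m - 1) = 0"
    by (simp add: comm_ring_morphism.diff[OF pw_morphism[OF m(1)]])
  then have "coeff Q m = 1" using m by simp
  with dQ mQ show ?thesis unfolding p_def by blast
qed

text \<open>Among all Puiseux roots one with least \<open>m\<close> is primitive, since a common
  factor could be removed by lowering the ramification.\<close>

lemma primitive_root_exists:
  fixes F :: "'a::alg_closed_field fps poly"
  assumes "lead_coeff F = 1" "0 < degree F"
    and "\<And>k. 0 < k \<Longrightarrow> k \<le> degree F \<Longrightarrow> (of_nat k :: 'a) \<noteq> 0"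
  shows "\<exists>m S. 0 < m \<and> (of_nat m :: 'a) \<noteq> 0 \<and> primitive m S \<and> ev m S F = 0"
proof -
  define P where "P m \<longleftrightarrow> 0 < m \<and> (of_nat m :: 'a) \<noteq> 0 \<and> (\<exists>S. ev m S F = 0)" for m
  have "\<exists>m. P m" using puiseux_root[OF assms] unfolding P_def ev_def by blast
  define m where "m = (LEAST m. P m)"
  have "P m" unfolding m_def using \<open>\<exists>m. P m\<close> by (rule LeastI_ex)
  then obtain S where m: "0 < m" "(of_nat m :: 'a) \<noteq> 0" "ev m S F = 0" unfolding P_def by blast
  have "primitive m S"
    unfolding primitive_def
  proof (intro allI impI, rule ccontr)
    fix g assume g: "g dvd m" "1 < g" and no: "\<nexists>i. fps_nth S i \<noteq> 0 \<and> \<not> g dvd i"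
    obtain k where k: "m = g * k" using g by blast
    then have k0: "0 < k" "k < m" "(of_nat k :: 'a) \<noteq> 0" using m g by auto
    define T where "T = Abs_fps (\<lambda>n. fps_nth S (g * n))"
    have T: "S = pw g T" using no g by (intro fps_ext) (auto simp: pw_nth T_def)
    have "map_poly (pw m) F = map_poly (pw g) (map_poly (pw k) F)"
      using g k0 by (intro poly_eqI) (simp add: coeff_map_poly pw_pw k)
    then have "ev m S F = pw g (ev k T F)"
      unfolding ev_def T using g comm_ring_morphism.poly_map_poly[OF pw_morphism[of g], of "map_poly (pw k) F" T]
      by simp
    then have "ev k T F = 0" using m g by simp
    then have "P k" using k0 unfolding P_def by blast
    then have "m \<le> k" unfolding m_def by (rule Least_le)
    with k0 show False by simp
  qed
  with m show ?thesis by blast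
qed

text \<open>The norm polynomial of a primitive root divides \<open>F\<close>, because a remainder of
  degree below \<open>m\<close> cannot vanish on the branch. It is irreducible, because the factor
  vanishing on the branch already has degree \<open>m\<close>.\<close>

lemma irreducible_parametrization:
  fixes F :: "'a::alg_closed_field fps poly"
  assumes F: "lead_coeff F = 1" "0 < degree F"
    and char: "\<And>k. 0 < k \<Longrightarrow> k \<le> degree F \<Longrightarrow> (of_nat k :: 'a) \<noteq> 0"
  shows "\<exists>m S. 0 < m \<and> m \<le> degree F \<and> primitive m S \<and> ev m S F = 0 \<and>
           (Factorial_Ring.irreducible F \<longleftrightarrow> m = degree F) \<and>
           (m = degree F \<longrightarrow> map_poly (pw m) F = (\<Prod>w\<in>unity_roots m. [:- twist w S, 1:]))"
proof -
  obtain m S where m: "0 < m" "(of_nat m :: 'a) \<noteq> 0" and S: "primitive m S" "ev m S F = 0"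
    using primitive_root_exists[OF assms] by blast
  obtain Q where Q: "lead_coeff Q = 1" "degree Q = m"
    "map_poly (pw m) Q = (\<Prod>w\<in>unity_roots m. [:- twist w S, 1:])"
    using norm_poly_exists[OF m] by blast
  interpret ev: comm_ring_morphism "ev m S" by (rule ev_morphism[OF m(1)])
  have evQ: "ev m S Q = 0"
    unfolding ev_def Q poly_prod using unity_roots_card[OF m] by (intro prod_zero) (auto intro!: bexI[of _ 1])
  obtain q r where qr: "F = q * Q + r" "degree r < m"
    using monic_division[OF Q(1)] Q(2) m by metis
  have "ev m S r = 0" using S(2) evQ unfolding qr(1) by (simp add: ev.add ev.mult)
  then have "r = 0" using degree_ge_of_root[OF m S(1)] qr(2) by force
  then have F_eq: "F = q * Q" using qr by simp
  have q0: "q \<noteq> 0" using F_eq F by auto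
  have dF: "degree F = degree q + m" using F_eq degree_mult_monic[OF Q(1) q0] Q by simp
  have lq: "lead_coeff q = 1" using F(1) Q(1) unfolding F_eq lead_coeff_mult by simp
  have irred: "Factorial_Ring.irreducible Q"
  proof (rule Factorial_Ring.irreducibleI)
    show "Q \<noteq> 0" "\<not> Q dvd 1" using Q m by (auto simp: is_unit_poly_iff)
    have unit: "B dvd 1" if AB: "Q = A * B" "ev m S A = 0" for A B
    proof -
      have AB0: "A \<noteq> 0" "B \<noteq> 0" using AB Q m by auto
      have "m \<le> degree A" using degree_ge_of_root[OF m S(1) AB(2) AB0(1)] .
      moreover have "degree A + degree B = m" using AB Q AB0 by (metis degree_mult_eq)
      ultimately have "degree B = 0" by simp
      then obtain b where b: "B = [:b:]" by (metis degree_eq_zeroE)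
      have "lead_coeff A * b = 1" using Q(1) unfolding AB(1) b lead_coeff_mult by simp
      then show ?thesis unfolding b by (metis dvd_triv_right is_unit_poly_iff)
    qed
    fix A B assume AB: "Q = A * B"
    then have "ev m S A * ev m S B = 0" using evQ by (simp add: ev.mult)
    then show "A dvd 1 \<or> B dvd 1" using unit[of A B] unit[of B A] AB by (auto simp: mult.commute)
  qed
  have deg_eq: "F = Q" if "m = degree F"
  proof -
    have "degree q = 0" using that dF by simp
    then have "q = 1" using lq by (metis degree_eq_zeroE lead_coeff_pCons(2) one_pCons)
    then show ?thesis using F_eq by simp
  qed
  have "m = degree F" if "Factorial_Ring.irreducible F"
  proof -
    have "q dvd 1 \<or> Q dvd 1" using that F_eq by (rule Factorial_Ring.irreducibleD)
    moreover have "\<not> Q dvd 1" using Q m by (auto simp: is_unit_poly_iff)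
    ultimately have "degree q = 0" by (auto simp: is_unit_poly_iff)
    then show ?thesis using dF by simp
  qed
  moreover have "Factorial_Ring.irreducible F" if "m = degree F"
    using irred deg_eq[OF that] by metis
  moreover have "map_poly (pw m) F = (\<Prod>w\<in>unity_roots m. [:- twist w S, 1:])" if "m = degree F"
    using Q(3) deg_eq[OF that] by metis
  moreover have "m \<le> degree F" using dF by linarith
  ultimately show ?thesis using m(1) S by blast
qed

section \<open>The order of a power series\<close>

definition ord :: "'b::idom fps \<Rightarrow> enat" where
  "ord f = (if f = 0 then \<infinity> else enat (subdegree f))"

lemma valuation_ord: "valuation (ord :: 'b::idom fps \<Rightarrow> enat)"
proof
  fix a b :: "'b fps"
  show "min (ord a) (ord b) \<le> ord (a + b)"
    unfolding ord_def using subdegree_add_ge'[of a b] by (auto simp: min_def)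
qed (auto simp: ord_def zero_enat_def)

lemma valuation_morphism:
  "valuation v \<Longrightarrow> comm_ring_morphism h \<Longrightarrow> valuation (\<lambda>a. v (h a))"
  by unfold_locales
    (auto simp: comm_ring_morphism.add comm_ring_morphism.mult comm_ring_morphism.zero
      comm_ring_morphism.one valuation.zero valuation.one valuation.mult valuation.add_ge)

lemma ord_ge_iff: "enat k \<le> ord f \<longleftrightarrow> (\<forall>i<k. fps_nth f i = 0)"
  unfolding ord_def by (auto intro: subdegree_geI dest: nth_less_subdegree_zero order_less_le_trans)

lemma ord_eq_iff: "ord f = enat k \<longleftrightarrow> (\<forall>i<k. fps_nth f i = 0) \<and> fps_nth f k \<noteq> 0"
  unfolding ord_def by (auto intro: subdegreeI)

section \<open>Newton polygons\<close>

definition quadrant_hull :: "nat set \<Rightarrow> (nat \<Rightarrow> real) \<Rightarrow> (real \<times> real) set" where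
  "quadrant_hull I h = convex hull (\<Union>i\<in>I. {(real i + s, h i + t) | s t. 0 \<le> s \<and> 0 \<le> t})"

definition lower_edges :: "(real \<times> real) set \<Rightarrow> (real \<times> real) set" where
  "lower_edges C = (if compact_negative_edges C = {} then {p. p extreme_point_of C}
     else \<Union>(compact_negative_edges C))"

lemma newton_polygon_conv_lower_edges:
  "newton_polygon v \<psi> F = lower_edges (quadrant_hull {i. adic_expansion \<psi> F i \<noteq> 0}
     (\<lambda>i. real (the_enat (v (adic_expansion \<psi> F i * \<psi> ^ i)))))"
  unfolding newton_polygon_def newton_region_def lower_edges_def quadrant_hull_def by (simp add: Let_def)

lemma quadrant_hull_vertex: "i \<in> I \<Longrightarrow> (real i, h i) \<in> quadrant_hull I h"
  unfolding quadrant_hull_def by (rule hull_inc) (force intro!: exI[of _ 0])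

lemma quadrant_hull_convex: "convex (quadrant_hull I h)"
  unfolding quadrant_hull_def by (rule convex_convex_hull)

lemma quadrant_hull_up:
  assumes "p \<in> quadrant_hull I h" "0 \<le> s" "0 \<le> t"
  shows "(s, t) + p \<in> quadrant_hull I h"
proof -
  define U where "U = (\<Union>i\<in>I. {(real i + s, h i + t) | s t. 0 \<le> s \<and> 0 \<le> t})"
  have "(\<lambda>x. (s, t) + x) ` U \<subseteq> U"
  proof
    fix x assume "x \<in> (\<lambda>x. (s, t) + x) ` U"
    then obtain i s' t' where "i \<in> I" "0 \<le> s'" "0 \<le> t'" "x = (real i + (s + s'), h i + (t + t'))"
      unfolding U_def by (auto simp: algebra_simps)
    then show "x \<in> U" unfolding U_def using assms by (intro UN_I[of i]) (auto intro!: exI add_nonneg_nonneg)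
  qed
  then have "convex hull ((\<lambda>x. (s, t) + x) ` U) \<subseteq> convex hull U" by (rule hull_mono)
  then show ?thesis
    using assms(1) unfolding quadrant_hull_def U_def[symmetric] convex_hull_translation by blast
qed

lemma quadrant_hull_ge:
  assumes "0 \<le> a" "0 \<le> b" "\<And>i. i \<in> I \<Longrightarrow> k \<le> a * real i + b * h i" "p \<in> quadrant_hull I h"
  shows "k \<le> a * fst p + b * snd p"
proof -
  have "quadrant_hull I h \<subseteq> {x. inner (a, b) x \<ge> k}"
    unfolding quadrant_hull_def
  proof (rule hull_minimal)
    show "convex {x. inner (a, b) x \<ge> k}" by (rule convex_halfspace_ge)
    show "(\<Union>i\<in>I. {(real i + s, h i + t) | s t. 0 \<le> s \<and> 0 \<le> t}) \<subseteq> {x. inner (a, b) x \<ge> k}"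
    proof safe
      fix i and s t :: real assume "i \<in> I" "0 \<le> s" "0 \<le> t"
      then have "k + 0 \<le> (a * real i + b * h i) + (a * s + b * t)"
        using assms by (intro add_mono) auto
      then show "k \<le> inner (a, b) (real i + s, h i + t)" by (simp add: inner_prod_def algebra_simps)
    qed
  qed
  then show ?thesis using assms(4) by (auto simp: inner_prod_def)
qed

text \<open>A point displaced from its vertex by (s, t) is the midpoint of the vertex and the point
  displaced by twice as much.\<close>

lemma extreme_points_quadrant_hull:
  "{p. p extreme_point_of quadrant_hull I h} \<subseteq> (\<lambda>i. (real i, h i)) ` I"
proof safe
  fix x y assume ext: "(x, y) extreme_point_of quadrant_hull I h"
  then have "(x, y) \<in> (\<Union>i\<in>I. {(real i + s, h i + t) | s t. 0 \<le> s \<and> 0 \<le> t})"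
    unfolding quadrant_hull_def by (rule extreme_point_of_convex_hull)
  then obtain i s t where i: "i \<in> I" "0 \<le> s" "0 \<le> t" "x = real i + s" "y = h i + t" by blast
  show "(x, y) \<in> (\<lambda>i. (real i, h i)) ` I"
  proof (cases "s = 0 \<and> t = 0")
    case False
    let ?a = "(real i, h i)" and ?b = "(2 * s, 2 * t) + (real i, h i)"
    have ab: "?a \<in> quadrant_hull I h" "?b \<in> quadrant_hull I h"
      using i by (auto intro: quadrant_hull_vertex intro!: quadrant_hull_up simp del: add_Pair)
    have "(x, y) = midpoint ?a ?b" using i by (simp add: midpoint_def)
    moreover have "?a \<noteq> ?b" using False by auto
    ultimately have "(x, y) \<in> open_segment ?a ?b" by (simp add: midpoint_in_open_segment)
    then show ?thesis using ext ab unfolding extreme_point_of_def by blast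
  qed (use i in auto)
qed

lemma collinear_cross:
  fixes p r x :: "real \<times> real"
  assumes "collinear e" "p \<in> e" "r \<in> e" "x \<in> e"
  shows "(snd x - snd p) * (fst r - fst p) = (snd r - snd p) * (fst x - fst p)"
proof -
  obtain u where u: "\<And>x y. x \<in> e \<Longrightarrow> y \<in> e \<Longrightarrow> \<exists>c. x - y = c *\<^sub>R u"
    using assms(1) unfolding collinear_def by blast
  obtain c d where "x - p = c *\<^sub>R u" "r - p = d *\<^sub>R u" using u assms by meson
  then have "fst x - fst p = c * fst u" "snd x - snd p = c * snd u"
    "fst r - fst p = d * fst u" "snd r - snd p = d * snd u"
    by (simp_all flip: fst_diff snd_diff)
  then show ?thesis by simp
qed

text \<open>
  If \<open>x\<close> were strictly below the line through \<open>p\<close> and \<open>r\<close>, prolonging the segment from \<open>x\<close>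
  through the midpoint of \<open>p\<close> and \<open>r\<close> a little further would stay in \<open>C\<close>, which is closed upwards.
\<close>
lemma above_negative_face:
  fixes p r x :: "real \<times> real"
  assumes C: "convex C" "\<And>p s t. p \<in> C \<Longrightarrow> 0 \<le> s \<Longrightarrow> 0 \<le> t \<Longrightarrow> (s, t) + p \<in> C"
    and e: "e face_of C" "collinear e" "p \<in> e" "r \<in> e" "fst p < fst r" "snd r < snd p" and x: "x \<in> C"
  shows "(snd r - snd p) * (fst x - fst p) \<le> (snd x - snd p) * (fst r - fst p)"
proof (rule ccontr)
  define D where "D = fst r - fst p"
  define E where "E = snd r - snd p"
  define L where "L w = (snd w - snd p) * D - E * (fst w - fst p)" for w :: "real \<times> real"
  have D: "0 < D" using e by (simp add: D_def)
  assume "\<not> ?thesis"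
  then have Lx: "L x < 0" by (simp add: L_def D_def E_def)
  define z where "z = (1/2) *\<^sub>R p + (1/2) *\<^sub>R r"
  have ze: "z \<in> e"
    unfolding z_def using face_of_imp_convex[OF e(1)] e by (intro convexD) auto
  have fz: "fst z = fst p + D / 2" "snd z = snd p + E / 2" by (simp_all add: z_def D_def E_def field_simps)
  define \<delta> where "\<delta> = fst z - fst x"
  \<comment> \<open>Small enough that the abscissa of the prolonged point \<open>y\<close> stays
    between those of \<open>p\<close> and \<open>r\<close>, so that \<open>e\<close> has a point
    \<open>p'\<close> with that abscissa.\<close>
  define \<epsilon> where "\<epsilon> = D / (2 * (\<bar>\<delta>\<bar> + 1))"
  have \<epsilon>: "0 < \<epsilon>" using D by (simp add: \<epsilon>_def)
  define \<tau> where "\<tau> = \<epsilon> * \<delta> / D"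
  have "\<tau> = \<delta> / (2 * (\<bar>\<delta>\<bar> + 1))" using D by (simp add: \<tau>_def \<epsilon>_def)
  then have "\<bar>\<tau>\<bar> \<le> 1/2" by (simp add: abs_mult divide_le_eq)
  then have \<tau>: "- 1/2 \<le> \<tau>" "\<tau> \<le> 1/2" by auto
  define y where "y = z + \<epsilon> *\<^sub>R (z - x)"
  define p' where "p' = (1/2 - \<tau>) *\<^sub>R p + (1/2 + \<tau>) *\<^sub>R r"
  have "p' \<in> e"
    unfolding p'_def using face_of_imp_convex[OF e(1)] e \<tau> by (intro convexD) auto
  then have p'C: "p' \<in> C" using face_of_imp_subset[OF e(1)] by blast
  have fp': "fst p' = fst z + \<tau> * D" "snd p' = snd z + \<tau> * E"
    by (simp_all add: p'_def fz D_def E_def algebra_simps add_divide_distrib diff_divide_distrib)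
  have fy: "fst y = fst p'" using D by (simp add: y_def fp' \<tau>_def \<delta>_def)
  have Lz: "L z = 0" by (simp add: L_def fz)
  have Ly: "L y = - \<epsilon> * L x"
  proof -
    have "L y = L z + \<epsilon> * (L z - L x)" by (simp add: L_def y_def algebra_simps)
    then show ?thesis using Lz by simp
  qed
  have "L p' = 0" by (simp add: L_def fp' fz algebra_simps)
  then have "L y = (snd y - snd p') * D" by (simp add: L_def fy algebra_simps)
  moreover have "0 < L y" using Ly \<epsilon> Lx by (simp add: mult_pos_neg)
  ultimately have "0 < snd y - snd p'" using D by (simp add: zero_less_mult_iff)
  then have "(0, snd y - snd p') + p' \<in> C" using C(2)[OF p'C] by simp
  moreover have "(0, snd y - snd p') + p' = y" using fy by (simp add: prod_eq_iff)
  ultimately have yC: "y \<in> C" by simp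
  have "0 < L y" using Ly \<epsilon> Lx by (simp add: mult_pos_neg)
  then have "x \<noteq> y" using Lx by auto
  moreover have "z = (1 - 1 / (1 + \<epsilon>)) *\<^sub>R x + (1 / (1 + \<epsilon>)) *\<^sub>R y"
  proof -
    have "(1 + \<epsilon>) *\<^sub>R z = \<epsilon> *\<^sub>R x + y" by (simp add: y_def algebra_simps)
    moreover have "z = (1 / (1 + \<epsilon>)) *\<^sub>R ((1 + \<epsilon>) *\<^sub>R z)" using \<epsilon> by simp
    ultimately have "z = (1 / (1 + \<epsilon>)) *\<^sub>R (\<epsilon> *\<^sub>R x + y)" by simp
    moreover have "1 - 1 / (1 + \<epsilon>) = \<epsilon> / (1 + \<epsilon>)" using \<epsilon> by (simp add: field_simps)
    ultimately show ?thesis by (simp only: scaleR_add_right scaleR_scaleR) simp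
  qed
  ultimately have "z \<in> open_segment x y"
    unfolding in_segment using \<epsilon> by (intro conjI exI[of _ "1 / (1 + \<epsilon>)"]) auto
  then have "x \<in> e" using e(1) ze x yC unfolding face_of_def by blast
  then have "L x = 0" using collinear_cross[OF e(2) e(3,4)] by (simp add: L_def D_def E_def)
  then show False using Lx by simp
qed

lemma edge_collinear: "aff_dim e = 1 \<Longrightarrow> collinear (e :: (real \<times> real) set)"
  by (simp add: collinear_aff_dim)

text \<open>Without a negative edge only finitely many extreme points would be left, too few for a
  segment. So the segment contains such an edge; the line through this edge supports the whole
  region, and the inequalities are read off from it.\<close>

lemma straight_lower_edgesD:
  assumes I: "finite I" and N: "0 < N" and B: "(real N, B) \<in> lower_edges (quadrant_hull I h)"
    and st: "straight N (lower_edges (quadrant_hull I h))"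
  shows "0 \<in> I" "lower_edges (quadrant_hull I h) = closed_segment (0, h 0) (real N, B)" "B < h 0"
    "\<And>i. i \<in> I \<Longrightarrow> real N * h 0 + (B - h 0) * real i \<le> real N * h i"
proof -
  let ?C = "quadrant_hull I h"
  obtain a b where seg: "lower_edges ?C = closed_segment (0, a) (real N, b)"
    using st unfolding straight_def by blast
  have ne: "compact_negative_edges ?C \<noteq> {}"
  proof
    assume "compact_negative_edges ?C = {}"
    then have "lower_edges ?C \<subseteq> (\<lambda>i. (real i, h i)) ` I"
      using extreme_points_quadrant_hull[of I h] unfolding lower_edges_def by simp
    then have "finite (closed_segment (0, a) (real N, b))"
      unfolding seg using I finite_subset by blast
    then show False using N by (simp add: finite_closed_segment)
  qed
  then obtain e where eE: "e \<in> compact_negative_edges ?C" by blast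
  then obtain p r where e: "e face_of ?C" "aff_dim e = 1" "p \<in> e" "r \<in> e" "fst p < fst r" "snd r < snd p"
    unfolding compact_negative_edges_def by blast
  have on: "\<exists>u. 0 \<le> u \<and> u \<le> 1 \<and> fst x = u * real N \<and> snd x = a + u * (b - a)"
    if "x \<in> lower_edges ?C" for x
    using that unfolding seg in_segment by (force simp: algebra_simps)
  have le: "lower_edges ?C = \<Union>(compact_negative_edges ?C)" using ne by (simp add: lower_edges_def)
  then have sub: "lower_edges ?C \<subseteq> ?C"
    unfolding compact_negative_edges_def using face_of_imp_subset by blast
  have "p \<in> lower_edges ?C" "r \<in> lower_edges ?C" using le eE e by auto
  then obtain u u' where u: "fst p = u * real N" "snd p = a + u * (b - a)"
      "fst r = u' * real N" "snd r = a + u' * (b - a)" using on by meson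
  then have uu': "u < u'" using e(5) N by simp
  then have "(u' - u) * (b - a) < 0" using u e(6) by (simp add: algebra_simps)
  then have ba: "b < a" using uu' by (simp add: mult_less_0_iff)
  have Bb: "B = b"
  proof -
    obtain w where "real N = w * real N" "B = a + w * (b - a)" using on[OF B] by auto
    then show ?thesis using N by simp
  qed
  have line: "(b - a) * fst x \<le> (snd x - a) * real N" if "x \<in> ?C" for x
  proof -
    have "(snd r - snd p) * (fst x - fst p) \<le> (snd x - snd p) * (fst r - fst p)"
      by (rule above_negative_face[OF quadrant_hull_convex quadrant_hull_up e(1) edge_collinear[OF e(2)] e(3-6) that])
    then have "(u' - u) * ((b - a) * fst x) \<le> (u' - u) * ((snd x - a) * real N)"
      unfolding u by (simp add: algebra_simps)
    then show ?thesis using uu' by simp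
  qed
  have a0: "(0, a) \<in> ?C" using sub unfolding seg by auto
  show "0 \<in> I"
  proof (rule ccontr)
    assume "0 \<notin> I"
    then have "1 \<le> 1 * real i + 0 * h i" if "i \<in> I" for i
      using that by (cases i) auto
    from quadrant_hull_ge[OF _ _ this a0] show False by simp
  qed
  have "a \<le> h 0" using line[OF quadrant_hull_vertex[OF \<open>0 \<in> I\<close>, of h]] N
    by (simp add: zero_le_mult_iff)
  moreover have "h 0 \<le> a"
  proof -
    \<comment> \<open>\<open>M\<close> bounds every difference \<open>h 0 - h i\<close>, so the line
      of slope \<open>-M\<close> through the vertex at 0 supports the region and no point of
      abscissa 0 lies below that vertex.\<close>
    define M where "M = \<bar>h 0\<bar> + (\<Sum>i\<in>I. \<bar>h i\<bar>)"
    have M: "h 0 - h i \<le> M" if "i \<in> I" for i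
      unfolding M_def using member_le_sum[OF that _ I, of "\<lambda>i. \<bar>h i\<bar>"] by simp
    have "0 \<le> M" unfolding M_def by (intro add_nonneg_nonneg sum_nonneg) auto
    have "h 0 \<le> M * real i + 1 * h i" if "i \<in> I" for i
    proof (cases "i = 0")
      case False
      then have "M * 1 \<le> M * real i" using \<open>0 \<le> M\<close> by (intro mult_left_mono) auto
      then show ?thesis using M[OF that] by linarith
    qed simp
    from quadrant_hull_ge[OF \<open>0 \<le> M\<close> _ this a0] show ?thesis by simp
  qed
  ultimately have a: "a = h 0" by simp
  show "lower_edges ?C = closed_segment (0, h 0) (real N, B)" "B < h 0"
    using seg ba a Bb by auto
  show "real N * h 0 + (B - h 0) * real i \<le> real N * h i" if "i \<in> I" for i
    using line[OF quadrant_hull_vertex[OF that, of h]] by (simp add: a Bb algebra_simps)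
qed

text \<open>The segment is a face by its supporting line; the work is to exclude other negative
  edges. The midpoint \<open>z\<close> of two points of such an edge cannot lie above the line,
  since the region would then contain a point strictly to the left of and below \<open>z\<close>. So
  \<open>z\<close> lies in the segment, and the two faces coincide.\<close>

lemma straight_lower_edgesI:
  assumes N: "0 < N" "0 \<in> I" "N \<in> I" "\<And>i. i \<in> I \<Longrightarrow> i \<le> N" "h N < h 0"
    and line: "\<And>i. i \<in> I \<Longrightarrow> real N * h 0 + (h N - h 0) * real i \<le> real N * h i"
  shows "lower_edges (quadrant_hull I h) = closed_segment (0, h 0) (real N, h N)"
proof -
  let ?C = "quadrant_hull I h"
  define s where "s = closed_segment (0, h 0) (real N, h N)"
  define L where "L x = (h 0 - h N) * fst x + real N * snd x" for x :: "real \<times> real"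
  define k where "k = real N * h 0"
  have L: "k \<le> L x" if "x \<in> ?C" for x
    unfolding L_def by (rule quadrant_hull_ge[of _ _ I _ h, OF _ _ _ that])
      (use N line in \<open>auto simp: k_def algebra_simps\<close>)
  have f0: "0 \<le> fst x" if "x \<in> ?C" for x
    using quadrant_hull_ge[of 1 0 I 0 h x] that by simp
  have sN: "h N \<le> snd x" if "x \<in> ?C" for x
  proof -
    have "h N \<le> h i" if i: "i \<in> I" for i
    proof -
      have "real N * h N = real N * h 0 + (h N - h 0) * real N" by (simp add: algebra_simps)
      also have "\<dots> \<le> real N * h 0 + (h N - h 0) * real i"
        using N i by (intro add_left_mono mult_left_mono_neg) auto
      also have "\<dots> \<le> real N * h i" using line[OF i] .
      finally show ?thesis using N by simp
    qed
    then show ?thesis using quadrant_hull_ge[of 0 1 I "h N" h x] that by simp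
  qed
  have sC: "s \<subseteq> ?C"
    unfolding s_def using quadrant_hull_vertex[OF N(2), of h] quadrant_hull_vertex[OF N(3), of h]
    by (intro closed_segment_subset quadrant_hull_convex) auto
  have sL: "s = ?C \<inter> {x. L x = k}"
  proof (intro equalityI subsetI IntI CollectI)
    fix p assume ps: "p \<in> s"
    then show "p \<in> ?C" using sC by blast
    obtain u where p: "p = (u * real N, (1 - u) * h 0 + u * h N)"
      using ps unfolding s_def in_segment by auto
    show "L p = k" unfolding L_def k_def p fst_conv snd_conv by (simp add: algebra_simps)
  next
    fix p assume pC: "p \<in> ?C \<inter> {x. L x = k}"
    obtain x y where pxy: "p = (x, y)" by (cases p)
    have xC: "(x, y) \<in> ?C" and k: "L (x, y) = k" using pC unfolding pxy by auto
    define u where "u = x / real N"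
    have "0 \<le> u" using f0[OF xC] by (simp add: u_def)
    have y: "y = (1 - u) * h 0 + u * h N" and x: "x = u * real N"
      using k N by (simp_all add: L_def k_def u_def field_simps)
    have "u * (h 0 - h N) \<le> 1 * (h 0 - h N)" using sN[OF xC] y by (simp add: algebra_simps)
    then have "u \<le> 1" using N(5) by (subst (asm) mult_le_cancel_right) auto
    then show "p \<in> s" unfolding pxy s_def in_segment
      using \<open>0 \<le> u\<close> x y by (intro exI[of _ u]) auto
  qed
  have "s face_of ?C"
  proof -
    have "?C \<inter> {x. inner (h 0 - h N, real N) x = k} face_of ?C"
      by (rule face_of_Int_supporting_hyperplane_ge[OF quadrant_hull_convex])
        (use L in \<open>simp add: L_def inner_prod_def\<close>)
    then show ?thesis unfolding sL L_def by (simp add: inner_prod_def)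
  qed
  moreover have "aff_dim s = 1"
    using N unfolding s_def segment_convex_hull aff_dim_convex_hull aff_dim_2 by simp
  moreover have "compact s" unfolding s_def by simp
  moreover have "\<exists>p\<in>s. \<exists>r\<in>s. fst p < fst r \<and> snd r < snd p"
    unfolding s_def using N by (intro bexI[of _ "(0, h 0)"] bexI[of _ "(real N, h N)"]) auto
  ultimately have sE: "s \<in> compact_negative_edges ?C"
    unfolding compact_negative_edges_def by blast
  have "e = s" if eE: "e \<in> compact_negative_edges ?C" for e
  proof -
    from eE obtain p r where e: "e face_of ?C" "aff_dim e = 1" "p \<in> e" "r \<in> e" "fst p < fst r" "snd r < snd p"
      unfolding compact_negative_edges_def by blast
    have above: "(snd r - snd p) * (fst x - fst p) \<le> (snd x - snd p) * (fst r - fst p)" if "x \<in> ?C" for x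
      by (rule above_negative_face[OF quadrant_hull_convex quadrant_hull_up e(1) edge_collinear[OF e(2)] e(3-6) that])
    have eC: "e \<subseteq> ?C" using face_of_imp_subset[OF e(1)] .
    then have prC: "p \<in> ?C" "r \<in> ?C" using e by auto
    define z where "z = (1/2) *\<^sub>R p + (1/2) *\<^sub>R r"
    have ze: "z \<in> e"
      unfolding z_def using face_of_imp_convex[OF e(1)] e by (intro convexD) auto
    then have zC: "z \<in> ?C" using eC by blast
    have fz: "fst z = (fst p + fst r) / 2" "snd z = (snd p + snd r) / 2" by (simp_all add: z_def)
    have no: "\<not> (fst x < fst z \<and> snd x < snd z)" if "x \<in> ?C" for x
    proof
      assume less: "fst x < fst z \<and> snd x < snd z"
      have "(snd r - snd p) * (fst z - fst p) = (snd z - snd p) * (fst r - fst p)"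
        by (simp add: fz field_simps)
      moreover have "(snd r - snd p) * (fst z - fst p) < (snd r - snd p) * (fst x - fst p)"
        using less e by (intro mult_strict_left_mono_neg) auto
      moreover have "(snd x - snd p) * (fst r - fst p) < (snd z - snd p) * (fst r - fst p)"
        using less e by (intro mult_strict_right_mono) auto
      ultimately show False using above[OF that] by linarith
    qed
    have z0: "0 < fst z" using f0[OF prC(1)] e(5) by (simp add: fz)
    have zN: "h N < snd z" using sN[OF prC(2)] e(6) by (simp add: fz)
    have Lz: "L z = k"
    proof (rule ccontr)
      assume "L z \<noteq> k"
      then have less: "k < L z" using L[OF zC] by simp
      show False
      proof (cases "real N < fst z")
        case True
        then show False using no[OF quadrant_hull_vertex[OF N(3), of h]] zN by simp
      next
        case False
        \<comment> \<open>Moving left by \<delta> uses at most half of the gap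
          \<open>L z - k\<close>, so the point of the segment at abscissa
          \<open>fst z - \<delta>\<close> is still strictly below \<open>z\<close>. The minimum
          keeps that abscissa nonnegative.\<close>
        define \<delta> where "\<delta> = min (fst z) ((L z - k) / (2 * (h 0 - h N)))"
        have \<delta>: "0 < \<delta>" "\<delta> \<le> fst z" using z0 less N by (auto simp: \<delta>_def)
        have "\<delta> \<le> (L z - k) / (2 * (h 0 - h N))" by (simp add: \<delta>_def)
        then have \<delta>': "\<delta> * (2 * (h 0 - h N)) \<le> L z - k" using N(5) by (simp add: pos_le_divide_eq)
        have pos: "0 < \<delta> * (h 0 - h N)" using \<delta> N(5) by simp
        define u where "u = (fst z - \<delta>) / real N"
        have u: "0 \<le> u" "u \<le> 1" using \<delta> False N by (auto simp: u_def field_simps)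
        define x where "x = (u * real N, (1 - u) * h 0 + u * h N)"
        have "x \<in> s" unfolding s_def in_segment x_def using u by (intro exI[of _ u]) auto
        then have xC: "x \<in> ?C" and Lx: "L x = k" using sL by auto
        have fx: "fst x = fst z - \<delta>" using N by (simp add: x_def u_def)
        have "real N * (snd z - snd x) = L z - k - (h 0 - h N) * \<delta>"
          using Lx fx by (simp add: L_def algebra_simps)
        also have "\<dots> > 0" using \<delta>' pos by (simp add: algebra_simps)
        finally have "snd x < snd z" using N by (simp add: zero_less_mult_iff)
        then show False using no[OF xC] fx \<delta> by simp
      qed
    qed
    have "fst p + fst r = 2 * fst z" "snd p + snd r = 2 * snd z" using fz by simp_all
    then have "(h 0 - h N) * (fst p + fst r) + real N * (snd p + snd r) = 2 * L z"
      unfolding L_def by (simp only:) (simp add: algebra_simps)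
    then have "L p + L r = 2 * L z" unfolding L_def by (simp add: algebra_simps)
    then have sum: "L p + L r = 2 * k" using Lz by simp
    have Lpr: "L p = k" using sum L[OF prC(1)] L[OF prC(2)] by simp
    have Lr: "L r = k" using sum Lpr by simp
    have "e \<subseteq> s"
    proof
      fix x assume xe: "x \<in> e"
      have "(snd x - snd p) * (fst r - fst p) = (snd r - snd p) * (fst x - fst p)"
        by (rule collinear_cross[OF edge_collinear[OF e(2)] e(3,4) xe])
      moreover have "(L x - L p) * (fst r - fst p) - (L r - L p) * (fst x - fst p) =
          real N * ((snd x - snd p) * (fst r - fst p) - (snd r - snd p) * (fst x - fst p))"
        unfolding L_def by (simp add: algebra_simps)
      ultimately have "(L x - L p) * (fst r - fst p) = (L r - L p) * (fst x - fst p)" by simp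
      then have "L x = k" using Lpr Lr e(5) by simp
      then show "x \<in> s" using sL eC xe by blast
    qed
    moreover have "s \<subseteq> e"
    proof -
      have "z \<in> s" using sL zC Lz by blast
      moreover have "z \<noteq> (0, h 0)" using z0 by auto
      moreover have "z \<noteq> (real N, h N)" using zN by auto
      ultimately have "z \<in> open_segment (0, h 0) (real N, h N)"
        unfolding s_def open_segment_def by blast
      then have "(0, h 0) \<in> e \<and> (real N, h N) \<in> e"
        using e(1) ze quadrant_hull_vertex[OF N(2), of h] quadrant_hull_vertex[OF N(3), of h]
        unfolding face_of_def by auto
      then show ?thesis unfolding s_def
        using face_of_imp_convex[OF e(1)] by (intro closed_segment_subset) auto
    qed
    ultimately show "e = s" by blast
  qed
  then have "compact_negative_edges ?C = {s}" using sE by blast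
  then show ?thesis unfolding lower_edges_def s_def by simp
qed

lemma straight_slope_segment:
  assumes "0 < N"
  shows "straight_slope N (closed_segment (0, a) (real N, b)) = (b - a) / real N"
  unfolding straight_slope_def
proof (rule the_equality)
  fix s assume "\<exists>a' b'. closed_segment (0, a) (real N, b) = closed_segment (0, a') (real N, b') \<and> s = (b' - a') / real N"
  then obtain a' b' where eq: "closed_segment (0, a) (real N, b) = closed_segment (0, a') (real N, b')"
    and s: "s = (b' - a') / real N" by blast
  from eq have "{(0, a), (real N, b)} = {(0, a'), (real N, b')}" by (simp only: closed_segment_eq)
  then have "a = a'" "b = b'" using assms by (auto simp: doubleton_eq_iff)
  then show "s = (b - a) / real N" using s by simp
qed blast

lemma slope_fraction_eq:
  assumes "0 < q" "coprime q m"
  shows "slope_fraction (- (real m / real q)) = (q, m)"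
  unfolding slope_fraction_def
proof (rule the_equality)
  show "case (q, m) of (q', m') \<Rightarrow> 0 < q' \<and> coprime q' m' \<and> - (real m / real q) = - (real m' / real q')"
    using assms by simp
  fix x assume x: "case x of (q', m') \<Rightarrow> 0 < q' \<and> coprime q' m' \<and> - (real m / real q) = - (real m' / real q')"
  obtain q' m' where xq: "x = (q', m')" by (cases x)
  with x have q': "0 < q'" "coprime q' m'" "real m / real q = real m' / real q'" by auto
  then have "real (m * q') = real (m' * q)" using assms by (simp add: field_simps)
  then have eq: "m * q' = m' * q" by (simp only: of_nat_eq_iff)
  then have "q dvd m * q'" "q' dvd m' * q" by (metis dvd_triv_right)+
  then have "q dvd q'" "q' dvd q"
    using assms q' by (simp_all add: coprime_dvd_mult_right_iff)
  then have "q = q'" by (rule dvd_antisym)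
  then show "x = (q, m)" using eq assms xq by simp
qed

lemma reduced_fraction:
  assumes "0 < n" "0 < N"
  obtains q m :: nat where "0 < q" "0 < m" "coprime q m" "q = N div gcd N n" "m * N = n * q" "q dvd N"
proof -
  let ?g = "gcd N n"
  have g: "0 < ?g" using assms by simp
  define q where "q = N div ?g"
  define m where "m = n div ?g"
  have N: "N = q * ?g" and n: "n = m * ?g" unfolding q_def m_def by simp_all
  have "coprime q m" unfolding q_def m_def using assms by (intro div_gcd_coprime) auto
  moreover have "0 < q" "0 < m" using N n assms by (metis gr0I mult_0)+
  moreover have "m * N = n * q" using N n by (metis mult.commute mult.left_commute)
  moreover have "q dvd N" using N by (metis dvd_triv_left)
  ultimately show ?thesis using that q_def by blast
qed

section \<open>Straight Newton polygons\<close>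

locale expansion = valuation v + monic_poly \<psi> for v :: "'a::field fps poly \<Rightarrow> enat" and \<psi> +
  fixes F :: "'a fps poly" and N :: nat
  assumes v_infinity: "v H = \<infinity> \<Longrightarrow> H = 0"
    and F: "lead_coeff F = 1" "degree F = N * degree \<psi>" "v F = enat N * v \<psi>" and N_pos: "0 < N"
begin

abbreviation "co i \<equiv> coeff (adic \<psi> F) i"
abbreviation "P \<equiv> newton_polygon v \<psi> F"
abbreviation "V \<equiv> the_enat (v \<psi>)"

lemma vpsi: "v \<psi> = enat V"
  using v_infinity[of \<psi>] nonzero by (cases "v \<psi>") auto

lemma degree_adic_F: "degree (adic \<psi> F) = N" and co_N: "co N = 1"
  using adic_monic[OF F(1,2)] by auto

lemma F_sum: "F = (\<Sum>i\<le>N. co i * \<psi> ^ i)"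
  using poly_adic[of F] unfolding poly_altdef degree_adic_F by simp

lemma v_co: "co i \<noteq> 0 \<Longrightarrow> v (co i) = enat (the_enat (v (co i)))"
  using v_infinity by (cases "v (co i)") auto

definition ht :: "nat \<Rightarrow> real" where "ht i = real (the_enat (v (co i * \<psi> ^ i)))"

lemma ht: "co i \<noteq> 0 \<Longrightarrow> ht i = real (the_enat (v (co i))) + real i * real V"
  unfolding ht_def mult power by (subst vpsi, subst v_co) auto

lemma ht_N: "ht N = real N * real V"
  using ht[of N] co_N by (simp add: zero_enat_def)

lemma v_F: "real (the_enat (v F)) = real N * real V"
  unfolding F(3) by (subst vpsi) simp

lemma polygon: "P = lower_edges (quadrant_hull {i. co i \<noteq> 0} ht)"
  unfolding newton_polygon_conv_lower_edges adic_expansion_conv_adic[OF monic deg_pos] ht_def ..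

lemma support: "finite {i. co i \<noteq> 0}" "i \<in> {i. co i \<noteq> 0} \<Longrightarrow> i \<le> N"
  using le_degree[of "adic \<psi> F"] unfolding degree_adic_F
  by (auto intro: finite_subset[of _ "{..N}"])

text \<open>Clearing denominators in the supporting line gives the integer relation
  \<open>q * A = N * (q * V + m)\<close> for the value \<open>A\<close> of the constant coefficient.
  As \<open>q * V + m\<close> is the augmented value of \<psi>, the last two facts compute the next
  value of \<open>F\<close>.\<close>

lemma straightD:
  assumes "(real N, real (the_enat (v F))) \<in> P" "straight N P"
  obtains q m where "0 < q" "0 < m" "coprime q m" "q dvd N"
    "slope_fraction (straight_slope N P) = (q, m)"
    "\<And>i. enat (N * (q * V + m)) \<le> enat q * v (co i) + enat (i * (q * V + m))"
    "enat q * v (co 0) = enat (N * (q * V + m))"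
proof -
  note D = straight_lower_edgesD[OF support(1) N_pos assms[unfolded polygon], unfolded v_F]
  have c0: "co 0 \<noteq> 0" using D(1) by simp
  define A where "A = the_enat (v (co 0))"
  have A: "ht 0 = real A" "v (co 0) = enat A" using ht[OF c0] v_co[OF c0] by (simp_all add: A_def)
  have less: "N * V < A" using D(3) A by (simp flip: of_nat_mult)
  define n where "n = A - N * V"
  obtain q m where qm: "0 < q" "0 < m" "coprime q m" "m * N = n * q" "q dvd N"
    using reduced_fraction[of n N] less N_pos n_def by (metis zero_less_diff)
  have "straight_slope N P = (real N * real V - real A) / real N"
    using D(2) straight_slope_segment[OF N_pos] unfolding polygon A by simp
  also have "\<dots> = - (real m / real q)"
  proof -
    have "real A - real N * real V = real n" using less by (simp add: n_def of_nat_diff)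
    moreover have "real m * real N = real n * real q" using qm(4) by (metis of_nat_mult)
    ultimately show ?thesis using qm(1) N_pos by (simp add: field_simps)
  qed
  finally have slope: "slope_fraction (straight_slope N P) = (q, m)"
    using slope_fraction_eq[OF qm(1,3)] by simp
  have qA: "q * A = N * (q * V + m)"
  proof -
    have "q * A = q * (N * V) + q * n" using less by (simp add: n_def flip: distrib_left)
    then show ?thesis using qm(4) by (simp add: algebra_simps)
  qed
  have main: "enat (N * (q * V + m)) \<le> enat q * v (co i) + enat (i * (q * V + m))" for i
  proof (cases "co i = 0")
    case True
    then show ?thesis using qm(1) by (simp add: imult_is_infinity zero_enat_def)
  next
    case False
    define a where "a = the_enat (v (co i))"
    have a: "ht i = real a + real i * real V" "v (co i) = enat a"
      using ht[OF False] v_co[OF False] by (simp_all add: a_def)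
    have iN: "i \<le> N" using support(2) False by auto
    have "real N * real A + (real N * real V - real A) * real i \<le> real N * (real a + real i * real V)"
      using D(4)[of i] False unfolding A a by simp
    then have "real q * (real N * real A + (real N * real V - real A) * real i) \<le>
        real q * (real N * (real a + real i * real V))"
      by (rule mult_left_mono) simp
    moreover have "real q * real A = real N * (real q * real V + real m)"
      using qA by (metis of_nat_mult of_nat_add)
    moreover have "real q * (real N * real A + (real N * real V - real A) * real i) =
        real N * (real q * real A) + real q * real N * real V * real i - (real q * real A) * real i"
      by (simp add: algebra_simps)
    ultimately have "real N * (real N * (real q * real V + real m)) \<le>
      real N * (real q * real a + real i * (real q * real V + real m))"
      by (simp add: algebra_simps)
    then have "real N * (real q * real V + real m) \<le> real q * real a + real i * (real q * real V + real m)"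
      using N_pos by simp
    then have "N * (q * V + m) \<le> q * a + i * (q * V + m)"
      by (simp only: of_nat_le_iff flip: of_nat_mult of_nat_add)
    then show ?thesis unfolding a by simp
  qed
  show ?thesis by (rule that[OF qm(1-3,5) slope main]) (simp add: A qA)
qed

text \<open>The slope is -(\<rho> - N V)/N. Removing a multiple of \<open>N\<close> does not change
  the gcd with \<open>N\<close>, so the reduced denominator depends on \<rho> alone.\<close>

lemma straightI:
  assumes c0: "v (co 0) = enat \<rho>" and less: "N * V < \<rho>"
    and line: "\<And>i. enat (N * \<rho>) \<le> enat N * v (co i) + enat (i * \<rho>)"
  shows "(real N, real (the_enat (v F))) \<in> P" "straight N P"
    "\<exists>m. slope_fraction (straight_slope N P) = (N div gcd N \<rho>, m)"
proof -
  have nz: "co 0 \<noteq> 0" using c0 by auto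
  have h0: "ht 0 = real \<rho>" using ht[OF nz] c0 by simp
  have P: "P = closed_segment (0, ht 0) (real N, ht N)"
    unfolding polygon
  proof (rule straight_lower_edgesI[OF N_pos])
    show "0 \<in> {i. co i \<noteq> 0}" "N \<in> {i. co i \<noteq> 0}" using nz co_N by auto
    show "i \<le> N" if "i \<in> {i. co i \<noteq> 0}" for i using support(2) that by blast
    show "ht N < ht 0" unfolding ht_N h0 using less by (simp flip: of_nat_mult)
    fix i assume "i \<in> {i. co i \<noteq> 0}"
    then have i: "co i \<noteq> 0" by simp
    define a where "a = the_enat (v (co i))"
    have a: "ht i = real a + real i * real V" "v (co i) = enat a"
      using ht[OF i] v_co[OF i] by (simp_all add: a_def)
    have "N * \<rho> \<le> N * a + i * \<rho>" using line[of i] unfolding a by simp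
    then have "real N * real \<rho> \<le> real N * real a + real i * real \<rho>"
      by (simp only: of_nat_le_iff flip: of_nat_mult of_nat_add)
    then show "real N * ht 0 + (ht N - ht 0) * real i \<le> real N * ht i"
      unfolding h0 ht_N a by (simp add: algebra_simps)
  qed
  show "(real N, real (the_enat (v F))) \<in> P" unfolding P v_F ht_N by simp
  show "straight N P" unfolding straight_def P by auto
  define n where "n = \<rho> - N * V"
  have n: "0 < n" using less by (simp add: n_def)
  obtain q m where qm: "0 < q" "0 < m" "coprime q m" "q = N div gcd N n" "m * N = n * q" "q dvd N"
    using reduced_fraction[OF n N_pos] by metis
  have "gcd N n = gcd N \<rho>"
  proof -
    have "\<rho> = V * N + n" using less by (simp add: n_def mult.commute)
    then show ?thesis by (simp only: gcd_add_mult)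
  qed
  have "straight_slope N P = (real N * real V - real \<rho>) / real N"
    unfolding P straight_slope_segment[OF N_pos] h0 ht_N ..
  also have "\<dots> = - (real m / real q)"
  proof -
    have "real \<rho> - real N * real V = real n" using less by (simp add: n_def of_nat_diff)
    moreover have "real m * real N = real n * real q" using qm(5) by (metis of_nat_mult)
    ultimately show ?thesis using qm(1) N_pos by (simp add: field_simps)
  qed
  finally have "slope_fraction (straight_slope N P) = (q, m)"
    using slope_fraction_eq[OF qm(1,3)] by simp
  then show "\<exists>m. slope_fraction (straight_slope N P) = (N div gcd N \<rho>, m)"
    using qm(4) \<open>gcd N n = gcd N \<rho>\<close> by auto
qed

end

section \<open>The invariant of the loop\<close>

text \<open>The multiples of \<beta> with factor below \<open>q\<close> are distinct modulo
  \<open>q\<close>. Hence terms of an adic expansion with fewer than \<open>q\<close> coefficients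
  never tie in value.\<close>

lemma linear_combination_unique:
  fixes q x y i j \<beta> :: nat
  assumes "coprime q \<beta>" "q * x + i * \<beta> = q * y + j * \<beta>" "i < q" "j < q"
  shows "i = j"
proof -
  have "int q * int x + int i * int \<beta> = int q * int y + int j * int \<beta>"
    using assms(2) by (metis of_nat_add of_nat_mult)
  then have "(int i - int j) * int \<beta> = int q * (int y - int x)" by (simp add: algebra_simps)
  then have "int q dvd (int i - int j) * int \<beta>" by simp
  then have "int q dvd int i - int j"
    using assms(1) by (simp add: coprime_dvd_mult_left_iff)
  then have "int i - int j = 0"
    using dvd_imp_le_int[of "int i - int j" "int q"] assms(3,4) by linarith
  then show ?thesis by simp
qed

text \<open>
  The state of the loop: \<open>e\<close> is the degree of the current approximate root, and \<open>\<nu>\<close> is the valuation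
  along a branch of \<open>F\<close>, normalized so that \<open>\<nu> x = c * e\<close> stays constant during the loop. Each round divides
  \<open>c\<close> by \<open>q\<close>, so at the end the degree \<open>e\<close> of \<open>F\<close> divides \<open>\<nu> x\<close>, which is the degree of the branch.
\<close>
locale stage = v: valuation v + \<nu>: valuation \<nu> for v \<nu> :: "'a::field fps poly \<Rightarrow> enat" +
  fixes F :: "'a fps poly" and N e c :: nat
  assumes F: "lead_coeff F = 1" "degree F = N * e" "\<nu> F = \<infinity>"
    and pos: "0 < N" "0 < e" "0 < c" and N_nz: "(of_nat N :: 'a) \<noteq> 0"
    and v_infinity: "v H = \<infinity> \<Longrightarrow> H = 0"
    and \<nu>_ge: "enat c * v H \<le> \<nu> H"
    and \<nu>_eq: "degree a < e \<Longrightarrow> \<nu> a = enat c * v a"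
    and base: "\<exists>P. lead_coeff P = 1 \<and> degree P = e \<and> division_stable v P \<and> v F = enat N * v P"
begin

definition \<psi> :: "'a fps poly" where "\<psi> = approx_root N F"

lemma psi:
  assumes "2 \<le> N"
  shows "is_approx_root N F \<psi>" "lead_coeff \<psi> = 1" "degree \<psi> = e" "division_stable v \<psi>"
    "v F = enat N * v \<psi>" "coeff (adic \<psi> F) (N - 1) = 0"
proof -
  obtain P where P: "lead_coeff P = 1" "degree P = e" "division_stable v P" "v F = enat N * v P"
    using base by blast
  have "P \<noteq> 0" using P(1) by auto
  then have "v P \<noteq> \<infinity>" using v_infinity by blast
  from approx_root_valuation[of F N P, OF F(1) _ N_nz assms P(1) _ v.valuation_axioms P(3) this]
  show "is_approx_root N F \<psi>" "lead_coeff \<psi> = 1" "degree \<psi> = e" "division_stable v \<psi>"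
    "v F = enat N * v \<psi>" "coeff (adic \<psi> F) (N - 1) = 0"
    using P F pos unfolding \<psi>_def by auto
qed

lemma expansion: "2 \<le> N \<Longrightarrow> expansion v \<psi> F N"
  by unfold_locales (use psi F pos v_infinity in auto)

text \<open>As \<open>\<nu> F\<close> is infinite, no term of the expansion of \<open>F\<close> may
  be alone in having least value. If \<open>q * \<nu> \<psi>\<close> exceeded
  \<open>c * \<beta>\<close>, the constant term would be alone; if it were smaller,
  \<open>\<psi> ^ N\<close> would be.\<close>

lemma nu_psi:
  assumes N: "2 \<le> N" and q: "0 < q"
    and line: "\<And>i. enat (N * \<beta>) \<le> enat q * v (coeff (adic \<psi> F) i) + enat (i * \<beta>)"
    and zero: "enat q * v (coeff (adic \<psi> F) 0) = enat (N * \<beta>)"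
  obtains \<rho> where "\<nu> \<psi> = enat \<rho>" "q * \<rho> = c * \<beta>"
proof -
  interpret ex: expansion v \<psi> F N by (rule expansion[OF N])
  have nu_co: "\<nu> (ex.co i) = enat c * v (ex.co i)" for i
    using ex.degree_coeff_adic psi(3)[OF N] by (intro \<nu>_eq) simp
  obtain A where A: "v (ex.co 0) = enat A" "q * A = N * \<beta>"
    using zero q by (cases "v (ex.co 0)") (auto simp: imult_is_infinity zero_enat_def split: if_splits)
  have F0: "F = ex.co 0 + (\<Sum>i\<in>{1..N}. ex.co i * \<psi> ^ i)"
  proof -
    have "{..N} = insert 0 {1..N}" by auto
    then show ?thesis by (subst ex.F_sum) simp
  qed
  have FN: "F = \<psi> ^ N + (\<Sum>i<N. ex.co i * \<psi> ^ i)"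
  proof -
    have "{..N} = insert N {..<N}" by auto
    then show ?thesis by (subst ex.F_sum) (simp add: ex.co_N)
  qed
  \<comment> \<open>A competitor of the constant term; it also shows that
    \<open>\<nu> \<psi>\<close> is finite.\<close>
  have no0: "\<exists>i\<in>{1..N}. \<nu> (ex.co i * \<psi> ^ i) \<le> enat (c * A)"
  proof (rule ccontr)
    assume "\<not> ?thesis"
    then have "enat (c * A) < \<nu> (\<Sum>i\<in>{1..N}. ex.co i * \<psi> ^ i)"
      by (intro \<nu>.sum_greater) (auto simp: not_le)
    then have "\<nu> F = \<nu> (ex.co 0)"
      by (subst F0, intro \<nu>.add_eq) (simp add: nu_co A)
    then show False using F nu_co[of 0] A by simp
  qed
  then obtain i0 where i0: "1 \<le> i0" "i0 \<le> N" "\<nu> (ex.co i0 * \<psi> ^ i0) \<le> enat (c * A)" by auto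
  have "\<nu> \<psi> \<noteq> \<infinity>"
  proof
    assume "\<nu> \<psi> = \<infinity>"
    then have "\<nu> (ex.co i0 * \<psi> ^ i0) = \<infinity>"
      using i0(1) by (simp add: \<nu>.mult \<nu>.power imult_is_infinity zero_enat_def)
    then show False using i0(3) by simp
  qed
  then obtain \<rho> where \<rho>: "\<nu> \<psi> = enat \<rho>" by auto
  have ge: "c * \<beta> \<ge> q * \<rho>"
  proof (rule ccontr)
    assume less: "\<not> ?thesis"
    have "v (ex.co i0) \<noteq> \<infinity>"
    proof
      assume "v (ex.co i0) = \<infinity>"
      then have "\<nu> (ex.co i0 * \<psi> ^ i0) = \<infinity>"
        using pos by (simp add: \<nu>.mult nu_co imult_is_infinity zero_enat_def)
      then show False using i0(3) by simp
    qed
    then obtain a where a: "v (ex.co i0) = enat a" by auto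
    have "c * a + i0 * \<rho> \<le> c * A" using i0(3) by (simp add: \<nu>.mult \<nu>.power nu_co a \<rho>)
    then have "q * (c * a + i0 * \<rho>) \<le> q * (c * A)" by (rule mult_left_mono) simp
    moreover have "c * (N * \<beta>) \<le> c * (q * a + i0 * \<beta>)"
      using line[of i0] by (intro mult_left_mono) (simp_all add: a)
    moreover have "i0 * (c * \<beta>) < i0 * (q * \<rho>)" using less i0 by simp
    moreover have "q * (c * A) = c * (N * \<beta>)" using A(2) by (metis mult.left_commute)
    moreover have "q * (c * a + i0 * \<rho>) = c * (q * a) + i0 * (q * \<rho>)"
      "c * (q * a + i0 * \<beta>) = c * (q * a) + i0 * (c * \<beta>)"
      by (simp_all add: algebra_simps)
    ultimately show False by linarith
  qed
  have le: "c * \<beta> \<le> q * \<rho>"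
  proof (rule ccontr)
    assume less: "\<not> ?thesis"
    have "enat (N * \<rho>) < \<nu> (ex.co i * \<psi> ^ i)" if i: "i < N" for i
    proof (cases "v (ex.co i)")
      case (enat a)
      have "c * (N * \<beta>) \<le> c * (q * a + i * \<beta>)"
        using line[of i] by (intro mult_left_mono) (simp_all add: enat)
      moreover have "(N - i) * (q * \<rho>) < (N - i) * (c * \<beta>)" using less i by simp
      moreover have "N * x = (N - i) * x + i * x" for x :: nat
        using i by (simp flip: distrib_right)
      from this[of "c * \<beta>"] this[of "q * \<rho>"]
      have "N * (c * \<beta>) = (N - i) * (c * \<beta>) + i * (c * \<beta>)" "N * (q * \<rho>) = (N - i) * (q * \<rho>) + i * (q * \<rho>)" .
      moreover have "q * (c * a + i * \<rho>) = c * (q * a) + i * (q * \<rho>)"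
        "c * (q * a + i * \<beta>) = c * (q * a) + i * (c * \<beta>)"
        "c * (N * \<beta>) = N * (c * \<beta>)" "q * (N * \<rho>) = N * (q * \<rho>)"
        by (simp_all add: algebra_simps)
      ultimately have "q * (N * \<rho>) < q * (c * a + i * \<rho>)" by linarith
      then have "N * \<rho> < c * a + i * \<rho>" by simp
      then show ?thesis by (simp add: \<nu>.mult \<nu>.power nu_co enat \<rho>)
    next
      case infinity
      then show ?thesis using pos by (simp add: \<nu>.mult nu_co imult_is_infinity zero_enat_def)
    qed
    then have "enat (N * \<rho>) < \<nu> (\<Sum>i<N. ex.co i * \<psi> ^ i)"
      by (intro \<nu>.sum_greater) auto
    then have "\<nu> F = \<nu> (\<psi> ^ N)"
      by (subst FN, intro \<nu>.add_eq) (simp add: \<nu>.power \<rho>)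
    then show False using F by (simp add: \<nu>.power \<rho>)
  qed
  show ?thesis by (rule that[OF \<rho>]) (use ge le in simp)
qed

text \<open>As \<open>q\<close> is coprime to \<beta>, the equation
  \<open>q * \<rho> = c * \<beta>\<close> yields \<open>q dvd c\<close>. For the same reason the
  terms of an expansion of degree below \<open>e * q\<close> have distinct values, so \<nu> of the
  sum is that of the least term and agreement extends to this range. The new base polynomial is
  \<open>\<psi> ^ q\<close>.\<close>

lemma step:
  assumes N: "2 \<le> N" and qm: "0 < q" "0 < m" "coprime q m" "q dvd N"
    and line: "\<And>i. enat (N * (q * the_enat (v \<psi>) + m)) \<le>
        enat q * v (coeff (adic \<psi> F) i) + enat (i * (q * the_enat (v \<psi>) + m))"
    and zero: "enat q * v (coeff (adic \<psi> F) 0) = enat (N * (q * the_enat (v \<psi>) + m))"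
  shows "q dvd c" "stage (next_valuation q m \<psi> v) \<nu> F (N div q) (e * q) (c div q)"
proof -
  interpret ex: expansion v \<psi> F N by (rule expansion[OF N])
  define \<beta> where "\<beta> = q * ex.V + m"
  obtain \<rho> where \<rho>: "\<nu> \<psi> = enat \<rho>" "q * \<rho> = c * \<beta>"
    using nu_psi[OF N qm(1) line zero] unfolding \<beta>_def by blast
  have "\<beta> = ex.V * q + m" by (simp add: \<beta>_def mult.commute)
  then have coprime: "coprime q \<beta>"
    using qm(3) by (simp only: coprime_iff_gcd_eq_1 gcd_add_mult)
  have "q dvd c * \<beta>" using \<rho>(2) by (metis dvd_triv_left)
  then show qc: "q dvd c" using coprime by (simp add: coprime_dvd_mult_left_iff)
  define c' where "c' = c div q"
  have c: "c = q * c'" using qc by (simp add: c'_def)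
  have c'0: "0 < c'" using c pos by (cases c') auto
  have \<rho>': "\<rho> = c' * \<beta>" using \<rho>(2) qm(1) unfolding c by simp
  have deg: "degree \<psi> = e" using psi[OF N] by simp
  have "enat c * v \<psi> < \<nu> \<psi>"
    unfolding \<rho>(1) \<rho>' c by (subst ex.vpsi) (use qm c'0 in \<open>simp add: \<beta>_def algebra_simps\<close>)
  then interpret au: augmentation v \<nu> \<psi> c q m
    by unfold_locales (use psi[OF N] \<nu>_ge \<nu>_eq v_infinity pos qm deg in auto)
  have w: "au.weight = \<beta>" by (simp add: au.weight_def \<beta>_def)
  have aug: "next_valuation q m \<psi> v = au.aug" by (rule next_valuation_conv_aug) (rule au.augmentation_axioms)
  have nu_term: "\<nu> (coeff (adic \<psi> H) i * \<psi> ^ i) = enat c' * (enat q * v (coeff (adic \<psi> H) i) + enat (i * \<beta>))" for H i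
  proof -
    have "\<nu> (coeff (adic \<psi> H) i) = enat c * v (coeff (adic \<psi> H) i)"
      using ex.degree_coeff_adic by (intro au.\<nu>_eq)
    then show ?thesis unfolding \<nu>.mult \<nu>.power \<rho>(1) \<rho>' c using c'0 qm
      by (cases "v (coeff (adic \<psi> H) i)") (auto simp: algebra_simps imult_is_infinity zero_enat_def)
  qed
  have aug_le: "au.aug H \<le> enat q * v (coeff (adic \<psi> H) i) + enat (i * \<beta>)" for H i
    unfolding au.aug_def w by (rule gauss_le)
  have H_sum: "H = (\<Sum>i\<le>degree (adic \<psi> H). coeff (adic \<psi> H) i * \<psi> ^ i)" for H
    using ex.poly_adic[of H] unfolding poly_altdef by simp
  have ge: "enat c' * au.aug H \<le> \<nu> H" for H
    by (subst (2) H_sum) (intro \<nu>.sum_ge, simp only: nu_term, intro mult_left_mono aug_le, simp)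
  have eq: "\<nu> a = enat c' * au.aug a" if a: "degree a < e * q" for a
  proof (cases "a = 0")
    case True
    then show ?thesis using c'0 by (simp add: au.aug_0 imult_is_infinity zero_enat_def)
  next
    case False
    define A where "A = adic \<psi> a"
    obtain i where i: "au.aug a = enat q * v (coeff A i) + enat (i * \<beta>)"
      unfolding au.aug_def w A_def using gauss_attained[of "\<lambda>a. enat q * v a"] by blast
    have fin: "au.aug a \<noteq> \<infinity>" using False au.aug_infinity by blast
    then obtain x where x: "v (coeff A i) = enat x"
      using i qm by (cases "v (coeff A i)") (auto simp: imult_is_infinity zero_enat_def)
    have small: "j < q" if "coeff A j \<noteq> 0" for j
    proof (rule ccontr)
      assume "\<not> j < q"
      then have "e * q \<le> j * degree \<psi>" by (simp add: deg mult.commute)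
      then show False using that a ex.coeff_adic_eq_0[of a j] unfolding A_def by simp
    qed
    have Ai: "coeff A i \<noteq> 0"
    proof
      assume "coeff A i = 0"
      then have "v (coeff A i) = \<infinity>" by simp
      then show False using x by simp
    qed
    then have iq: "i < q" by (rule small)
    have less: "au.aug a < enat q * v (coeff A j) + enat (j * \<beta>)" if j: "j \<noteq> i" for j
    proof (cases "coeff A j = 0")
      case True
      then show ?thesis using fin qm by (simp add: imult_is_infinity zero_enat_def)
    next
      case nz: False
      then obtain y where y: "v (coeff A j) = enat y" using v_infinity by (cases "v (coeff A j)") auto
      have jq: "j < q" using small nz by blast
      have "q * x + i * \<beta> \<noteq> q * y + j * \<beta>"
        using linear_combination_unique[OF coprime _ iq jq] j by blast
      then show ?thesis using aug_le[of a j] i unfolding A_def[symmetric] x y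
        by (simp add: order.strict_iff_order)
    qed
    let ?t = "\<lambda>j. coeff A j * \<psi> ^ j"
    have split: "a = ?t i + (\<Sum>j\<in>{..degree A} - {i}. ?t j)"
    proof -
      have "i \<le> degree A" using Ai by (intro le_degree)
      then show ?thesis
        by (subst H_sum) (simp add: A_def[symmetric] sum.remove[of _ i])
    qed
    have ti: "\<nu> (?t i) = enat c' * au.aug a" unfolding A_def nu_term i[unfolded A_def] ..
    have "\<nu> (?t i) < \<nu> (\<Sum>j\<in>{..degree A} - {i}. ?t j)"
    proof (rule \<nu>.sum_greater)
      show "\<nu> (?t i) < \<infinity>" unfolding ti using fin by (cases "au.aug a") auto
      fix j assume "j \<in> {..degree A} - {i}"
      then show "\<nu> (?t i) < \<nu> (?t j)"
        unfolding ti using less[of j] unfolding A_def nu_term using c'0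
        by (simp only: enat_mult_less_cancel) simp
    qed
    then have "\<nu> (?t i + (\<Sum>j\<in>{..degree A} - {i}. ?t j)) = \<nu> (?t i)" by (rule \<nu>.add_eq)
    then show ?thesis using split ti by metis
  qed
  obtain N' where N': "N = q * N'" using qm(4) by blast
  have N'eq: "N div q = N'" using N' qm(1) by simp
  \<comment> \<open>In the expansion of \<open>s * \<psi> ^ q + r\<close> the indices below
    \<open>q\<close> come from \<open>r\<close> alone and the others from
    \<open>s * \<psi> ^ q\<close> alone.\<close>
  have stable: "division_stable au.aug (\<psi> ^ q)"
    unfolding division_stable_def
  proof (intro allI impI)
    fix s r :: "'a fps poly" assume r: "degree r < degree (\<psi> ^ q)"
    have "degree (\<psi> ^ q) = q * degree \<psi>" by (rule degree_monic_power(1)[OF ex.monic])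
    then have r0: "coeff (adic \<psi> r) i = 0" if "q \<le> i" for i
      using r that by (intro ex.coeff_adic_eq_0) (metis mult_le_mono1 order_less_le_trans)
    have sq: "adic \<psi> (s * \<psi> ^ q) = monom 1 q * adic \<psi> s"
      using ex.adic_reduced[of s] ex.deg_pos
      by (intro ex.adicI) (auto simp: reduced_def coeff_monom_mult poly_monom ex.poly_adic mult.commute)
    show "au.aug (s * \<psi> ^ q + r) \<le> au.aug (s * \<psi> ^ q)"
      unfolding au.aug_def[of "s * \<psi> ^ q"]
    proof (rule gauss_geI)
      fix i
      show "au.aug (s * \<psi> ^ q + r) \<le> enat q * v (coeff (adic \<psi> (s * \<psi> ^ q)) i) + enat (i * au.weight)"
      proof (cases "i < q")
        case True
        then show ?thesis using qm unfolding sq by (simp add: coeff_monom_mult imult_is_infinity zero_enat_def)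
      next
        case False
        then have "coeff (adic \<psi> (s * \<psi> ^ q + r)) i = coeff (adic \<psi> (s * \<psi> ^ q)) i"
          by (simp add: ex.adic_add r0)
        then show ?thesis using aug_le[of "s * \<psi> ^ q + r" i] by (simp add: w)
      qed
    qed
  qed
  have "au.aug F = enat (N * \<beta>)"
    unfolding au.aug_def w
  proof (rule antisym)
    have "gauss (\<lambda>a. enat q * v a) \<beta> (adic \<psi> F) \<le> enat q * v (ex.co N) + enat (N * \<beta>)" by (rule gauss_le)
    then show "gauss (\<lambda>a. enat q * v a) \<beta> (adic \<psi> F) \<le> enat (N * \<beta>)" by (simp add: ex.co_N)
    show "enat (N * \<beta>) \<le> gauss (\<lambda>a. enat q * v a) \<beta> (adic \<psi> F)"
      using line unfolding \<beta>_def by (rule gauss_geI)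
  qed
  also have "\<dots> = enat N' * (enat q * enat \<beta>)"
    by (simp add: N' mult_ac)
  also have "\<dots> = enat N' * au.aug (\<psi> ^ q)"
    unfolding valuation.power[OF au.valuation_aug] au.aug_\<psi> w ..
  finally have aF: "au.aug F = enat N' * au.aug (\<psi> ^ q)" .
  have "N' \<noteq> 0" using N' pos by auto
  have nz: "(of_nat N' :: 'a) \<noteq> 0" using N_nz unfolding N' by simp
  show "stage (next_valuation q m \<psi> v) \<nu> F (N div q) (e * q) (c div q)"
    unfolding aug N'eq c'_def[symmetric]
  proof (intro stage.intro stage_axioms.intro au.valuation_aug \<nu>.valuation_axioms)
    show "lead_coeff F = 1" "\<nu> F = \<infinity>" "0 < c'" "(of_nat N' :: 'a) \<noteq> 0"
      using F c'0 nz by auto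
    show "degree F = N' * (e * q)" "0 < N'" "0 < e * q" using F N' \<open>N' \<noteq> 0\<close> pos qm by auto
    show "au.aug H = \<infinity> \<Longrightarrow> H = 0" for H by (rule au.aug_infinity)
    show "enat c' * au.aug H \<le> \<nu> H" for H by (rule ge)
    show "\<nu> a = enat c' * au.aug a" if "degree a < e * q" for a by (rule eq[OF that])
    show "\<exists>P. lead_coeff P = 1 \<and> degree P = e * q \<and> division_stable au.aug P \<and> au.aug F = enat N' * au.aug P"
      using degree_monic_power[OF ex.monic, of q] stable aF deg by (intro exI[of _ "\<psi> ^ q"]) (auto simp: mult.commute)
  qed
qed

end

section \<open>Initial forms along a generic perturbation of the parametrization\<close>

lemma fps_mult_nth_low:
  fixes f g :: "'b::comm_ring_1 fps"
  assumes "\<And>i. i < k \<Longrightarrow> fps_nth f i = 0" "\<And>i. i < l \<Longrightarrow> fps_nth g i = 0"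
  shows "fps_nth (f * g) (k + l) = fps_nth f k * fps_nth g l"
    and "n < k + l \<Longrightarrow> fps_nth (f * g) n = 0"
proof -
  have "fps_nth f i * fps_nth g (k + l - i) = 0" if "i \<le> k + l" "i \<noteq> k" for i
    using that assms(1)[of i] assms(2)[of "k + l - i"] by (cases "i < k") auto
  then have "(\<Sum>i=0..k + l. fps_nth f i * fps_nth g (k + l - i)) = (\<Sum>i\<in>{k}. fps_nth f i * fps_nth g (k + l - i))"
    by (intro sum.mono_neutral_right) auto
  then show "fps_nth (f * g) (k + l) = fps_nth f k * fps_nth g l"
    by (simp add: fps_mult_nth)
  assume n: "n < k + l"
  have "fps_nth f i * fps_nth g (n - i) = 0" if "i \<le> n" for i
    using that n assms(1)[of i] assms(2)[of "n - i"] by (cases "i < k") auto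
  then show "fps_nth (f * g) n = 0" by (simp add: fps_mult_nth)
qed

text \<open>The value \<open>l = 0\<close> is allowed, so sums can be treated termwise before it is
  known whether the initial forms cancel.\<close>

definition starts :: "'b::comm_ring_1 fps \<Rightarrow> nat \<Rightarrow> 'b \<Rightarrow> bool" where
  "starts f n l \<longleftrightarrow> (\<forall>i<n. fps_nth f i = 0) \<and> fps_nth f n = l"

lemma starts_mult: "starts f n l \<Longrightarrow> starts g k r \<Longrightarrow> starts (f * g) (n + k) (l * r)"
  unfolding starts_def using fps_mult_nth_low[of n f k g] by auto

lemma starts_prod:
  "finite A \<Longrightarrow> (\<And>x. x \<in> A \<Longrightarrow> starts (f x) (n x) (l x)) \<Longrightarrow> starts (prod f A) (sum n A) (prod l A)"
proof (induction A rule: finite_induct)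
  case empty
  then show ?case by (simp add: starts_def)
next
  case (insert x A)
  then show ?case by (auto intro: starts_mult)
qed

lemma starts_power: "starts f n l \<Longrightarrow> starts (f ^ k) (k * n) (l ^ k)"
proof (induction k)
  case (Suc k)
  then show ?case using starts_mult[of f n l "f ^ k" "k * n" "l ^ k"] by (simp add: add.commute)
qed (simp add: starts_def)

lemma starts_add: "starts f n l \<Longrightarrow> starts g n r \<Longrightarrow> starts (f + g) n (l + r)"
  unfolding starts_def by auto

lemma starts_sum: "(\<And>x. x \<in> A \<Longrightarrow> starts (f x) n (l x)) \<Longrightarrow> starts (sum f A) n (sum l A)"
  unfolding starts_def by (simp add: fps_sum_nth)

lemma starts_ord: "starts f n l \<Longrightarrow> l \<noteq> 0 \<Longrightarrow> ord f = enat n"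
  unfolding starts_def ord_eq_iff by auto

lemma ord_starts: "enat n \<le> ord f \<Longrightarrow> starts f n (fps_nth f n)"
  unfolding starts_def ord_ge_iff by auto

lemma coeff_prod_linear:
  fixes f :: "'b \<Rightarrow> 'c::idom"
  assumes "finite A" "A \<noteq> {}"
  shows "coeff (\<Prod>w\<in>A. [:- f w, 1:]) (card A - 1) = - (\<Sum>w\<in>A. f w)"
  using assms
proof (induction A rule: finite_ne_induct)
  case (insert x A)
  have d: "degree (\<Prod>w\<in>A. [:- f w, 1:]) = card A"
    using insert by (subst degree_prod_eq_sum_degree) auto
  have "lead_coeff (\<Prod>w\<in>A. [:- f w, 1:]) = 1" unfolding lead_coeff_prod by simp
  then have l: "coeff (\<Prod>w\<in>A. [:- f w, 1:]) (card A) = 1" using d by simp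
  have "0 < card A" using insert by (simp add: card_gt_0_iff)
  then obtain k where k: "card A = Suc k" by (cases "card A") auto
  then show ?case using insert l by (simp add: algebra_simps)
qed simp

text \<open>
  The type \<^typ>\<open>'a poly fps\<close> stands for \<open>L[u][[t]]\<close>: \<open>generic d S c H\<close> is
  \<open>H (t\<^sup>d, S + u t\<^sup>c)\<close> with an indeterminate \<open>u\<close>, and its lowest coefficient in \<open>t\<close>
  is the initial form of \<open>H\<close>, a polynomial in \<open>u\<close>.
\<close>
definition embed :: "'a::idom fps \<Rightarrow> 'a poly fps" where
  "embed f = Abs_fps (\<lambda>n. [:fps_nth f n:])"

definition perturb :: "nat \<Rightarrow> 'a::idom poly fps" where
  "perturb c = fps_const [:0, 1:] * fps_X ^ c"

text \<open>The expansion of H(t^d, S + y) in powers of \<open>y\<close>. It is independent of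
  \<open>c\<close>, so smallness can be stated before the next characteristic exponent is known;
  \<open>coeff_generic_nth\<close> translates.\<close>

definition taylor :: "nat \<Rightarrow> 'a::field fps \<Rightarrow> 'a fps poly \<Rightarrow> 'a fps poly" where
  "taylor d S H = pcompose (map_poly (pw d) H) [:S, 1:]"

definition generic :: "nat \<Rightarrow> 'a::field fps \<Rightarrow> nat \<Rightarrow> 'a fps poly \<Rightarrow> 'a poly fps" where
  "generic d S c H = poly (map_poly embed (map_poly (pw d) H)) (embed S + perturb c)"

lemma const_poly_morphism: "comm_ring_morphism (\<lambda>x :: 'r::comm_ring_1. [:x:])"
  by unfold_locales (auto simp: one_pCons)

lemma embed_nth [simp]: "fps_nth (embed f) n = [:fps_nth f n:]"
  by (simp add: embed_def)

lemma embed_morphism: "comm_ring_morphism embed"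
proof
  show "embed (a * b) = embed a * embed b" for a b :: "'a fps"
  proof (rule fps_ext)
    fix n
    show "fps_nth (embed (a * b)) n = fps_nth (embed a * embed b) n"
      by (simp add: fps_mult_nth comm_ring_morphism.sum[OF const_poly_morphism] mult.commute)
  qed
qed (auto intro!: fps_ext simp: one_pCons)

lemma perturb_power: "perturb c ^ j = fps_const (monom 1 j) * fps_X ^ (c * j)"
  unfolding perturb_def power_mult_distrib by (simp add: monom_altdef power_mult)

lemma perturb_nth: "fps_nth (perturb c) n = (if n = c then [:0, 1:] else 0)"
  unfolding perturb_def by simp

lemma generic_morphism: "0 < d \<Longrightarrow> comm_ring_morphism (generic d S c)"
  unfolding generic_def
  by (intro comm_ring_morphism_comp[OF poly_eval_morphism]
      comm_ring_morphism_comp[OF comm_ring_morphism.map_poly_morphism[OF embed_morphism]]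
      comm_ring_morphism.map_poly_morphism pw_morphism)

lemma generic_conv_taylor: "generic d S c H = poly (map_poly embed (taylor d S H)) (perturb c)"
proof -
  interpret embed: comm_ring_morphism "embed :: 'a fps \<Rightarrow> _" by (rule embed_morphism)
  show ?thesis
    unfolding generic_def taylor_def embed.map_poly_pcompose by (simp add: poly_pcompose)
qed

lemma coeff_generic_nth:
  "coeff (fps_nth (generic d S c H) n) i =
     (if c * i \<le> n then fps_nth (coeff (taylor d S H) i) (n - c * i) else 0)"
proof -
  interpret embed: comm_ring_morphism "embed :: 'a fps \<Rightarrow> _" by (rule embed_morphism)
  define G where "G = taylor d S H"
  define D where "D = max (degree G) i"
  have "degree (map_poly embed G) \<le> D"
    unfolding D_def by (intro degree_le) (auto simp: coeff_eq_0)
  then have "poly (map_poly embed G) (perturb c) = (\<Sum>j\<le>D. coeff (map_poly embed G) j * perturb c ^ j)"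
    unfolding poly_altdef
    by (intro sum.mono_neutral_left) (auto simp: coeff_eq_0 simp del: embed.coeff_map)
  also have "\<dots> = (\<Sum>j\<le>D. (embed (coeff G j) * fps_const (monom 1 j)) * fps_X ^ (c * j))"
    by (simp add: perturb_power mult.assoc)
  finally have "coeff (fps_nth (generic d S c H) n) i =
      (\<Sum>j\<le>D. coeff (fps_nth ((embed (coeff G j) * fps_const (monom 1 j)) * fps_X ^ (c * j)) n) i)"
    unfolding generic_conv_taylor G_def[symmetric] by (simp add: fps_sum_nth coeff_sum)
  also have "\<dots> = (\<Sum>j\<in>{i}. coeff (fps_nth ((embed (coeff G j) * fps_const (monom 1 j)) * fps_X ^ (c * j)) n) i)"
    by (intro sum.mono_neutral_right) (auto simp: D_def fps_X_power_mult_right_nth)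
  also have "\<dots> = (if c * i \<le> n then fps_nth (coeff G i) (n - c * i) else 0)"
    by (auto simp: fps_X_power_mult_right_nth)
  finally show ?thesis unfolding G_def .
qed

lemma coeff_taylor_0: "coeff (taylor d S H) 0 = ev d S H"
  unfolding taylor_def ev_def by simp

lemma coeff_generic_nth_0: "coeff (fps_nth (generic d S c H) n) 0 = fps_nth (ev d S H) n"
  by (simp add: coeff_generic_nth coeff_taylor_0)

text \<open>
  \<open>N\<close> is the gcd of \<open>d\<close> and the exponents of \<open>S\<close> below \<open>k\<^sub>0\<close>. The assumption \<open>small\<close> says that
  the initial form of a polynomial of degree below \<open>e\<close> along \<open>S + u t\<^bsup>k\<^sub>0\<^esup>\<close> is free of \<open>u\<close>.
\<close>
locale irreducible_stage =
  stage v "\<lambda>H. ord (ev d S H)" F N e N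
  for v :: "'a::alg_closed_field fps poly \<Rightarrow> enat" and d S F N e +
  fixes k\<^sub>0 :: nat
  assumes d_def: "d = degree F"
    and char: "\<And>k. 0 < k \<Longrightarrow> k \<le> d \<Longrightarrow> (of_nat k :: 'a) \<noteq> 0"
    and prim: "primitive d S"
    and F_prod: "map_poly (pw d) F = (\<Prod>w\<in>unity_roots d. [:- twist w S, 1:])"
    and N_dvd: "\<And>i. i < k\<^sub>0 \<Longrightarrow> fps_nth S i \<noteq> 0 \<Longrightarrow> N dvd i"
    and dvd_N: "\<And>g. g dvd d \<Longrightarrow> (\<And>i. i < k\<^sub>0 \<Longrightarrow> fps_nth S i \<noteq> 0 \<Longrightarrow> g dvd i) \<Longrightarrow> g dvd N"
    and small: "\<And>a i. a \<noteq> 0 \<Longrightarrow> degree a < e \<Longrightarrow> 0 < i \<Longrightarrow>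
      ord (ev d S a) < ord (coeff (taylor d S a) i) + enat (k\<^sub>0 * i)"

text \<open>\<open>c\<close> is the next characteristic exponent of \<open>S\<close>.\<close>
locale irreducible_step = irreducible_stage v d S F N e k\<^sub>0
  for v :: "'a::alg_closed_field fps poly \<Rightarrow> enat" and d S F N e k\<^sub>0 +
  fixes c :: nat
  assumes c: "fps_nth S c \<noteq> 0" "\<not> N dvd c" "\<And>i. i < c \<Longrightarrow> fps_nth S i \<noteq> 0 \<Longrightarrow> N dvd i"
begin

abbreviation "\<Phi> \<equiv> generic d S c"
abbreviation "W \<equiv> (\<lambda>H. ord (\<Phi> H))"
abbreviation "s \<equiv> fps_nth S c"

lemma d_eq: "d = N * e" and d_pos: "0 < d" and N2: "2 \<le> N"
proof -
  show "d = N * e" using F d_def by simp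
  then show "0 < d" using pos by simp
  show "2 \<le> N" using c(2) pos by (cases "N = 1") auto
qed

lemma nz: "(of_nat d :: 'a) \<noteq> 0" "(of_nat e :: 'a) \<noteq> 0"
proof -
  show "(of_nat d :: 'a) \<noteq> 0" using char[of d] d_pos by simp
  have "e \<le> d" using d_eq pos by simp
  then show "(of_nat e :: 'a) \<noteq> 0" using char[of e] pos by simp
qed

lemma k0_le: "k\<^sub>0 \<le> c"
  using N_dvd[of c] c(1,2) by (cases "c < k\<^sub>0") auto

lemma W_valuation: "valuation W"
  by (rule valuation_morphism[OF valuation_ord generic_morphism[OF d_pos]])

lemma Phi_morphism: "comm_ring_morphism \<Phi>"
  by (intro generic_morphism d_pos)

text \<open>Since \<open>c\<close> is at least \<open>k\<^sub>0\<close>, perturbing at t^c is a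
  smaller change than the one in \<open>small\<close>, and every term with a positive power of
  \<open>u\<close> still falls beyond the order of \<open>a\<close>.\<close>

lemma small_starts:
  assumes "a \<noteq> 0" "degree a < e"
  obtains n \<kappa> where "\<kappa> \<noteq> 0" "ord (ev d S a) = enat n" "W a = enat n" "starts (\<Phi> a) n [:\<kappa>:]"
proof -
  have fin: "ord (ev d S a) \<noteq> \<infinity>"
  proof
    assume "ord (ev d S a) = \<infinity>"
    then show False using small[OF assms, of 1] by simp
  qed
  then obtain n where n: "ord (ev d S a) = enat n" by auto
  define \<kappa> where "\<kappa> = fps_nth (ev d S a) n"
  have \<kappa>: "\<kappa> \<noteq> 0" "\<And>i. i < n \<Longrightarrow> fps_nth (ev d S a) i = 0" using n unfolding ord_eq_iff \<kappa>_def by auto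
  have zero: "fps_nth (coeff (taylor d S a) i) (k - c * i) = 0" if i: "0 < i" "k \<le> n" "c * i \<le> k" for i k
  proof -
    have "enat n < ord (coeff (taylor d S a) i) + enat (k\<^sub>0 * i)" using small[OF assms i(1)] n by simp
    also have "\<dots> \<le> ord (coeff (taylor d S a) i) + enat (c * i)"
      using k0_le by (intro add_left_mono) simp
    finally have "enat (Suc n - c * i) \<le> ord (coeff (taylor d S a) i)"
      by (cases "ord (coeff (taylor d S a) i)") auto
    then show ?thesis using i unfolding ord_ge_iff by auto
  qed
  have st: "starts (\<Phi> a) n [:\<kappa>:]"
    unfolding starts_def
  proof (intro conjI allI impI)
    show "fps_nth (\<Phi> a) k = 0" if k: "k < n" for k
    proof (rule poly_eqI)
      show "coeff (fps_nth (\<Phi> a) k) i = coeff 0 i" for i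
        using k zero[of i k] \<kappa>(2)[OF k] coeff_generic_nth_0[of d S c a k]
        by (cases "i = 0") (auto simp: coeff_generic_nth)
    qed
    show "fps_nth (\<Phi> a) n = [:\<kappa>:]"
    proof (rule poly_eqI)
      show "coeff (fps_nth (\<Phi> a) n) i = coeff [:\<kappa>:] i" for i
        using zero[of i n] coeff_generic_nth_0[of d S c a n]
        by (cases "i = 0") (auto simp: coeff_generic_nth \<kappa>_def coeff_pCons split: nat.splits)
    qed
  qed
  have "W a = enat n" by (rule starts_ord[OF st]) (use \<kappa> in simp)
  then show ?thesis by (rule that[OF \<kappa>(1) n _ st])
qed

text \<open>Here \<open>n\<close> is only a lower bound for the order; below the true order the
  constant is 0.\<close>

lemma small_starts_const:
  assumes "degree a < e" "enat n \<le> W a"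
  shows "starts (\<Phi> a) n [:coeff (fps_nth (\<Phi> a) n) 0:]"
    and "coeff (fps_nth (\<Phi> a) n) 0 \<noteq> 0 \<longleftrightarrow> W a = enat n"
proof -
  have *: "starts (\<Phi> a) n (fps_nth (\<Phi> a) n)" using assms(2) by (rule ord_starts)
  have "fps_nth (\<Phi> a) n = [:coeff (fps_nth (\<Phi> a) n) 0:] \<and>
     (coeff (fps_nth (\<Phi> a) n) 0 \<noteq> 0 \<longleftrightarrow> W a = enat n)"
  proof (cases "a = 0")
    case True
    then show ?thesis using comm_ring_morphism.zero[OF Phi_morphism] by (simp add: ord_def)
  next
    case False
    obtain k \<kappa> where k: "\<kappa> \<noteq> 0" "W a = enat k" "starts (\<Phi> a) k [:\<kappa>:]"
      using small_starts[OF False assms(1)] by metis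
    show ?thesis
    proof (cases "k = n")
      case True
      then show ?thesis using k by (auto simp: starts_def)
    next
      case False
      then have "n < k" using assms(2) k(2) by simp
      then have "fps_nth (\<Phi> a) n = 0" using k(3) by (simp add: starts_def)
      then show ?thesis using False k(2) by simp
    qed
  qed
  then show "starts (\<Phi> a) n [:coeff (fps_nth (\<Phi> a) n) 0:]"
    and "coeff (fps_nth (\<Phi> a) n) 0 \<noteq> 0 \<longleftrightarrow> W a = enat n" using * by auto
qed

lemma W_finite: "a \<noteq> 0 \<Longrightarrow> degree a < e \<Longrightarrow> W a \<noteq> \<infinity>"
  using small_starts by (metis enat.distinct(2))

text \<open>
  If the initial form \<open>h\<close> of \<open>Q\<close> is not constant, the terms of a \<open>Q\<close>-adic expansion cannot
  cancel: their initial forms are distinct powers of \<open>h\<close> up to constants.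
\<close>
lemma expansion_starts:
  assumes Q: "lead_coeff Q = 1" "degree Q = e" "starts (\<Phi> Q) \<omega> h" "0 < degree h"
    and H: "H \<noteq> 0"
  obtains n K where "W H = enat n" "gauss W \<omega> (adic Q H) = enat n" "starts (\<Phi> H) n (pcompose K h)"
    "\<And>i. coeff K i \<noteq> 0 \<longleftrightarrow> W (coeff (adic Q H) i) + enat (i * \<omega>) = enat n"
    "\<And>i. i * \<omega> \<le> n \<Longrightarrow> coeff K i = coeff (fps_nth (\<Phi> (coeff (adic Q H) i)) (n - i * \<omega>)) 0"
proof -
  interpret Q: monic_poly Q by unfold_locales (use Q pos in auto)
  interpret Phi: comm_ring_morphism \<Phi> by (rule Phi_morphism)
  define A where "A = adic Q H"
  have dA: "degree (coeff A i) < e" for i using Q.degree_coeff_adic Q(2) unfolding A_def by simp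
  have "lead_coeff A \<noteq> 0" using H unfolding A_def by simp
  then have "W (lead_coeff A) \<noteq> \<infinity>" using W_finite dA by blast
  then have "gauss W \<omega> A \<noteq> \<infinity>"
  proof (rule contrapos_nn)
    assume "gauss W \<omega> A = \<infinity>"
    then show "W (lead_coeff A) = \<infinity>"
      using gauss_le[of W \<omega> A "degree A"] by (cases "W (lead_coeff A)") auto
  qed
  then obtain n where n: "gauss W \<omega> A = enat n" by auto
  have le: "enat n \<le> W (coeff A i) + enat (i * \<omega>)" for i
    using gauss_le[of W \<omega> A i] n by simp
  \<comment> \<open>The contribution of index \<open>i\<close> at level \<open>n\<close>. The test
    guards the truncated subtraction: if \<open>i * \<omega>\<close> exceeds \<open>n\<close>, the
    term starts too late to contribute.\<close>
  define \<kappa> where "\<kappa> i = (if i * \<omega> \<le> n then coeff (fps_nth (\<Phi> (coeff A i)) (n - i * \<omega>)) 0 else 0)" for i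
  define K where "K = (\<Sum>i\<le>degree A. monom (\<kappa> i) i)"
  have \<kappa>0: "\<kappa> i = 0" if "degree A < i" for i
    using that by (simp add: \<kappa>_def coeff_eq_0 Phi.zero)
  have cK: "coeff K i = \<kappa> i" for i
    unfolding K_def using \<kappa>0[of i] by (auto simp: coeff_sum not_le)
  have \<kappa>_iff: "\<kappa> i \<noteq> 0 \<longleftrightarrow> W (coeff A i) + enat (i * \<omega>) = enat n" for i
  proof (cases "i * \<omega> \<le> n")
    case True
    then have "enat (n - i * \<omega>) \<le> W (coeff A i)"
      using le[of i] by (cases "W (coeff A i)") auto
    from small_starts_const(2)[OF dA this] show ?thesis
      using True unfolding \<kappa>_def by (cases "W (coeff A i)") auto
  next
    case False
    then show ?thesis unfolding \<kappa>_def by (cases "W (coeff A i)") auto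
  qed
  have summand: "starts (\<Phi> (coeff A i * Q ^ i)) n (smult (\<kappa> i) (h ^ i))" for i
  proof (cases "i * \<omega> \<le> n")
    case True
    then have "enat (n - i * \<omega>) \<le> W (coeff A i)"
      using le[of i] by (cases "W (coeff A i)") auto
    from starts_mult[OF small_starts_const(1)[OF dA this] starts_power[OF Q(3), of i]]
    show ?thesis using True by (simp add: Phi.mult Phi.power \<kappa>_def)
  next
    case False
    have "fps_nth (\<Phi> (coeff A i) * \<Phi> Q ^ i) k = 0" if "k < i * \<omega>" for k
      using fps_mult_nth_low(2)[of 0 "\<Phi> (coeff A i)" "i * \<omega>" "\<Phi> Q ^ i" k] starts_power[OF Q(3), of i] that
      unfolding starts_def by auto
    then show ?thesis using False by (simp add: Phi.mult Phi.power starts_def \<kappa>_def)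
  qed
  have "H = (\<Sum>i\<le>degree A. coeff A i * Q ^ i)"
    using Q.poly_adic[of H] unfolding poly_altdef A_def by simp
  then have "\<Phi> H = \<Phi> (\<Sum>i\<le>degree A. coeff A i * Q ^ i)" by (rule arg_cong)
  then have "\<Phi> H = (\<Sum>i\<le>degree A. \<Phi> (coeff A i * Q ^ i))" by (simp only: Phi.sum)
  then have "starts (\<Phi> H) n (\<Sum>i\<le>degree A. smult (\<kappa> i) (h ^ i))"
    using starts_sum[of "{..degree A}", OF summand] by simp
  moreover have "pcompose K h = (\<Sum>i\<le>degree A. smult (\<kappa> i) (h ^ i))"
  proof -
    have "pcompose (monom x i) h = smult x (h ^ i)" for x i
    proof -
      have "monom x i = smult x ([:0, 1:] ^ i)" by (simp add: monom_altdef)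
      then show ?thesis
        by (simp add: pcompose_smult comm_ring_morphism.power[OF pcompose_morphism] pcompose_pCons)
    qed
    then show ?thesis unfolding K_def by (simp add: pcompose_sum)
  qed
  ultimately have st: "starts (\<Phi> H) n (pcompose K h)" by simp
  obtain i where "gauss W \<omega> A = W (coeff A i) + enat (i * \<omega>)" using gauss_attained by blast
  then have "coeff K i \<noteq> 0" using n \<kappa>_iff[of i] cK by simp
  then have "K \<noteq> 0" by auto
  then have "pcompose K h \<noteq> 0" using Q(4) by (simp add: pcompose_eq_0_iff)
  then have "W H = enat n" using st by (rule starts_ord[rotated])
  then show ?thesis using that[of n K] n st \<kappa>_iff cK unfolding A_def[symmetric] \<kappa>_def by auto
qed

text \<open>By \<open>expansion_starts\<close>, \<open>W\<close> is a minimum over the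
  \<open>Q\<close>-adic coefficients, and \<open>r\<close> changes only the coefficient at index 0,
  which vanishes for a multiple of \<open>Q\<close>.\<close>

lemma division_stable_W:
  assumes Q: "lead_coeff Q = 1" "degree Q = e" "starts (\<Phi> Q) \<omega> h" "0 < degree h"
  shows "division_stable W Q"
  unfolding division_stable_def
proof (intro allI impI)
  interpret Q: monic_poly Q by unfold_locales (use Q pos in auto)
  fix q r :: "'a fps poly" assume r: "degree r < degree Q"
  show "W (q * Q + r) \<le> W (q * Q)"
  proof (cases "q = 0")
    case True
    then show ?thesis using comm_ring_morphism.zero[OF Phi_morphism] by (simp add: ord_def)
  next
    case False
    have W_gauss: "W H = gauss W \<omega> (adic Q H)" if "H \<noteq> 0" for H
      using expansion_starts[OF Q that] by metis
    have nz: "q * Q \<noteq> 0" using False Q.nonzero by simp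
    have nz': "q * Q + r \<noteq> 0"
    proof
      assume "q * Q + r = 0"
      then have "q * Q + r = 0 * Q + 0" by simp
      from monic_division_unique(1)[OF Q(1) this r] False Q.deg_pos show False by simp
    qed
    have ad: "adic Q (q * Q + r) = pCons r (adic Q q)" "adic Q (q * Q) = pCons 0 (adic Q q)"
      using Q.adic_times_plus[OF r, of q] Q.adic_times_plus[of 0 q] Q.deg_pos by auto
    have "gauss W \<omega> (pCons r (adic Q q)) \<le> gauss W \<omega> (pCons 0 (adic Q q))"
    proof (rule gauss_geI)
      fix i
      show "gauss W \<omega> (pCons r (adic Q q)) \<le> W (coeff (pCons 0 (adic Q q)) i) + enat (i * \<omega>)"
      proof (cases i)
        case 0
        then show ?thesis using valuation.zero[OF W_valuation] by simp
      next
        case (Suc j)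
        then show ?thesis using gauss_le[of W \<omega> "pCons r (adic Q q)" i] by simp
      qed
    qed
    then show ?thesis unfolding W_gauss[OF nz] W_gauss[OF nz'] ad .
  qed
qed

end

section \<open>Irreducible polynomials pass the test\<close>

lemma starts_embed_perturb:
  assumes "\<And>i. i < n \<Longrightarrow> fps_nth f i = 0"
  shows "n < c \<Longrightarrow> starts (embed f + perturb c) n [:fps_nth f n:]"
    and "n = c \<Longrightarrow> starts (embed f + perturb c) n [:fps_nth f n, 1:]"
  using assms unfolding starts_def by (auto simp: perturb_nth)

context irreducible_step
begin

text \<open>Below \<open>c\<close> all exponents of \<open>S\<close> are multiples of
  \<open>N\<close>, so the truncation of \<open>S\<close> is this series in t^N; its conjugates are
  indexed by \<open>e\<close>-th instead of \<open>d\<close>-th roots of unity.\<close>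

definition base_series :: "'a fps" where
  "base_series = Abs_fps (\<lambda>n. if N * n < c then fps_nth S (N * n) else 0)"

lemma N0: "0 < N" using pos by simp

lemma S_below: "i < c \<Longrightarrow> fps_nth S i = fps_nth (pw N base_series) i"
  using N0 c(3)[of i] by (auto simp: pw_nth base_series_def elim!: dvdE)

definition gap :: "'a \<Rightarrow> 'a fps" where
  "gap \<eta> = base_series - twist \<eta> base_series"

text \<open>A common factor \<open>g\<close> of \<open>e\<close> and the exponents would make
  \<open>N * g\<close> a common divisor of \<open>d\<close> and the exponents of \<open>S\<close>
  below \<open>k\<^sub>0\<close>, and \<open>N\<close> is the greatest such divisor.\<close>

lemma base_primitive: "primitive e base_series"
  unfolding primitive_def
proof (intro allI impI, rule ccontr)
  fix g assume g: "g dvd e" "1 < g" and no: "\<nexists>i. fps_nth base_series i \<noteq> 0 \<and> \<not> g dvd i"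
  have "N * g dvd N"
  proof (rule dvd_N)
    show "N * g dvd d" using g(1) by (simp add: d_eq)
    fix i assume i: "i < k\<^sub>0" "fps_nth S i \<noteq> 0"
    then obtain j where j: "i = N * j" using N_dvd by blast
    have "fps_nth base_series j \<noteq> 0" using i k0_le by (simp add: base_series_def j)
    then show "N * g dvd i" using no by (auto simp: j)
  qed
  then show False using g(2) N0 by simp
qed

lemma gap_nonzero: "\<eta> \<in> unity_roots e \<Longrightarrow> \<eta> \<noteq> 1 \<Longrightarrow> gap \<eta> \<noteq> 0"
  using twist_primitive[OF pos(2) base_primitive, of \<eta>] by (auto simp: gap_def)

text \<open>The order in t of the linear factor belonging to the conjugate \<eta>. For \<eta> = 1
  the truncated series cancels and u t^c becomes visible; for the others the order is below
  \<open>c\<close>, so \<open>u\<close> is not seen.\<close>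

definition cdeg :: "'a \<Rightarrow> nat" where
  "cdeg \<eta> = (if \<eta> = 1 then c else N * subdegree (gap \<eta>))"

definition clead :: "'a \<Rightarrow> 'a" where
  "clead \<eta> = fps_nth (gap \<eta>) (subdegree (gap \<eta>))"

lemma gap_starts:
  assumes f: "\<And>i. i < c \<Longrightarrow> fps_nth f i = fps_nth (pw N (gap \<eta>)) i" and \<eta>: "\<eta> \<in> unity_roots e" "\<eta> \<noteq> 1"
  shows "starts (embed f + perturb c) (cdeg \<eta>) [:clead \<eta>:]"
proof -
  have nz: "gap \<eta> \<noteq> 0" using gap_nonzero \<eta> by blast
  define k where "k = subdegree (gap \<eta>)"
  have "fps_nth (gap \<eta>) k \<noteq> 0" using nz by (simp add: k_def)
  then have "fps_nth base_series k \<noteq> 0" by (auto simp: gap_def)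
  then have kc: "N * k < c" by (auto simp: base_series_def split: if_splits)
  have "fps_nth f i = 0" if "i < N * k" for i
    using f[of i] that kc N0 by (auto simp: pw_nth k_def elim!: dvdE)
  from starts_embed_perturb(1)[OF this kc] have "starts (embed f + perturb c) (N * k) [:fps_nth f (N * k):]" .
  moreover have "fps_nth f (N * k) = clead \<eta>"
    using f[OF kc] N0 by (simp add: pw_nth clead_def k_def)
  ultimately show ?thesis using \<eta> by (simp add: cdeg_def k_def)
qed

lemma norm_starts:
  "starts (embed (S - pw N (twist \<eta> base_series)) + perturb c) (cdeg \<eta>)
     (if \<eta> = 1 then [:s, 1:] else [:clead \<eta>:])" if \<eta>: "\<eta> \<in> unity_roots e"
proof (cases "\<eta> = 1")
  case True
  have "fps_nth (S - pw N base_series) i = 0" if "i < c" for i using S_below[OF that] by simp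
  from starts_embed_perturb(2)[of c "S - pw N base_series" c, OF this] show ?thesis
    using True c(2) N0 by (simp add: cdeg_def pw_nth)
next
  case False
  interpret pN: comm_ring_morphism "pw N :: 'a fps \<Rightarrow> _" by (rule pw_morphism[OF N0])
  have "fps_nth (S - pw N (twist \<eta> base_series)) i = fps_nth (pw N (gap \<eta>)) i" if "i < c" for i
    using S_below[OF that] by (simp add: gap_def pN.diff)
  from gap_starts[OF this \<eta> False] False show ?thesis by simp
qed

lemma unity_power: "w \<in> unity_roots d \<Longrightarrow> w ^ N \<in> unity_roots e"
  by (simp add: unity_roots_def d_eq power_mult)

text \<open>Below t^c, twisting \<open>S\<close> by \<open>w\<close> is twisting the base series by
  \<open>w ^ N\<close>. If that power is 1, the first possible difference is (1 - w^c) s t^c, next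
  to u t^c.\<close>

lemma conj_starts:
  "starts (embed (S - twist w S) + perturb c) (cdeg (w ^ N))
     (if w ^ N = 1 then [:s - w ^ c * s, 1:] else [:clead (w ^ N):])" if w: "w \<in> unity_roots d"
proof -
  have f: "fps_nth (S - twist w S) i = fps_nth (pw N (gap (w ^ N))) i" if "i < c" for i
  proof (cases "N dvd i")
    case True
    then obtain j where "i = N * j" by blast
    moreover from this have "fps_nth S i = fps_nth base_series j" using S_below[OF that] N0 by (simp add: pw_nth)
    moreover have "w ^ (N * j) = (w ^ N) ^ j" by (rule power_mult)
    ultimately show ?thesis using N0 by (simp add: pw_nth gap_def)
  next
    case False
    then show ?thesis using c(3)[OF that] N0 by (auto simp: pw_nth)
  qed
  show ?thesis
  proof (cases "w ^ N = 1")
    case True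
    have "fps_nth (S - twist w S) i = 0" if "i < c" for i
      using f[OF that] True by (simp add: gap_def)
    from starts_embed_perturb(2)[of c "S - twist w S" c, OF this] show ?thesis
      using True by (simp add: cdeg_def)
  next
    case False
    from gap_starts[OF f unity_power[OF w] False] False show ?thesis by simp
  qed
qed

lemma generic_of_prod:
  assumes "map_poly (pw d) Q = (\<Prod>x\<in>A. [:- f x, 1:])"
  shows "\<Phi> Q = (\<Prod>x\<in>A. embed (S - f x) + perturb c)"
proof -
  interpret em: comm_ring_morphism "embed :: 'a fps \<Rightarrow> _" by (rule embed_morphism)
  interpret mem: comm_ring_morphism "map_poly (embed :: 'a fps \<Rightarrow> _)" by (rule em.map_poly_morphism)
  show ?thesis unfolding generic_def assms mem.prod poly_prod
    by (intro prod.cong) (auto simp: em.minus em.diff em.one)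
qed

text \<open>
  \<open>P\<close> is the minimal polynomial of \<open>S\<close> truncated at the characteristic exponent \<open>c\<close>. Its initial
  form is linear in \<open>u\<close>, and that of \<open>F\<close> is read off the factorization into conjugates.
\<close>
lemma norm_poly:
  obtains P \<omega> l where "lead_coeff P = 1" "degree P = e" "l \<noteq> 0"
    "starts (\<Phi> P) \<omega> [:l * s, l:]" "W F = enat (N * \<omega>)" "\<not> N dvd \<omega>" "gcd N \<omega> = gcd N c"
    "\<exists>C. C \<noteq> 0 \<and> starts (\<Phi> F) (N * \<omega>) (smult C (\<Prod>w\<in>unity_roots N. [:s - w ^ c * s, 1:]))"
proof -
  obtain P where P: "lead_coeff P = 1" "degree P = e"
    "map_poly (pw e) P = (\<Prod>\<eta>\<in>unity_roots e. [:- twist \<eta> base_series, 1:])"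
    using norm_poly_exists[OF pos(2) nz(2)] by blast
  interpret pN: comm_ring_morphism "pw N :: 'a fps \<Rightarrow> _" by (rule pw_morphism[OF N0])
  interpret mpN: comm_ring_morphism "map_poly (pw N :: 'a fps \<Rightarrow> _)" by (rule pN.map_poly_morphism)
  have fin: "finite (unity_roots e :: 'a set)" "finite (unity_roots d :: 'a set)"
    using unity_roots_card(1)[OF pos(2) nz(2)] unity_roots_card(1)[OF d_pos nz(1)] by auto
  have "map_poly (pw d) P = map_poly (pw N) (map_poly (pw e) P)"
    using pos by (intro poly_eqI) (simp add: coeff_map_poly pw_pw d_eq)
  also have "\<dots> = (\<Prod>\<eta>\<in>unity_roots e. [:- pw N (twist \<eta> base_series), 1:])"
    unfolding P(3) mpN.prod by (simp add: pN.minus)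
  finally have PhiP: "\<Phi> P = (\<Prod>\<eta>\<in>unity_roots e. embed (S - pw N (twist \<eta> base_series)) + perturb c)"
    by (rule generic_of_prod)
  define \<omega> where "\<omega> = (\<Sum>\<eta>\<in>(unity_roots e :: 'a set). cdeg \<eta>)"
  have const: "(\<Prod>x\<in>A. [:f x:]) = [:\<Prod>x\<in>A. f x:]" for f :: "'a \<Rightarrow> 'a" and A
    by (rule comm_ring_morphism.prod[OF const_poly_morphism, symmetric])
  define l where "l = (\<Prod>\<eta>\<in>unity_roots e - {1}. clead \<eta>)"
  have l: "l \<noteq> 0"
    unfolding l_def using fin gap_nonzero by (auto simp: clead_def)
  have "(\<Prod>\<eta>\<in>unity_roots e. if \<eta> = 1 then [:s, 1:] else [:clead \<eta>:]) =
      [:s, 1:] * (\<Prod>\<eta>\<in>unity_roots e - {1}. if \<eta> = 1 then [:s, 1:] else [:clead \<eta>:])"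
    using fin by (subst prod.remove[of _ 1]) auto
  also have "(\<Prod>\<eta>\<in>unity_roots e - {1}. if \<eta> = 1 then [:s, 1:] else [:clead \<eta>:]) = [:l:]"
    unfolding l_def const[symmetric] by (intro prod.cong) auto
  finally have "(\<Prod>\<eta>\<in>unity_roots e. if \<eta> = 1 then [:s, 1:] else [:clead \<eta>:]) = [:l * s, l:]"
    by simp
  moreover have "starts (\<Phi> P) \<omega> (\<Prod>\<eta>\<in>unity_roots e. if \<eta> = 1 then [:s, 1:] else [:clead \<eta>:])"
    unfolding PhiP \<omega>_def by (rule starts_prod[OF fin(1)]) (rule norm_starts)
  ultimately have stP: "starts (\<Phi> P) \<omega> [:l * s, l:]" by simp
  \<comment> \<open>The factor \<eta> = 1 contributes \<open>c\<close> and every other factor a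
    multiple of \<open>N\<close>, so \<omega> and \<open>c\<close> agree modulo
    \<open>N\<close>.\<close>
  have \<omega>: "\<omega> = c + N * (\<Sum>\<eta>\<in>unity_roots e - {1}. subdegree (gap \<eta>))"
  proof -
    have "\<omega> = cdeg 1 + (\<Sum>\<eta>\<in>unity_roots e - {1}. cdeg \<eta>)"
      unfolding \<omega>_def using fin by (subst sum.remove[of _ 1]) auto
    then show ?thesis by (simp add: cdeg_def sum_distrib_left)
  qed
  have ndvd: "\<not> N dvd \<omega>" unfolding \<omega> using c(2) by (simp add: dvd_add_left_iff)
  have gcd: "gcd N \<omega> = gcd N c"
  proof -
    have "\<omega> = (\<Sum>\<eta>\<in>unity_roots e - {1}. subdegree (gap \<eta>)) * N + c" using \<omega> by simp
    then show ?thesis by (simp only: gcd_add_mult)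
  qed
  \<comment> \<open>Each \<eta> has exactly \<open>N\<close> preimages under w \<mapsto> w^N, so
    each order \<open>cdeg \<eta>\<close> occurs \<open>N\<close> times among the factors of
    \<open>F\<close>.\<close>
  have fiber: "{w \<in> unity_roots d. w ^ N = \<eta>} = {w. w ^ N = \<eta>}" if "\<eta> \<in> unity_roots e" for \<eta> :: 'a
    using that by (auto simp: unity_roots_def d_eq power_mult)
  have "(\<Sum>w\<in>(unity_roots d :: 'a set). cdeg (w ^ N)) =
      (\<Sum>\<eta>\<in>unity_roots e. \<Sum>w\<in>{w \<in> unity_roots d. w ^ N = \<eta>}. cdeg (w ^ N))"
    using unity_power by (intro sum.group[symmetric] fin) auto
  also have "\<dots> = (\<Sum>\<eta>\<in>(unity_roots e :: 'a set). N * cdeg \<eta>)"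
  proof (rule sum.cong)
    fix \<eta> :: 'a assume \<eta>: "\<eta> \<in> unity_roots e"
    have "(\<Sum>w\<in>{w \<in> unity_roots d. w ^ N = \<eta>}. cdeg (w ^ N)) = card {w \<in> unity_roots d. w ^ N = \<eta>} * cdeg \<eta>"
      by simp
    also have "card {w \<in> unity_roots d. w ^ N = \<eta>} = N"
      unfolding fiber[OF \<eta>] by (rule card_power_fiber(2)[OF N0 N_nz unity_roots_nonzero[OF pos(2) \<eta>]])
    finally show "(\<Sum>w\<in>{w \<in> unity_roots d. w ^ N = \<eta>}. cdeg (w ^ N)) = N * cdeg \<eta>" .
  qed simp
  also have "\<dots> = N * \<omega>" by (simp add: \<omega>_def sum_distrib_left)
  finally have sumF: "(\<Sum>w\<in>(unity_roots d :: 'a set). cdeg (w ^ N)) = N * \<omega>" .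
  define ld where "ld w = (if w ^ N = 1 then [:s - w ^ c * s, 1:] else [:clead (w ^ N):])" for w
  have "starts (\<Phi> F) (\<Sum>w\<in>unity_roots d. cdeg (w ^ N)) (\<Prod>w\<in>unity_roots d. ld w)"
    unfolding generic_of_prod[OF F_prod] by (rule starts_prod[OF fin(2)]) (unfold ld_def, rule conj_starts)
  then have stF: "starts (\<Phi> F) (N * \<omega>) (\<Prod>w\<in>unity_roots d. ld w)" unfolding sumF .
  have sub: "unity_roots N \<subseteq> (unity_roots d :: 'a set)"
    by (auto simp: unity_roots_def d_eq power_mult)
  define C where "C = (\<Prod>w\<in>unity_roots d - unity_roots N. clead (w ^ N))"
  have "C \<noteq> 0"
    unfolding C_def using fin gap_nonzero[OF unity_power] by (auto simp: clead_def unity_roots_def)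
  have "(\<Prod>w\<in>unity_roots d. ld w) = (\<Prod>w\<in>unity_roots d - unity_roots N. ld w) * (\<Prod>w\<in>unity_roots N. ld w)"
    by (rule prod.subset_diff[OF sub fin(2)])
  also have "(\<Prod>w\<in>unity_roots d - unity_roots N. ld w) = [:C:]"
    unfolding C_def const[symmetric] by (intro prod.cong) (auto simp: ld_def unity_roots_def)
  also have "(\<Prod>w\<in>unity_roots N. ld w) = (\<Prod>w\<in>unity_roots N. [:s - w ^ c * s, 1:])"
    by (intro prod.cong) (auto simp: ld_def unity_roots_def)
  finally have ldF: "(\<Prod>w\<in>unity_roots d. ld w) = smult C (\<Prod>w\<in>unity_roots N. [:s - w ^ c * s, 1:])"
    by simp
  have "finite (unity_roots N :: 'a set)" using sub fin finite_subset by blast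
  then have "(\<Prod>w\<in>unity_roots N. [:s - w ^ c * s, 1:]) \<noteq> 0" by (simp add: prod_zero_iff)
  then have "(\<Prod>w\<in>unity_roots d. ld w) \<noteq> 0" unfolding ldF using \<open>C \<noteq> 0\<close> by simp
  then have WF: "W F = enat (N * \<omega>)" by (rule starts_ord[OF stF])
  have "\<exists>C. C \<noteq> 0 \<and> starts (\<Phi> F) (N * \<omega>) (smult C (\<Prod>w\<in>unity_roots N. [:s - w ^ c * s, 1:]))"
    using stF \<open>C \<noteq> 0\<close> unfolding ldF by blast
  then show ?thesis by (rule that[OF P(1,2) l stP WF ndvd gcd])
qed

text \<open>
  In terms of \<open>z = l (u + s) + \<kappa>\<close> the initial form of \<open>F\<close> is, up to a constant, the product of
  \<open>z - \<kappa> - l s w\<^sup>c\<close> over \<open>w\<^sup>N = 1\<close>. The \<open>w\<^sup>c\<close> sum to zero, so a vanishing subleading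
  coefficient forces \<open>\<kappa> = 0\<close>.
\<close>
lemma pcompose_monic_linear_prod:
  fixes K :: "'a poly"
  assumes l: "l \<noteq> 0" and K: "coeff K N = 1" "coeff K (N - 1) = 0" and C: "C \<noteq> 0"
    and eq: "pcompose K [:l * s + \<kappa>, l:] = smult C (\<Prod>w\<in>unity_roots N. [:s - w ^ c * s, 1:])"
  shows "\<kappa> = 0" "coeff K 0 \<noteq> 0"
proof -
  \<comment> \<open>The inverse under composition of u \<mapsto> l (u + s) + \<kappa>, used to solve
    for \<open>K\<close>.\<close>
  define L where "L = [:- (l * s + \<kappa>) / l, 1 / l:]"
  have card: "finite (unity_roots N :: 'a set)" "card (unity_roots N :: 'a set) = N"
    using unity_roots_card[OF N0 N_nz] by auto
  have "pcompose [:l * s + \<kappa>, l:] L = [:0, 1:]"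
    using l by (simp add: L_def pcompose_pCons)
  then have "K = pcompose (pcompose K [:l * s + \<kappa>, l:]) L"
    by (metis pcompose_assoc pcompose_idR)
  also have "\<dots> = smult C (\<Prod>w\<in>unity_roots N. pcompose [:s - w ^ c * s, 1:] L)"
    unfolding eq by (simp add: pcompose_smult pcompose_prod)
  also have "(\<Prod>w\<in>unity_roots N. pcompose [:s - w ^ c * s, 1:] L) =
      (\<Prod>w\<in>unity_roots N. [:1 / l:] * [:- (\<kappa> + l * s * w ^ c), 1:])"
    using l by (intro prod.cong) (auto simp: L_def pcompose_pCons field_simps)
  also have "smult C \<dots> = smult (C * (1 / l) ^ N) (\<Prod>w\<in>unity_roots N. [:- (\<kappa> + l * s * w ^ c), 1:])"
    unfolding prod.distrib prod_constant card
    by (simp add: poly_const_pow)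
  finally have K_eq: "K = smult (C * (1 / l) ^ N) (\<Prod>w\<in>unity_roots N. [:- (\<kappa> + l * s * w ^ c), 1:])" .
  define M where "M = (\<Prod>w\<in>(unity_roots N :: 'a set). [:- (\<kappa> + l * s * w ^ c), 1:])"
  have "degree M = N"
    unfolding M_def using card by (subst degree_prod_eq_sum_degree) auto
  moreover have "lead_coeff M = 1" unfolding M_def lead_coeff_prod by simp
  ultimately have "coeff M N = 1" by simp
  then have C1: "C * (1 / l) ^ N = 1" using K(1) K_eq unfolding M_def[symmetric] by (metis coeff_smult mult.right_neutral)
  then have KM: "K = M" using K_eq unfolding M_def by simp
  have "unity_roots N \<noteq> ({} :: 'a set)" using one_in_unity_roots by blast
  from coeff_prod_linear[OF card(1) this, of "\<lambda>w. \<kappa> + l * s * w ^ c"] K(2)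
  have "(\<Sum>w\<in>(unity_roots N :: 'a set). \<kappa> + l * s * w ^ c) = 0"
    unfolding card KM M_def by simp
  moreover have "(\<Sum>w\<in>(unity_roots N :: 'a set). w ^ c) = 0"
    by (rule unity_roots_sum_power[OF N0 N_nz c(2)])
  ultimately have "of_nat N * \<kappa> = 0"
    by (simp add: sum.distrib sum_distrib_left[symmetric] card)
  then show \<kappa>: "\<kappa> = 0" using N_nz by simp
  have "poly M 0 = (\<Prod>w\<in>(unity_roots N :: 'a set). - (l * s * w ^ c))"
    unfolding M_def poly_prod \<kappa> by simp
  also have "\<dots> \<noteq> 0"
    using card l c(1) unity_roots_nonzero[OF N0] by (auto simp: prod_zero_iff)
  finally show "coeff K 0 \<noteq> 0" unfolding KM by (simp add: poly_0_coeff_0)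
qed

end

section \<open>One round of the loop on an irreducible polynomial\<close>

context irreducible_step
begin

text \<open>The difference of \<psi> and the norm polynomial \<open>P\<close> has degree below
  \<open>e\<close> and value at least \<omega>, so it shifts the initial form by a constant \<kappa>
  only. The vanishing coefficient of \<open>\<psi> ^ (N - 1)\<close> then forces \<kappa> =
  0.\<close>

lemma psi_starts:
  obtains \<omega> l where "l \<noteq> 0" "starts (\<Phi> \<psi>) \<omega> [:l * s, l:]" "\<not> N dvd \<omega>" "gcd N \<omega> = gcd N c"
    "\<And>i. enat (N * \<omega>) \<le> W (coeff (adic \<psi> F) i) + enat (i * \<omega>)"
    "W (coeff (adic \<psi> F) 0) = enat (N * \<omega>)"
proof -
  interpret Phi: comm_ring_morphism \<Phi> by (rule Phi_morphism)
  obtain P \<omega> l C where P: "lead_coeff P = 1" "degree P = e" and l: "l \<noteq> 0"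
    and st: "starts (\<Phi> P) \<omega> [:l * s, l:]" and WF: "W F = enat (N * \<omega>)"
    and \<omega>: "\<not> N dvd \<omega>" "gcd N \<omega> = gcd N c" and C: "C \<noteq> 0"
    and stF: "starts (\<Phi> F) (N * \<omega>) (smult C (\<Prod>w\<in>unity_roots N. [:s - w ^ c * s, 1:]))"
    by (rule norm_poly) blast
  have WP: "W P = enat \<omega>" using st by (rule starts_ord) (use l in simp)
  have stable: "division_stable W P"
    by (rule division_stable_W[OF P st]) (use l in simp)
  have "degree F = N * degree P" "0 < degree P" "W P \<noteq> \<infinity>" "enat N * W P \<le> W F"
    using F(2) P pos WP WF by auto
  from approx_root_valuation[OF F(1) this(1) N_nz N2 P(1) this(2) W_valuation stable this(3,4), folded \<psi>_def]
  have psi: "lead_coeff \<psi> = 1" "degree \<psi> = e" "enat \<omega> \<le> W (\<psi> - P)" "coeff (adic \<psi> F) (N - 1) = 0"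
    unfolding WP P(2) by auto
  have dif: "degree (\<psi> - P) < e"
    using degree_diff_monic[of \<psi> P] psi P pos by auto
  define \<kappa> where "\<kappa> = coeff (fps_nth (\<Phi> (\<psi> - P)) \<omega>) 0"
  have "starts (\<Phi> (P + (\<psi> - P))) \<omega> ([:l * s, l:] + [:\<kappa>:])"
    unfolding Phi.add \<kappa>_def by (rule starts_add[OF st small_starts_const(1)[OF dif psi(3)]])
  then have st\<psi>: "starts (\<Phi> \<psi>) \<omega> [:l * s + \<kappa>, l:]" by simp
  have F0: "F \<noteq> 0" using F(1) by auto
  have "0 < degree [:l * s + \<kappa>, l:]" using l by simp
  from expansion_starts[OF psi(1,2) st\<psi> this F0] obtain n K where
    nK: "W F = enat n" "gauss W \<omega> (adic \<psi> F) = enat n" "starts (\<Phi> F) n (pcompose K [:l * s + \<kappa>, l:])"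
    "\<And>i. coeff K i \<noteq> 0 \<longleftrightarrow> W (coeff (adic \<psi> F) i) + enat (i * \<omega>) = enat n"
    "\<And>i. i * \<omega> \<le> n \<Longrightarrow> coeff K i = coeff (fps_nth (\<Phi> (coeff (adic \<psi> F) i)) (n - i * \<omega>)) 0"
    by metis
  have n: "n = N * \<omega>" using nK(1) WF by simp
  interpret ex: expansion v \<psi> F N by (rule expansion[OF N2])
  have K: "coeff K N = 1" "coeff K (N - 1) = 0"
    using nK(5)[of N] nK(5)[of "N - 1"] psi(4) by (simp_all add: n ex.co_N)
  have "pcompose K [:l * s + \<kappa>, l:] = smult C (\<Prod>w\<in>unity_roots N. [:s - w ^ c * s, 1:])"
    using nK(3) stF unfolding n starts_def by simp
  note res = pcompose_monic_linear_prod[OF l K C this]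
  have "W (coeff (adic \<psi> F) 0) = enat (N * \<omega>)"
    using nK(4)[of 0] res(2) by (simp add: n zero_enat_def[symmetric])
  moreover have "enat (N * \<omega>) \<le> W (coeff (adic \<psi> F) i) + enat (i * \<omega>)" for i
    using gauss_le[of W \<omega> "adic \<psi> F" i] nK(2) n by simp
  moreover have "starts (\<Phi> \<psi>) \<omega> [:l * s, l:]" using st\<psi> res(1) by simp
  ultimately show ?thesis using that[OF l _ \<omega>] by blast
qed

text \<open>Setting \<open>u = 0\<close> returns to \<open>S\<close> itself, and the order is
  unchanged as long as the initial form survives there.\<close>

lemma nu_of_starts:
  assumes "starts (\<Phi> H) n h" "coeff h 0 \<noteq> 0"
  shows "ord (ev d S H) = enat n"
proof -
  have "fps_nth (ev d S H) k = coeff (fps_nth (\<Phi> H) k) 0" for k by (simp add: coeff_generic_nth_0)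
  then show ?thesis using assms unfolding starts_def ord_eq_iff by simp
qed

lemma nu_small: "degree a < e \<Longrightarrow> ord (ev d S a) = W a"
proof (cases "a = 0")
  case True
  then show ?thesis
    using comm_ring_morphism.zero[OF Phi_morphism] comm_ring_morphism.zero[OF ev_morphism[OF d_pos]]
    by (simp add: ord_def)
next
  case False
  assume "degree a < e"
  then show ?thesis using small_starts[OF False] by metis
qed

text \<open>The constant coefficient has \<open>v\<close>-value \<omega>, so the slope has
  denominator \<open>N div gcd N c\<close>, which is not 1 as \<open>N\<close> does not divide
  \<open>c\<close>. The exponent \<open>c\<close> is now absorbed, hence the bound
  \<open>Suc c\<close> of the next stage.\<close>

lemma advance:
  obtains q m where "(real N, real (the_enat (v F))) \<in> newton_polygon v \<psi> F"
    "straight N (newton_polygon v \<psi> F)" "slope_fraction (straight_slope N (newton_polygon v \<psi> F)) = (q, m)"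
    "q \<noteq> 1" "0 < q" "irreducible_stage (next_valuation q m \<psi> v) d S F (N div q) (e * q) (Suc c)"
proof -
  interpret ex: expansion v \<psi> F N by (rule expansion[OF N2])
  obtain \<omega> l where l: "l \<noteq> 0" and st: "starts (\<Phi> \<psi>) \<omega> [:l * s, l:]" and \<omega>: "\<not> N dvd \<omega>" "gcd N \<omega> = gcd N c"
    and line: "\<And>i. enat (N * \<omega>) \<le> W (ex.co i) + enat (i * \<omega>)" and zero: "W (ex.co 0) = enat (N * \<omega>)"
    by (rule psi_starts) blast
  have dpsi: "lead_coeff \<psi> = 1" "degree \<psi> = e" using psi[OF N2] by auto
  have W_small: "W a = enat N * v a" if "degree a < e" for a
    using nu_small[OF that] \<nu>_eq[OF that] by simp
  have W_co: "W (ex.co i) = enat N * v (ex.co i)" for i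
    using ex.degree_coeff_adic[of F i] dpsi by (intro W_small) simp
  have nu_psi': "ord (ev d S \<psi>) = enat \<omega>" using l c(1) by (intro nu_of_starts[OF st]) simp
  have "enat N * enat \<omega> = enat N * v (ex.co 0)" using zero W_co by simp
  then have v0: "v (ex.co 0) = enat \<omega>" using enat_mult_eq_cancel[OF N0] by metis
  have "enat N * v \<psi> \<le> enat \<omega>" using \<nu>_ge[of \<psi>] nu_psi' by simp
  then have "N * ex.V \<le> \<omega>" by (subst (asm) ex.vpsi) simp
  \<comment> \<open>Equality would make \<omega> a multiple of \<open>N\<close>.\<close>
  then have less: "N * ex.V < \<omega>" using \<omega>(1) by (metis dvd_triv_left le_neq_implies_less)
  note sI = ex.straightI[OF v0 less line[unfolded W_co]]
  obtain q m where qm: "0 < q" "0 < m" "coprime q m" "q dvd N"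
    "slope_fraction (straight_slope N (newton_polygon v \<psi> F)) = (q, m)"
    "\<And>i. enat (N * (q * ex.V + m)) \<le> enat q * v (ex.co i) + enat (i * (q * ex.V + m))"
    "enat q * v (ex.co 0) = enat (N * (q * ex.V + m))"
    using ex.straightD[OF sI(1,2)] by metis
  have q: "q = N div gcd N \<omega>" using sI(3) qm(5) by auto
  define g where "g = gcd N \<omega>"
  have g: "N = q * g" "0 < g" "N div q = g"
  proof -
    show N: "N = q * g" unfolding q g_def by simp
    show "0 < g" using N0 by (simp add: g_def)
    show "N div q = g" by (subst N) (use qm(1) in simp)
  qed
  have q1: "q \<noteq> 1"
  proof
    assume "q = 1"
    then have "N = gcd N \<omega>" using g by (simp add: g_def)
    then show False using \<omega>(1) by (metis gcd_dvd2)
  qed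
  note next_stage = step[OF N2 qm(1-4,6,7)]
  have next_stage': "stage (next_valuation q m \<psi> v) (\<lambda>H. ord (ev d S H)) F (N div q) (e * q) (N div q)"
    using next_stage(2) .
  define \<beta> where "\<beta> = q * ex.V + m"
  have "\<beta> = ex.V * q + m" by (simp add: \<beta>_def mult.commute)
  then have cop: "coprime q \<beta>" using qm(3) by (simp only: coprime_iff_gcd_eq_1 gcd_add_mult)
  have "q * \<omega> = N * \<beta>" using qm(7) v0 by (simp add: \<beta>_def)
  then have \<omega>\<beta>: "\<omega> = g * \<beta>" using g qm(1) by simp
  \<comment> \<open>The initial form of \<open>a\<close> turns out to be a constant times a power of
    l (u + s). Since \<open>s\<close> is nonzero, it does not vanish at u = 0, so \<open>a\<close>
    has the same order along \<open>S\<close> and along the perturbation.\<close>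
  have small': "ord (ev d S a) < ord (coeff (taylor d S a) i) + enat (Suc c * i)"
    if a: "a \<noteq> 0" "degree a < e * q" and i: "0 < i" for a i
  proof -
    have h: "0 < degree [:l * s, l:]" using l by simp
    from expansion_starts[OF dpsi st h a(1)] obtain n K where
      nK: "W a = enat n" "starts (\<Phi> a) n (pcompose K [:l * s, l:])"
      "\<And>i. coeff K i \<noteq> 0 \<longleftrightarrow> W (coeff (adic \<psi> a) i) + enat (i * \<omega>) = enat n"
      by metis
    have lt: "j < q \<and> (\<exists>x. W (coeff (adic \<psi> a) j) = enat (N * x))" if "coeff K j \<noteq> 0" for j
    proof -
      have fin: "W (coeff (adic \<psi> a) j) \<noteq> \<infinity>"
      proof
        assume "W (coeff (adic \<psi> a) j) = \<infinity>"
        then show False using nK(3)[of j] that by simp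
      qed
      have Wj: "W (coeff (adic \<psi> a) j) = enat N * v (coeff (adic \<psi> a) j)"
        using ex.degree_coeff_adic[of a j] dpsi by (intro W_small) simp
      have "coeff (adic \<psi> a) j \<noteq> 0"
      proof
        assume "coeff (adic \<psi> a) j = 0"
        then have "W (coeff (adic \<psi> a) j) = \<infinity>" using valuation.zero[OF W_valuation] by simp
        then show False using fin by simp
      qed
      then have "\<not> degree a < j * degree \<psi>" using ex.coeff_adic_eq_0 by blast
      then have "\<not> degree a < j * e" unfolding dpsi(2) .
      moreover have "degree a < q * e" using a(2) by (simp add: mult.commute)
      ultimately have "j * e < q * e" by linarith
      moreover have "v (coeff (adic \<psi> a) j) \<noteq> \<infinity>"
      proof
        assume "v (coeff (adic \<psi> a) j) = \<infinity>"
        then show False using fin N0 unfolding Wj by (simp add: imult_is_infinity zero_enat_def)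
      qed
      ultimately show ?thesis unfolding Wj by (cases "v (coeff (adic \<psi> a) j)") auto
    qed
    \<comment> \<open>The weights, divided by \<open>g\<close>, differ modulo \<open>q\<close>, so
      only one term attains the minimum and \<open>K\<close> is a monomial.\<close>
    have uniq: "j = k" if jk: "coeff K j \<noteq> 0" "coeff K k \<noteq> 0" for j k
    proof -
      obtain x y where xy: "j < q" "k < q" "W (coeff (adic \<psi> a) j) = enat (N * x)"
        "W (coeff (adic \<psi> a) k) = enat (N * y)"
        using lt[OF jk(1)] lt[OF jk(2)] by blast
      then have "N * x + j * \<omega> = N * y + k * \<omega>" using nK(3)[of j] nK(3)[of k] jk by simp
      then have "g * (q * x + j * \<beta>) = g * (q * y + k * \<beta>)" unfolding \<omega>\<beta> g(1) by (simp add: algebra_simps)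
      then have "q * x + j * \<beta> = q * y + k * \<beta>" using g(2) by simp
      then show ?thesis using linear_combination_unique[OF cop] xy by blast
    qed
    have "K \<noteq> 0"
    proof
      assume "K = 0"
      then have "starts (\<Phi> a) n 0" using nK(2) by simp
      then show False using nK(1) unfolding starts_def ord_eq_iff by simp
    qed
    then obtain j where j: "coeff K j \<noteq> 0" by (metis leading_coeff_0_iff)
    have "K = monom (coeff K j) j"
      using uniq[OF j] by (intro poly_eqI) (metis coeff_monom)
    then have "poly K (l * s) = coeff K j * (l * s) ^ j" by (metis poly_monom)
    then have "coeff (pcompose K [:l * s, l:]) 0 \<noteq> 0"
      using j l c(1) by (simp flip: poly_0_coeff_0 add: poly_pcompose)
    from nu_of_starts[OF nK(2) this] have ev: "ord (ev d S a) = enat n" .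
    \<comment> \<open>The perturbation at \<open>c\<close> gives only the weak bound for the
      coefficient of u^i; passing to \<open>Suc c\<close> adds \<open>i > 0\<close> to the weight
      and makes it strict.\<close>
    have "enat (n - c * i) \<le> ord (coeff (taylor d S a) i)"
      unfolding ord_ge_iff
    proof (intro allI impI)
      fix k assume k: "k < n - c * i"
      have "fps_nth (\<Phi> a) (k + c * i) = 0" using nK(2) k unfolding starts_def by simp
      then have "coeff (fps_nth (\<Phi> a) (k + c * i)) i = 0" by simp
      then show "fps_nth (coeff (taylor d S a) i) k = 0" by (simp add: coeff_generic_nth)
    qed
    then have "enat (n - c * i) + enat (Suc c * i) \<le> ord (coeff (taylor d S a) i) + enat (Suc c * i)"
      by (rule add_right_mono)
    moreover have "enat n < enat (n - c * i) + enat (Suc c * i)" using i by simp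
    ultimately show ?thesis unfolding ev by (rule order_less_le_trans[rotated])
  qed
  have "irreducible_stage (next_valuation q m \<psi> v) d S F (N div q) (e * q) (Suc c)"
  proof (intro irreducible_stage.intro irreducible_stage_axioms.intro next_stage')
    show "d = degree F" "primitive d S" by (rule d_def prim)+
    show "map_poly (pw d) F = (\<Prod>w\<in>unity_roots d. [:- twist w S, 1:])" by (rule F_prod)
    show "(of_nat k :: 'a) \<noteq> 0" if "0 < k" "k \<le> d" for k using char that .
    show "N div q dvd i" if "i < Suc c" "fps_nth S i \<noteq> 0" for i
    proof (cases "i = c")
      case True
      then show ?thesis using g \<omega>(2) by (metis g_def gcd_dvd2)
    next
      case False
      then have "N dvd i" using that c(3) by simp
      then show ?thesis using g by (metis dvd_trans dvd_triv_right)
    qed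
    show "h dvd N div q" if "h dvd d" "\<And>i. i < Suc c \<Longrightarrow> fps_nth S i \<noteq> 0 \<Longrightarrow> h dvd i" for h
    proof -
      have "h dvd N" using dvd_N[OF that(1)] that(2) k0_le by (meson le_SucI less_le_trans)
      moreover have "h dvd c" using that(2) c(1) by blast
      ultimately show ?thesis unfolding g(3) g_def \<omega>(2) by simp
    qed
    show "ord (ev d S a) < ord (coeff (taylor d S a) i) + enat (Suc c * i)"
      if "a \<noteq> 0" "degree a < e * q" "0 < i" for a i
      by (rule small'[OF that])
  qed
  then show ?thesis using that[OF sI(1,2) qm(5) q1 qm(1)] by blast
qed

end

section \<open>The whole loop, by induction on \<open>N\<close>\<close>

lemma irreducible_stage_loop:
  assumes "irreducible_stage v d S F N e k"
  shows "abhyankar_loop F N v"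
  using assms
proof (induction N arbitrary: v e k rule: less_induct)
  case (less N)
  interpret st: irreducible_stage v d S F N e k by (rule less.prems)
  show ?case
  proof (cases "2 \<le> N")
    case False
    then show ?thesis by (subst abhyankar_loop.simps) simp
  next
    case True
    \<comment> \<open>As \<open>N\<close> divides \<open>d\<close> and exceeds 1, primitivity
      supplies an exponent not divisible by \<open>N\<close>; the least one is the next
      characteristic exponent.\<close>
    have "N dvd d" using st.F st.d_def by simp
    then have ex: "\<exists>i. fps_nth S i \<noteq> 0 \<and> \<not> N dvd i"
      using st.prim True unfolding primitive_def by auto
    define c where "c = (LEAST i. fps_nth S i \<noteq> 0 \<and> \<not> N dvd i)"
    have "fps_nth S c \<noteq> 0 \<and> \<not> N dvd c" unfolding c_def using ex by (rule LeastI_ex)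
    moreover have "N dvd i" if "i < c" "fps_nth S i \<noteq> 0" for i
      using not_less_Least[of i "\<lambda>i. fps_nth S i \<noteq> 0 \<and> \<not> N dvd i"] that unfolding c_def by blast
    ultimately interpret irreducible_step v d S F N e k c by unfold_locales auto
    obtain q m where qm: "(real N, real (the_enat (v F))) \<in> newton_polygon v st.\<psi> F"
      "straight N (newton_polygon v st.\<psi> F)" "slope_fraction (straight_slope N (newton_polygon v st.\<psi> F)) = (q, m)"
      "q \<noteq> 1" "irreducible_stage (next_valuation q m st.\<psi> v) d S F (N div q) (e * q) (Suc c)"
      by (rule advance)
    have "abhyankar_loop F (N div q) (next_valuation q m st.\<psi> v)"
      using less.IH[OF _ qm(5)] div_less_of_ne_one[of N q] True qm(4) by simp
    then show ?thesis
      using True qm by (subst abhyankar_loop.simps) (simp add: Let_def st.\<psi>_def)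
  qed
qed

text \<open>Every round moves a factor \<open>q\<close> from \<open>c\<close> to \<open>e\<close>,
  so \<open>c * e\<close> is constant; when the loop ends with \<open>N = 1\<close>,
  \<open>e\<close> is the degree of \<open>F\<close>.\<close>

lemma stage_loop_degree:
  assumes "stage v \<nu> F N e c" "abhyankar_loop F N v"
  shows "degree F dvd c * e"
  using assms
proof (induction N arbitrary: v e c rule: less_induct)
  case (less N)
  interpret stage v \<nu> F N e c by (rule less.prems)
  show ?case
  proof (cases "2 \<le> N")
    case False
    then have "N = 1" using pos by simp
    then show ?thesis using F by simp
  next
    case True
    interpret ex: expansion v \<psi> F N by (rule expansion[OF True])
    have loop: "(real N, real (the_enat (v F))) \<in> ex.P" "straight N ex.P"
      "case slope_fraction (straight_slope N ex.P) of (q, m) \<Rightarrow>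
           q \<noteq> 1 \<and> abhyankar_loop F (N div q) (next_valuation q m \<psi> v)"
      using less.prems(2) True
      by (subst (asm) abhyankar_loop.simps; simp add: Let_def \<psi>_def split: if_splits prod.splits)+
    obtain q m where qm: "0 < q" "0 < m" "coprime q m" "q dvd N"
      "slope_fraction (straight_slope N ex.P) = (q, m)"
      "\<And>i. enat (N * (q * ex.V + m)) \<le> enat q * v (ex.co i) + enat (i * (q * ex.V + m))"
      "enat q * v (ex.co 0) = enat (N * (q * ex.V + m))"
      using ex.straightD[OF loop(1,2)] by metis
    note next_stage = step[OF True qm(1-4,6,7)]
    have rec: "q \<noteq> 1" "abhyankar_loop F (N div q) (next_valuation q m \<psi> v)"
      using loop(3) qm(5) by auto
    have "N div q < N" using div_less_of_ne_one[of N q] True rec by simp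
    from less.IH[OF this next_stage(2) rec(2)] have "degree F dvd c div q * (e * q)" .
    also have "c div q * (e * q) = c * e" using next_stage(1) by (metis dvd_div_mult_self mult.assoc mult.commute)
    finally show ?thesis .
  qed
qed

section \<open>The first stage\<close>

text \<open>In contrast to \<open>aug_mult_nonzero\<close> no division follows, so the coefficient
  \<open>i + j\<close> itself has the value of the initial product.\<close>

lemma gauss_valuation:
  assumes v: "valuation v" and strict: "\<And>a. v a = \<infinity> \<Longrightarrow> a = 0"
  shows "valuation (gauss v \<mu>)" "gauss v \<mu> A = \<infinity> \<Longrightarrow> A = 0"
proof -
  interpret valuation v by (rule v)
  have zero: "gauss v \<mu> 0 = \<infinity>" unfolding gauss_def by simp
  show strict': "A = 0" if "gauss v \<mu> A = \<infinity>" for A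
  proof (rule ccontr)
    assume "A \<noteq> 0"
    then have "v (lead_coeff A) \<noteq> \<infinity>" using strict[of "lead_coeff A"] by (metis leading_coeff_0_iff)
    then show False using gauss_le[of v \<mu> A "degree A"] that by (cases "v (lead_coeff A)") auto
  qed
  show "valuation (gauss v \<mu>)"
  proof
    show "gauss v \<mu> 0 = \<infinity>" by (rule zero)
    have "initial_at v \<mu> 1 0 0"
      unfolding initial_at_def by (auto simp: coeff_1 zero_enat_def[symmetric])
    then show "gauss v \<mu> 1 = 0" by (simp add: gauss_eq_initial zero_enat_def)
    fix A B
    show "gauss v \<mu> (A * B) = gauss v \<mu> A + gauss v \<mu> B"
    proof (cases "A = 0 \<or> B = 0")
      case True
      then show ?thesis using zero by auto
    next
      case False
      then obtain w i u j where A: "initial_at v \<mu> A w i" "gauss v \<mu> A = enat w"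
        and B: "initial_at v \<mu> B u j" "gauss v \<mu> B = enat u"
        using strict' by (metis initial_exists)
      note prod = initial_at_mult[OF v A(1) B(1)]
      obtain R where R: "coeff (A * B) (i + j) = coeff A i * coeff B j + R"
        "enat (w + u) < v R + enat ((i + j) * \<mu>)" using prod(3) by blast
      have val: "v (coeff A i * coeff B j) + enat ((i + j) * \<mu>) = enat (w + u)"
      proof -
        have "enat w + enat u = (v (coeff A i) + enat (i * \<mu>)) + (v (coeff B j) + enat (j * \<mu>))"
          using A(1) B(1) unfolding initial_at_def by simp
        then show ?thesis
          by (simp add: mult algebra_simps plus_enat_simps(1)[symmetric] del: plus_enat_simps)
      qed
      then have "v (coeff A i * coeff B j) < v R"
        using R(2) by (cases "v (coeff A i * coeff B j)"; cases "v R") auto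
      then have "v (coeff (A * B) (i + j)) = v (coeff A i * coeff B j)"
        unfolding R(1) by (rule add_eq)
      then have "initial_at v \<mu> (A * B) (w + u) (i + j)"
        unfolding initial_at_def using prod(1,2) val by auto
      then show ?thesis using A B by (simp add: gauss_eq_initial)
    qed
    show "min (gauss v \<mu> A) (gauss v \<mu> B) \<le> gauss v \<mu> (A + B)"
    proof (rule gauss_geI)
      fix i
      have "min (gauss v \<mu> A) (gauss v \<mu> B) \<le>
          min (v (coeff A i) + enat (i * \<mu>)) (v (coeff B i) + enat (i * \<mu>))"
        by (intro min.mono gauss_le)
      also have "\<dots> = min (v (coeff A i)) (v (coeff B i)) + enat (i * \<mu>)" by (rule min_add_enat)
      also have "\<dots> \<le> v (coeff (A + B) i) + enat (i * \<mu>)"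
        unfolding coeff_add by (intro add_right_mono add_ge)
      finally show "min (gauss v \<mu> A) (gauss v \<mu> B) \<le> v (coeff (A + B) i) + enat (i * \<mu>)" .
    qed
  qed
qed

lemma x_valuation_conv_gauss: "x_valuation = gauss ord 0"
  by (rule ext) (simp add: x_valuation_def gauss_def ord_def zero_enat_def[symmetric])

lemma ord_infinity: "ord f = \<infinity> \<Longrightarrow> f = 0"
  by (auto simp: ord_def split: if_splits)

lemma ord_pw: "0 < m \<Longrightarrow> ord (pw m f) = enat m * ord f"
  by (auto simp: ord_def subdegree_pw imult_is_infinity zero_enat_def)

lemma x_valuation_le: "x_valuation H \<le> ord (coeff H i)"
  using gauss_le[of ord 0 H i] by (simp add: x_valuation_conv_gauss zero_enat_def[symmetric])

lemma x_valuation_geI: "(\<And>i. k \<le> ord (coeff H i)) \<Longrightarrow> k \<le> x_valuation H"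
  unfolding x_valuation_conv_gauss by (rule gauss_geI) (simp add: zero_enat_def[symmetric])

text \<open>Polynomials of degree below 1 are series in x, whose order is multiplied by
  \<open>m\<close> under x = t^m. The base polynomial is \<open>y\<close>; it and the monic
  \<open>F\<close> both have x-valuation 0.\<close>

lemma first_stage:
  fixes F :: "'a::field fps poly"
  assumes F: "lead_coeff F = 1" "0 < degree F" "(of_nat (degree F) :: 'a) \<noteq> 0"
    and m: "0 < m" "ev m S F = 0"
  shows "stage x_valuation (\<lambda>H. ord (ev m S H)) F (degree F) 1 m"
proof (intro stage.intro stage_axioms.intro)
  show val: "valuation x_valuation"
    unfolding x_valuation_conv_gauss by (intro gauss_valuation valuation_ord ord_infinity)
  show nu: "valuation (\<lambda>H. ord (ev m S H))"
    by (rule valuation_morphism[OF valuation_ord ev_morphism[OF m(1)]])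
  show "lead_coeff F = 1" "degree F = degree F * 1" "0 < degree F" "(0::nat) < 1" "0 < m"
    "(of_nat (degree F) :: 'a) \<noteq> 0" using F m by auto
  show "ord (ev m S F) = \<infinity>" using m by (simp add: ord_def)
  show "x_valuation H = \<infinity> \<Longrightarrow> H = 0" for H
    unfolding x_valuation_conv_gauss using gauss_valuation(2)[OF valuation_ord ord_infinity] .
  show "enat m * x_valuation H \<le> ord (ev m S H)" for H
  proof -
    have eq: "ev m S H = (\<Sum>i\<le>degree H. pw m (coeff H i) * S ^ i)"
      unfolding ev_def poly_altdef map_pw_degree[OF m(1)]
      by (simp add: comm_ring_morphism.coeff_map[OF pw_morphism[OF m(1)]])
    have "enat m * x_valuation H \<le> ord (pw m (coeff H i) * S ^ i)" for i
    proof -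
      have "enat m * x_valuation H \<le> ord (pw m (coeff H i))"
        unfolding ord_pw[OF m(1)] by (intro mult_left_mono x_valuation_le) simp
      also have "\<dots> \<le> ord (pw m (coeff H i)) + ord (S ^ i)" by simp
      finally show ?thesis by (simp add: valuation.mult[OF valuation_ord])
    qed
    then show ?thesis unfolding eq by (intro valuation.sum_ge[OF valuation_ord])
  qed
  show "ord (ev m S a) = enat m * x_valuation a" if "degree a < 1" for a
  proof -
    have "degree a = 0" using that by simp
    then obtain f where a: "a = [:f:]" by (rule degree_eq_zeroE)
    have "x_valuation a = ord f"
    proof (rule antisym)
      show "x_valuation a \<le> ord f" using x_valuation_le[of a 0] by (simp add: a)
      show "ord f \<le> x_valuation a"
        by (rule x_valuation_geI) (auto simp: a coeff_pCons ord_def split: nat.splits)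
    qed
    moreover have "ev m S a = pw m f"
      unfolding ev_def a by (simp add: comm_ring_morphism.map_poly_pCons'[OF pw_morphism[OF m(1)]])
    ultimately show ?thesis by (simp add: ord_pw[OF m(1)])
  qed
  have xv: "x_valuation G = 0" if "coeff G i = 1" for G :: "'a fps poly" and i
    using x_valuation_le[of G i] that by (simp add: ord_def zero_enat_def[symmetric])
  have "x_valuation F = 0" using F(1) by (rule xv)
  moreover have "x_valuation ([:0, 1:] :: 'a fps poly) = 0" by (rule xv[of _ 1]) simp
  moreover have "division_stable x_valuation ([:0, 1:] :: 'a fps poly)"
    unfolding division_stable_def
  proof (intro allI impI)
    fix q r :: "'a fps poly" assume "degree r < degree ([:0, 1:] :: 'a fps poly)"
    then have "degree r = 0" by simp
    then obtain f where r: "r = [:f:]" by (rule degree_eq_zeroE)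
    show "x_valuation (q * [:0, 1:] + r) \<le> x_valuation (q * [:0, 1:])"
    proof (rule x_valuation_geI)
      fix i
      show "x_valuation (q * [:0, 1:] + r) \<le> ord (coeff (q * [:0, 1:]) i)"
        using x_valuation_le[of "q * [:0, 1:] + r" i]
        by (cases i) (auto simp: r ord_def coeff_pCons)
    qed
  qed
  ultimately show "\<exists>P :: 'a fps poly. lead_coeff P = 1 \<and> degree P = 1 \<and> division_stable x_valuation P \<and>
      x_valuation F = enat (degree F) * x_valuation P"
    by (intro exI[of _ "[:0, 1:] :: 'a fps poly"]) simp
qed

text \<open>If the test succeeds, the degree of \<open>F\<close> divides the degree \<open>m\<close>
  of a branch; as \<open>m\<close> is at most that degree, the branch accounts for all of
  \<open>F\<close>.\<close>

theorem abhyankar_test_alg_closed: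
  fixes F :: "'a::alg_closed_field fps poly"
  assumes F: "lead_coeff F = 1" "0 < degree F"
    and char: "\<And>k. 0 < k \<Longrightarrow> k \<le> degree F \<Longrightarrow> (of_nat k :: 'a) \<noteq> 0"
  shows "abhyankar_test F \<longleftrightarrow> Factorial_Ring.irreducible F"
proof -
  obtain m S where m: "0 < m" "m \<le> degree F" "primitive m S" "ev m S F = 0"
    and irr: "Factorial_Ring.irreducible F \<longleftrightarrow> m = degree F"
    and prod: "m = degree F \<Longrightarrow> map_poly (pw m) F = (\<Prod>w\<in>unity_roots m. [:- twist w S, 1:])"
    using irreducible_parametrization[OF assms] by blast
  have stage: "stage x_valuation (\<lambda>H. ord (ev m S H)) F (degree F) 1 m"
    by (rule first_stage[OF F char m(1,4)]) (use F in auto)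
  show ?thesis
  proof
    assume "abhyankar_test F"
    then have "degree F dvd m * 1"
      unfolding abhyankar_test_def by (rule stage_loop_degree[OF stage])
    then have "m = degree F" using m by (auto dest: dvd_imp_le)
    then show "Factorial_Ring.irreducible F" using irr by simp
  next
    assume "Factorial_Ring.irreducible F"
    then have md: "m = degree F" using irr by simp
    \<comment> \<open>With \<open>k\<^sub>0\<close> equal to 0 no exponent has been read yet, and
      the gcd \<open>N\<close> is \<open>d\<close> itself.\<close>
    have "irreducible_stage x_valuation m S F (degree F) 1 0"
    proof (intro irreducible_stage.intro irreducible_stage_axioms.intro)
      show "stage x_valuation (\<lambda>H. ord (ev m S H)) F (degree F) 1 (degree F)"
        using stage md by simp
      show "ord (ev m S a) < ord (coeff (taylor m S a) i) + enat (0 * i)"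
        if a: "a \<noteq> 0" "degree a < 1" "0 < i" for a i
      proof -
        have "degree a = 0" using a(2) by simp
        then obtain f where af: "a = [:f:]" by (rule degree_eq_zeroE)
        have "taylor m S a = [:pw m f:]"
          unfolding taylor_def af by (simp add: comm_ring_morphism.map_poly_pCons'[OF pw_morphism[OF m(1)]])
        then have "coeff (taylor m S a) i = 0" using a(3) by (cases i) auto
        moreover have "ev m S a \<noteq> 0"
          unfolding ev_def af using a(1) m(1)
          by (simp add: comm_ring_morphism.map_poly_pCons'[OF pw_morphism[OF m(1)]] af)
        ultimately show ?thesis by (simp add: ord_def)
      qed
    qed (use md m prod char in auto)
    then show "abhyankar_test F"
      unfolding abhyankar_test_def by (rule irreducible_stage_loop)
  qed
qed

section \<open>Passing to the algebraic closure\<close>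

definition ac_fps :: "'a::field fps \<Rightarrow> 'a alg_closure fps" where
  "ac_fps f = Abs_fps (\<lambda>n. to_ac (fps_nth f n))"

lemma ac_fps_nth [simp]: "fps_nth (ac_fps f) n = to_ac (fps_nth f n)"
  by (simp add: ac_fps_def)

lemma ac_fps_morphism: "comm_ring_morphism ac_fps"
proof
  show "ac_fps (a * b) = ac_fps a * ac_fps b" for a b :: "'a fps"
    by (rule fps_ext) (simp add: fps_mult_nth to_ac_sum)
qed (auto intro!: fps_ext)

lemma ac_fps_eq_0_iff [simp]: "ac_fps f = 0 \<longleftrightarrow> f = 0"
  by (auto simp: fps_eq_iff)

lemma ord_ac_fps: "ord (ac_fps f) = ord f"
proof (cases "f = 0")
  case False
  then have "subdegree (ac_fps f) = subdegree f" by (intro subdegreeI) auto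
  then show ?thesis using False by (simp add: ord_def)
qed (simp add: ord_def)

abbreviation (input) bc :: "'a::field fps poly \<Rightarrow> 'a alg_closure fps poly" where
  "bc \<equiv> base_change_ac"

lemma bc_def: "bc = map_poly ac_fps"
  unfolding base_change_ac_def ac_fps_def ..

lemma bc_morphism: "comm_ring_morphism bc"
  unfolding bc_def by (rule comm_ring_morphism.map_poly_morphism[OF ac_fps_morphism])

interpretation bc: comm_ring_morphism bc by (rule bc_morphism)

lemma coeff_bc: "coeff (bc H) i = ac_fps (coeff H i)"
  unfolding bc_def by (rule comm_ring_morphism.coeff_map[OF ac_fps_morphism])

lemma degree_bc [simp]: "degree (bc H) = degree H"
  unfolding bc_def by (rule degree_map_poly) simp

lemma bc_eq_0_iff [simp]: "bc H = 0 \<longleftrightarrow> H = 0"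
  by (auto simp: poly_eq_iff coeff_bc)

lemma bc_monic: "lead_coeff H = 1 \<Longrightarrow> lead_coeff (bc H) = 1"
  by (simp add: coeff_bc comm_ring_morphism.one[OF ac_fps_morphism])

lemma is_approx_root_bc: "is_approx_root N F \<psi> \<Longrightarrow> is_approx_root N (bc F) (bc \<psi>)"
  unfolding is_approx_root_def bc.power[symmetric] bc.diff[symmetric] degree_bc bc_eq_0_iff
  using bc_monic[of \<psi>] unfolding degree_bc by blast

text \<open>The iteration starts at y^e and carries no condition beyond being monic of degree
  \<open>e\<close>.\<close>

lemma approx_root_exists:
  fixes F :: "'a::field fps poly"
  assumes "lead_coeff F = 1" "degree F = N * e" "(of_nat N :: 'a) \<noteq> 0" "2 \<le> N" "0 < e"
  shows "is_approx_root N F (approx_root N F)"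
proof -
  have "\<exists>\<psi>. (lead_coeff \<psi> = 1 \<and> degree \<psi> = e) \<and> is_approx_root N F \<psi>"
  proof (rule is_approx_root_induct[OF assms])
    show "lead_coeff (monom 1 e :: 'a fps poly) = 1 \<and> degree (monom 1 e :: 'a fps poly) = e"
      by (simp add: degree_monom_eq)
    fix P b :: "'a fps poly" assume P: "lead_coeff P = 1 \<and> degree P = e" and b: "degree b < e"
    define b' where "b' = smult (fps_const (1 / of_nat N)) b"
    have P': "lead_coeff P = 1" "degree P = e" using P by auto
    have "degree b' < degree P" using b P' unfolding b'_def by (metis degree_smult_le order_le_less_trans)
    then have "lead_coeff (P + b') = 1 \<and> degree (P + b') = e"
      using P' lead_coeff_add_le[of b' P] by (simp add: degree_add_eq_left add.commute)
    then show "lead_coeff (P + smult (fps_const (1 / of_nat N)) b) = 1 \<and>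
        degree (P + smult (fps_const (1 / of_nat N)) b) = e" unfolding b'_def .
  qed
  then obtain \<psi> where \<psi>: "is_approx_root N F \<psi>" by blast
  then have "approx_root N F = \<psi>"
    by (rule approx_rootI) (use assms in auto)
  with \<psi> show ?thesis by simp
qed

lemma approx_root_bc:
  fixes F :: "'a::field fps poly"
  assumes "lead_coeff F = 1" "degree F = N * e" "(of_nat N :: 'a) \<noteq> 0" "2 \<le> N" "0 < e"
  shows "approx_root N (bc F) = bc (approx_root N F)"
proof (rule approx_rootI)
  show "is_approx_root N (bc F) (bc (approx_root N F))"
    by (intro is_approx_root_bc approx_root_exists[OF assms])
  have "(of_nat N :: 'a alg_closure) = to_ac (of_nat N)" by simp
  then show "(of_nat N :: 'a alg_closure) \<noteq> 0" using assms(3) by (metis to_ac_eq_0_iff)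
qed (use assms in auto)

lemma adic_bc:
  assumes "lead_coeff \<psi> = 1" "0 < degree \<psi>"
  shows "adic (bc \<psi>) (bc H) = map_poly bc (adic \<psi> H)"
proof -
  interpret a: monic_poly \<psi> by unfold_locales (use assms in auto)
  interpret b: monic_poly "bc \<psi>" by unfold_locales (use assms bc_monic in auto)
  show ?thesis
  proof (rule b.adicI)
    show "reduced (bc \<psi>) (map_poly bc (adic \<psi> H))"
      using a.degree_coeff_adic[of H] unfolding reduced_def by simp
    show "poly (map_poly bc (adic \<psi> H)) (bc \<psi>) = bc H"
      by (simp add: bc.poly_map_poly a.poly_adic)
  qed
qed

lemma adic_expansion_bc:
  assumes "lead_coeff \<psi> = 1" "0 < degree \<psi>"
  shows "adic_expansion (bc \<psi>) (bc H) i = bc (adic_expansion \<psi> H i)"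
  using assms bc_monic[OF assms(1)]
  by (simp add: adic_expansion_conv_adic adic_bc)

text \<open>The slope is an integer divided by \<open>N\<close>, so its reduced denominator divides
  \<open>N\<close>. Natural ordinates suffice for this, which suits the arbitrary function
  \<open>v\<close> of \<open>abhyankar_loop_bc\<close>.\<close>

lemma straight_slope_dvd:
  assumes I: "finite I" and N: "0 < N" and h: "\<And>i. h i = real (k i)"
    and B: "(real N, real b) \<in> lower_edges (quadrant_hull I h)"
    and st: "straight N (lower_edges (quadrant_hull I h))"
    and qm: "slope_fraction (straight_slope N (lower_edges (quadrant_hull I h))) = (q, m)"
  shows "q dvd N" "0 < q"
proof -
  note D = straight_lower_edgesD[OF I N B st]
  have less: "b < k 0" using D(3) h by simp
  obtain q' m' where r: "0 < q'" "coprime q' m'" "m' * N = (k 0 - b) * q'" "q' dvd N"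
    using reduced_fraction[of "k 0 - b" N] less N by (metis zero_less_diff)
  have "real m' * real N = (real (k 0) - real b) * real q'"
    using r(3) less by (metis of_nat_diff of_nat_mult less_imp_le)
  then have "(real b - h 0) / real N = - (real m' / real q')"
    using r(1) N h by (simp add: field_simps)
  then have "straight_slope N (lower_edges (quadrant_hull I h)) = - (real m' / real q')"
    unfolding D(2) straight_slope_segment[OF N] .
  then have "(q, m) = (q', m')" using qm slope_fraction_eq[OF r(1,2)] by simp
  then show "q dvd N" "0 < q" using r by auto
qed

text \<open>The loop evaluates its valuation only at polynomials built from \<open>F\<close>, which
  over the closure are base changes. Compatibility of \<open>v'\<close> with \<open>v\<close> on
  these is inherited by the next valuations, and divisibility of the degree by \<open>N\<close>
  keeps \<open>N\<close> invertible.\<close>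

lemma abhyankar_loop_bc:
  fixes F :: "'a::field fps poly"
  assumes F: "lead_coeff F = 1" "0 < degree F"
    and char: "\<And>k. 0 < k \<Longrightarrow> k \<le> degree F \<Longrightarrow> (of_nat k :: 'a) \<noteq> 0"
    and "\<And>H. v' (bc H) = v H" "N dvd degree F" "0 < N"
  shows "abhyankar_loop (bc F) N v' = abhyankar_loop F N v"
  using assms(4-)
proof (induction N arbitrary: v v' rule: less_induct)
  case (less N)
  show ?case
  proof (cases "2 \<le> N")
    case False
    then show ?thesis by (subst (1 2) abhyankar_loop.simps) simp
  next
    case True
    obtain e where e: "degree F = N * e" using less.prems by blast
    then have e0: "0 < e" and Ne: "N \<le> degree F" using F by auto
    have N: "(of_nat N :: 'a) \<noteq> 0" using char[OF less.prems(3) Ne] .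
    define \<psi> where "\<psi> = approx_root N F"
    have "is_approx_root N F \<psi>"
      unfolding \<psi>_def by (rule approx_root_exists[OF F(1) e N True e0])
    then have \<psi>: "lead_coeff \<psi> = 1" "0 < degree \<psi>"
      using e e0 less.prems unfolding is_approx_root_def by auto
    have root: "approx_root N (bc F) = bc \<psi>"
      unfolding \<psi>_def by (rule approx_root_bc[OF F(1) e N True e0])
    note ad = adic_expansion_bc[OF \<psi>]
    have val: "v' (adic_expansion (bc \<psi>) (bc H) i * bc \<psi> ^ i) = v (adic_expansion \<psi> H i * \<psi> ^ i)" for H i
      unfolding ad by (simp only: less.prems(1) flip: bc.mult bc.power)
    have np: "newton_polygon v' (bc \<psi>) (bc F) = newton_polygon v \<psi> F"
      unfolding newton_polygon_conv_lower_edges val unfolding ad by simp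
    have nv: "next_valuation q m (bc \<psi>) v' (bc H) = next_valuation q m \<psi> v H" for q m H
      unfolding next_valuation_def val ..
    define P where "P = newton_polygon v \<psi> F"
    show ?thesis
    proof (cases "(real N, real (the_enat (v F))) \<in> P \<and> straight N P")
      case False
      then show ?thesis
        by (subst (1 2) abhyankar_loop.simps) (simp add: Let_def root np less.prems(1) \<psi>_def[symmetric] P_def[symmetric])
    next
      case st: True
      obtain q m where qm: "slope_fraction (straight_slope N P) = (q, m)" by force
      have fin: "finite {i. adic_expansion \<psi> F i \<noteq> 0}"
        unfolding adic_expansion_conv_adic[OF \<psi>]
        by (rule finite_subset[of _ "{..degree (adic \<psi> F)}"]) (auto simp: le_degree)
      have q: "q dvd N" "0 < q"
        using straight_slope_dvd[OF fin less.prems(3) refl, of "the_enat (v F)"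
            "\<lambda>i. the_enat (v (adic_expansion \<psi> F i * \<psi> ^ i))" q m] st qm
        unfolding P_def newton_polygon_conv_lower_edges by auto
      have rec: "abhyankar_loop (bc F) (N div q) (next_valuation q m (bc \<psi>) v') =
          abhyankar_loop F (N div q) (next_valuation q m \<psi> v)" if "q \<noteq> 1"
      proof (rule less.IH)
        show "N div q < N" using div_less_of_ne_one[of N q] True that by simp
        show "next_valuation q m (bc \<psi>) v' (bc H) = next_valuation q m \<psi> v H" for H by (rule nv)
        have "N div q dvd N" using q by (metis dvd_triv_left dvd_mult_div_cancel dvd_triv_right)
        then show "N div q dvd degree F" using less.prems(2) dvd_trans by blast
        show "0 < N div q" using q less.prems(3) by (simp add: dvd_imp_le div_greater_zero_iff)
      qed
      show ?thesis
        using st rec qm True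
        by (subst (1 2) abhyankar_loop.simps)
          (simp add: Let_def root np less.prems(1) \<psi>_def[symmetric] P_def[symmetric])
    qed
  qed
qed

lemma x_valuation_bc: "x_valuation (bc H) = x_valuation H"
  unfolding x_valuation_conv_gauss gauss_def by (simp add: coeff_bc ord_ac_fps)

theorem proposition13:
  fixes F :: "'a::field fps poly" and d :: nat
  assumes "perfect_field TYPE('a)"
    and "CHAR('a) = 0 \<or> CHAR('a) > d"
    and "Polynomial.degree F = d"
    and "d \<ge> 1"
    and "weierstrass F"
    and "squarefree F"
  shows "abhyankar_test F \<longleftrightarrow> Factorial_Ring.irreducible (base_change_ac F)"
proof -
  have F: "lead_coeff F = 1" "0 < degree F" using assms by (auto simp: weierstrass_def)
  have char: "(of_nat k :: 'a) \<noteq> 0" if "0 < k" "k \<le> degree F" for k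
    using assms(2,3) that by (auto simp: of_nat_eq_0_iff_char_dvd dest: dvd_imp_le)
  have char': "(of_nat k :: 'a alg_closure) \<noteq> 0" if "0 < k" "k \<le> degree (bc F)" for k
  proof -
    have "(of_nat k :: 'a alg_closure) = to_ac (of_nat k)" by simp
    then show ?thesis using char[of k] that by (metis degree_bc to_ac_eq_0_iff)
  qed
  have "abhyankar_test F \<longleftrightarrow> abhyankar_test (bc F)"
    unfolding abhyankar_test_def degree_bc
    using abhyankar_loop_bc[where v = x_valuation and v' = x_valuation and N = "degree F", OF F char x_valuation_bc] F(2)
    by simp
  also have "\<dots> \<longleftrightarrow> Factorial_Ring.irreducible (bc F)"
    by (rule abhyankar_test_alg_closed[OF bc_monic[OF F(1)] _ char']) (use F in simp_all)
  finally show ?thesis .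
qed

end
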